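(* Let $r,r'\in\mathbb{Z}_2$ and let $s,t\geq 1$ be integers. The following isomorphisms of $D_4$-modules hold. (1) If $s+t$ is even and $s\geq t$, then $\Omega^{s}V(r)\otimes\Omega^{-t}V(r')\cong\Omega^{s-t}V(r+r')\oplus(s+1)tP(r+r'+1)$. (2) If $s+t$ is odd and $s\geq t$, then $\Omega^{s}V(r)\otimes\Omega^{-t}V(r')\cong\Omega^{s-t}V(r+r')\oplus(s+1)tP(r+r')$. (3) If $s+t$ is even and $s<t$, then $\Omega^{s}V(r)\otimes\Omega^{-t}V(r')\cong\Omega^{s-t}V(r+r')\oplus(t+1)sP(r+r'+1)$. (4) If $s+t$ is odd and $s<t$, then $\Omega^{s}V(r)\otimes\Omega^{-t}V(r')\cong\Omega^{s-t}V(r+r')\oplus(t+1)sP(r+r')$.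
   Context: Let $k$ be an algebraically closed field with $\mathrm{char}(k)\neq 2$. All modules are finite-dimensional left modules; $\otimes=\otimes_k$; $\mathbb{Z}_2=\mathbb{Z}/2\mathbb{Z}$; $nM$ denotes the direct sum of $n$ copies of $M$. $D_4$ is the $k$-algebra generated by $a,b,c,d$ subject to $ba=-ab$, $db=-bd$, $ca=-ac$, $dc=-cd$, $bc=cb$, $a^2=0$, $b^2=1$, $c^2=1$, $d^2=0$, $da+ad=1-bc$. It is a $16$-dimensional Hopf algebra (isomorphic to the Drinfeld double of Sweedler's 4-dimensional Hopf algebra) with comultiplication $\Delta(a)=a\otimes b+1\otimes a$, $\Delta(b)=b\otimes b$, $\Delta(c)=c\otimes c$, $\Delta(d)=d\otimes c+1\otimes d$, counit $\varepsilon(a)=\varepsilon(d)=0$, $\varepsilon(b)=\varepsilon(c)=1$, antipode $S(a)=-ab$, $S(b)=b$, $S(c)=c$, $S(d)=-dc$. Tensor products of $D_4$-modules are $D_4$-modules via $\Delta$. For $r\in\mathbb{Z}_2$, $V(r)$ is the one-dimensional simple module on which $a,d$ act as $0$ and $b,c$ act as $(-1)^r$, and $P(r)$ is the projective cover of $V(r)$ (it is 4-dimensional and is also the injective envelope of $V(r)$). For a module $M$, $\Omega M$ is the kernel of a projective cover $P(M)\to M$ and $\Omega^{-1}M$ is the cokernel of an injective envelope $M\to I(M)$; for $s\geq1$, $\Omega^{s}$ and $\Omega^{-s}$ are the $s$-fold iterates of $\Omega$ and $\Omega^{-1}$; and $\Omega^0V(r)=V(r)$. *)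

theory Defs
  imports
    "HOL-Computational_Algebra.Computational_Algebra"
    "HOL-Library.Z2"
    "Jordan_Normal_Form.Matrix"
    "Jordan_Normal_Form.Matrix_Kernel"
begin

text \<open>
  A finite-dimensional left module over the algebra \<open>D\<^sub>4\<close>, given by the generators
  \<open>a, b, c, d\<close> and the relations below, is a finite-dimensional vector space with four
  endomorphisms that satisfy the relations.  The underlying space of a module \<open>M\<close> is taken to be
  the coordinate space \<open>carrier_vec (mdim M)\<close>, so a generator acts by a square matrix and a
  linear map from \<open>M\<close> to \<open>N\<close> is a matrix with \<open>mdim N\<close> rows and
  \<open>mdim M\<close> columns.
\<close>

datatype d4_gen = Ga | Gb | Gc | Gd

record 'k d4_mod =
  mdim :: nat
  act :: "d4_gen \<Rightarrow> 'k mat"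

definition d4_module :: "'k::field d4_mod \<Rightarrow> bool" where
  "d4_module M \<longleftrightarrow>
    (let n = mdim M; a = act M Ga; b = act M Gb; c = act M Gc; d = act M Gd in
      (\<forall>g. act M g \<in> carrier_mat n n) \<and>
      b * a = - (a * b) \<and> d * b = - (b * d) \<and> c * a = - (a * c) \<and> d * c = - (c * d) \<and>
      b * c = c * b \<and>
      a * a = 0\<^sub>m n n \<and> b * b = 1\<^sub>m n \<and> c * c = 1\<^sub>m n \<and> d * d = 0\<^sub>m n n \<and>
      d * a + a * d = 1\<^sub>m n - b * c)"


subsection \<open>Homomorphisms and submodules\<close>

definition d4_hom :: "'k::field d4_mod \<Rightarrow> 'k d4_mod \<Rightarrow> 'k mat \<Rightarrow> bool" where
  "d4_hom M N F \<longleftrightarrow>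
    F \<in> carrier_mat (mdim N) (mdim M) \<and> (\<forall>g. F * act M g = act N g * F)"

definition d4_iso :: "'k::field d4_mod \<Rightarrow> 'k d4_mod \<Rightarrow> bool"  (infix \<open>\<cong>\<^sub>D\<close> 50) where
  "M \<cong>\<^sub>D N \<longleftrightarrow>
    (\<exists>F G. d4_hom M N F \<and> d4_hom N M G \<and> G * F = 1\<^sub>m (mdim M) \<and> F * G = 1\<^sub>m (mdim N))"

definition mat_image :: "'k::field mat \<Rightarrow> 'k vec set" where
  "mat_image F = (\<lambda>v. F *\<^sub>v v) ` carrier_vec (dim_col F)"

definition d4_mono :: "'k::field d4_mod \<Rightarrow> 'k d4_mod \<Rightarrow> 'k mat \<Rightarrow> bool" where
  "d4_mono M N F \<longleftrightarrow> d4_hom M N F \<and> inj_on (\<lambda>v. F *\<^sub>v v) (carrier_vec (mdim M))"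

definition d4_epi :: "'k::field d4_mod \<Rightarrow> 'k d4_mod \<Rightarrow> 'k mat \<Rightarrow> bool" where
  "d4_epi M N F \<longleftrightarrow> d4_hom M N F \<and> mat_image F = carrier_vec (mdim N)"

definition d4_submodule :: "'k::field d4_mod \<Rightarrow> 'k vec set \<Rightarrow> bool" where
  "d4_submodule M U \<longleftrightarrow>
    U \<subseteq> carrier_vec (mdim M) \<and> 0\<^sub>v (mdim M) \<in> U \<and>
    (\<forall>u\<in>U. \<forall>v\<in>U. u + v \<in> U) \<and> (\<forall>x. \<forall>u\<in>U. x \<cdot>\<^sub>v u \<in> U) \<and>
    (\<forall>g. \<forall>u\<in>U. act M g *\<^sub>v u \<in> U)"


subsection \<open>Direct sums and tensor products\<close>

definition d4_sum :: "'k::field d4_mod \<Rightarrow> 'k d4_mod \<Rightarrow> 'k d4_mod"  (infixr \<open>\<oplus>\<^sub>D\<close> 65) where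
  "M \<oplus>\<^sub>D N =
    \<lparr> mdim = mdim M + mdim N,
      act = (\<lambda>g. four_block_mat (act M g) (0\<^sub>m (mdim M) (mdim N))
                                (0\<^sub>m (mdim N) (mdim M)) (act N g)) \<rparr>"

definition d4_zero :: "'k::field d4_mod" where
  "d4_zero = \<lparr> mdim = 0, act = (\<lambda>g. 0\<^sub>m 0 0) \<rparr>"

definition d4_copies :: "nat \<Rightarrow> 'k::field d4_mod \<Rightarrow> 'k d4_mod"  (infixr \<open>\<odot>\<^sub>D\<close> 70) where
  "n \<odot>\<^sub>D M = ((\<lambda>N. M \<oplus>\<^sub>D N) ^^ n) d4_zero"

text \<open>
  The Kronecker product is the matrix of the tensor product of two linear maps, for the
  basis vectors \<open>e\<^sub>i \<otimes> e\<^sub>j\<close> in lexicographic order.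
\<close>

definition kron :: "'k::field mat \<Rightarrow> 'k mat \<Rightarrow> 'k mat" where
  "kron A B =
    mat (dim_row A * dim_row B) (dim_col A * dim_col B)
      (\<lambda>(i, j). A $$ (i div dim_row B, j div dim_col B) * B $$ (i mod dim_row B, j mod dim_col B))"

text \<open>
  The action on a tensor product comes from the comultiplication
  \<open>\<Delta>(a) = a \<otimes> b + 1 \<otimes> a\<close>, \<open>\<Delta>(b) = b \<otimes> b\<close>,
  \<open>\<Delta>(c) = c \<otimes> c\<close>, \<open>\<Delta>(d) = d \<otimes> c + 1 \<otimes> d\<close>.
\<close>

definition d4_tensor :: "'k::field d4_mod \<Rightarrow> 'k d4_mod \<Rightarrow> 'k d4_mod"  (infixr \<open>\<otimes>\<^sub>D\<close> 70) where
  "M \<otimes>\<^sub>D N =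
    \<lparr> mdim = mdim M * mdim N,
      act = (\<lambda>g. case g of
          Ga \<Rightarrow> kron (act M Ga) (act N Gb) + kron (1\<^sub>m (mdim M)) (act N Ga)
        | Gb \<Rightarrow> kron (act M Gb) (act N Gb)
        | Gc \<Rightarrow> kron (act M Gc) (act N Gc)
        | Gd \<Rightarrow> kron (act M Gd) (act N Gc) + kron (1\<^sub>m (mdim M)) (act N Gd)) \<rparr>"


subsection \<open>Projective covers, injective envelopes and syzygies\<close>

definition d4_projective :: "'k::field d4_mod \<Rightarrow> bool" where
  "d4_projective P \<longleftrightarrow> d4_module P \<and>
    (\<forall>M N f h. d4_module M \<and> d4_module N \<and> d4_epi M N f \<and> d4_hom P N h \<longrightarrow>
      (\<exists>h'. d4_hom P M h' \<and> f * h' = h))"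

definition d4_injective :: "'k::field d4_mod \<Rightarrow> bool" where
  "d4_injective I \<longleftrightarrow> d4_module I \<and>
    (\<forall>M N f h. d4_module M \<and> d4_module N \<and> d4_mono M N f \<and> d4_hom M I h \<longrightarrow>
      (\<exists>h'. d4_hom N I h' \<and> h' * f = h))"

text \<open>A projective cover is an epimorphism from a projective module with superfluous kernel.\<close>

definition projective_cover :: "'k::field d4_mod \<Rightarrow> 'k mat \<Rightarrow> 'k d4_mod \<Rightarrow> bool" where
  "projective_cover P f M \<longleftrightarrow> d4_projective P \<and> d4_epi P M f \<and>
    (\<forall>U. d4_submodule P U \<and> {u + w | u w. u \<in> U \<and> w \<in> mat_kernel f} = carrier_vec (mdim P)
      \<longrightarrow> U = carrier_vec (mdim P))"

text \<open>An injective envelope is a monomorphism into an injective module with essential image.\<close>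

definition injective_envelope :: "'k::field d4_mod \<Rightarrow> 'k mat \<Rightarrow> 'k d4_mod \<Rightarrow> bool" where
  "injective_envelope I f M \<longleftrightarrow> d4_injective I \<and> d4_mono M I f \<and>
    (\<forall>U. d4_submodule I U \<and> U \<inter> mat_image f = {0\<^sub>v (mdim I)} \<longrightarrow> U = {0\<^sub>v (mdim I)})"

definition is_syzygy :: "'k::field d4_mod \<Rightarrow> 'k d4_mod \<Rightarrow> bool" where
  "is_syzygy M K \<longleftrightarrow> d4_module K \<and>
    (\<exists>P f i. projective_cover P f M \<and> d4_mono K P i \<and> mat_image i = mat_kernel f)"

definition is_cosyzygy :: "'k::field d4_mod \<Rightarrow> 'k d4_mod \<Rightarrow> bool" where
  "is_cosyzygy M C \<longleftrightarrow> d4_module C \<and>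
    (\<exists>I f p. injective_envelope I f M \<and> d4_epi I C p \<and> mat_kernel p = mat_image f)"

text \<open>
  Syzygies, cosyzygies and projective covers are determined only up to isomorphism;
  Hilbert choice picks a representative.
\<close>

definition syzygy :: "'k::field d4_mod \<Rightarrow> 'k d4_mod" where
  "syzygy M = (SOME K. is_syzygy M K)"

definition cosyzygy :: "'k::field d4_mod \<Rightarrow> 'k d4_mod" where
  "cosyzygy M = (SOME C. is_cosyzygy M C)"

definition Omega :: "int \<Rightarrow> 'k::field d4_mod \<Rightarrow> 'k d4_mod" where
  "Omega n M = (if n \<ge> 0 then (syzygy ^^ nat n) M else (cosyzygy ^^ nat (- n)) M)"


subsection \<open>The modules \<open>V(r)\<close> and \<open>P(r)\<close>\<close>

definition V :: "bit \<Rightarrow> 'k::field d4_mod" where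
  "V r =
    (let s = (if r = 0 then 1 else - 1) in
      \<lparr> mdim = 1,
        act = (\<lambda>g. case g of Ga \<Rightarrow> 0\<^sub>m 1 1 | Gb \<Rightarrow> s \<cdot>\<^sub>m 1\<^sub>m 1 | Gc \<Rightarrow> s \<cdot>\<^sub>m 1\<^sub>m 1 | Gd \<Rightarrow> 0\<^sub>m 1 1) \<rparr>)"

definition P :: "bit \<Rightarrow> 'k::field d4_mod" where
  "P r = (SOME Q. \<exists>f. projective_cover Q f (V r))"

end

theory Submission
  imports Defs "HOL-Library.Function_Algebras"
begin

text \<open>
  Only modules with \<open>b = c\<close> occur, that is, \<open>\<int>\<^sub>2\<close>-graded modules over the exterior algebra on
  \<open>a, d\<close>.  The syzygy \<open>\<Omega>\<^sup>s V(r)\<close> has a basis \<open>e\<^sub>0, \<dots>, e\<^sub>s\<close> of its top and \<open>f\<^sub>0, \<dots>, f\<^bsub>s-1\<^esub>\<close>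
  of its socle with \<open>a e\<^sub>i = f\<^sub>i\<close>, \<open>d e\<^sub>i = f\<^bsub>i-1\<^esub>\<close>.  Transposing all matrices is a duality that is
  compatible with tensor products, exchanges \<open>\<Omega>\<close> with \<open>\<Omega>\<^sup>-\<^sup>1\<close> and fixes \<open>V(r)\<close>, so
  \<open>\<Omega>\<^sup>-\<^sup>t V(r')\<close> has a basis \<open>g\<^sub>0, \<dots>, g\<^bsub>t-1\<^esub>\<close>, \<open>h\<^sub>0, \<dots>, h\<^sub>t\<close> with \<open>a g\<^sub>j = h\<^sub>j\<close>,
  \<open>d g\<^sub>j = h\<^bsub>j+1\<^esub>\<close>.  For \<open>s \<ge> t\<close> the map \<open>e\<^sub>i \<otimes> h\<^sub>j \<mapsto> e\<^bsub>i-j\<^esub>\<close> extends to an epimorphism of the tensor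
  product onto \<open>\<Omega>\<^bsup>s-t\<^esup> V(r + r')\<close> that kills the elements \<open>e\<^sub>i \<otimes> g\<^sub>j\<close>.  These generate a free
  submodule, because \<open>a d\<close> maps them to linearly independent elements; it splits off and has the
  complementary dimension.  The case \<open>s < t\<close> follows by duality and the symmetry of the tensor product.
\<close>

subsection \<open>Matrices\<close>

text \<open>Projectivity and injectivity are tested against all \<open>D\<^sub>4\<close>-modules,
  also those where b and c differ. Two facts bridge this gap: a vector v on which b and c both act
  by the sign of r satisfies d a v = - a d v, and char k \<noteq> 2 allows projecting onto such
  vectors. Since \<Omega> and \<open>P\<close> are Hilbert choices, they are replaced by explicit
  models through uniqueness of covers, envelopes, kernels and cokernels. The duality avoids the
  antipode: relations and comultiplication are invariant under the anti-automorphism fixing a, b, c,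
  d, so it preserves tensor products in the given order. Hence the dual of a syzygy times a cosyzygy
  is a cosyzygy times a syzygy, and the factors have to be swapped; the sign rule of graded spaces
  does this because b = c. The multiplicity (s + 1) t is the number of pairs (e_i, g_j), and (2 s +
  1)(2 t + 1) = 2 (s - t) + 1 + 4 (s + 1) t shows that nothing else is left over.\<close>

unbundle no Formal_Power_Series.fps_syntax

text \<open>
  Membership in a carrier is reduced to equations between dimensions; together with the
  destruction rules of the library this would loop.
\<close>
declare carrier_vecD [simp del] carrier_matD [simp del]

lemma carrier_vec_iff [simp]: "v \<in> carrier_vec n \<longleftrightarrow> dim_vec v = n"
  by (auto simp: carrier_vec_def)

lemma carrier_mat_iff [simp]: "A \<in> carrier_mat n m \<longleftrightarrow> dim_row A = n \<and> dim_col A = m"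
  by (auto simp: carrier_mat_def)

text \<open>The side conditions are equations between dimensions, which simplification can
  discharge; in the carrier form the dimensions would have to be guessed. The same holds for the
  laws below.\<close>

lemma mult_assoc_dim:
  "dim_col A = dim_row B \<Longrightarrow> dim_col B = dim_row C \<Longrightarrow> A * B * C = A * (B * (C :: 'k::field mat))"
  by (rule assoc_mult_mat[of _ "dim_row A" "dim_row B" _ "dim_row C" _ "dim_col C"]) auto

lemma mult_vec_assoc_dim:
  "dim_col A = dim_row B \<Longrightarrow> dim_col B = dim_vec v \<Longrightarrow> A * B *\<^sub>v v = A *\<^sub>v (B *\<^sub>v (v :: 'k::field vec))"
  by (rule assoc_mult_mat_vec[of _ "dim_row A" "dim_row B" _ "dim_vec v"]) auto

lemma mult_add_distrib_dim:
  "dim_col A = dim_row B \<Longrightarrow> dim_row B = dim_row C \<Longrightarrow> dim_col B = dim_col C \<Longrightarrow>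
    A * (B + C) = A * B + A * (C :: 'k::field mat)"
  by (rule mult_add_distrib_mat[of _ "dim_row A" "dim_row B" _ "dim_col B"]) auto

lemma add_mult_distrib_dim:
  "dim_col A = dim_row C \<Longrightarrow> dim_row A = dim_row B \<Longrightarrow> dim_col A = dim_col B \<Longrightarrow>
    (A + B) * C = A * C + B * (C :: 'k::field mat)"
  by (rule add_mult_distrib_mat[of _ "dim_row A" "dim_row C" _ _ "dim_col C"]) auto

lemma mult_minus_distrib_dim:
  "dim_col A = dim_row B \<Longrightarrow> dim_row B = dim_row C \<Longrightarrow> dim_col B = dim_col C \<Longrightarrow>
    A * (B - C) = A * B - A * (C :: 'k::field mat)"
  by (rule mult_minus_distrib_mat[of _ "dim_row A" "dim_row B" _ "dim_col B"]) auto

lemma minus_mult_distrib_dim: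
  "dim_col A = dim_row C \<Longrightarrow> dim_row A = dim_row B \<Longrightarrow> dim_col A = dim_col B \<Longrightarrow>
    (A - B) * C = A * C - B * (C :: 'k::field mat)"
  by (rule minus_mult_distrib_mat[of _ "dim_row A" "dim_row C" _ _ "dim_col C"]) auto

lemma uminus_mult_dim:
  "dim_col A = dim_row B \<Longrightarrow> - A * B = - (A * (B :: 'k::field mat))"
  "dim_col A = dim_row B \<Longrightarrow> A * - B = - (A * (B :: 'k::field mat))"
  by auto

lemma one_mult_dim:
  "dim_row A = n \<Longrightarrow> 1\<^sub>m n * A = (A :: 'k::field mat)"
  "dim_col A = n \<Longrightarrow> A * 1\<^sub>m n = A"
  by (auto intro: left_mult_one_mat' right_mult_one_mat')

lemma zero_mult_dim:
  "dim_row A = m \<Longrightarrow> 0\<^sub>m n m * A = 0\<^sub>m n (dim_col (A :: 'k::field mat))"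
  "dim_col A = m \<Longrightarrow> A * 0\<^sub>m m n = 0\<^sub>m (dim_row A) n"
  by auto

lemma mult_vec_add_dim:
  "dim_col A = dim_vec v \<Longrightarrow> dim_vec v = dim_vec w \<Longrightarrow> A *\<^sub>v (v + w) = A *\<^sub>v v + A *\<^sub>v (w :: 'k::field vec)"
  by (rule mult_add_distrib_mat_vec[of _ "dim_row A" "dim_vec v"]) auto

lemma mult_vec_minus_dim:
  "dim_col A = dim_vec v \<Longrightarrow> dim_vec v = dim_vec w \<Longrightarrow> A *\<^sub>v (v - w) = A *\<^sub>v v - A *\<^sub>v (w :: 'k::field vec)"
  by (rule mult_minus_distrib_mat_vec[of _ "dim_row A" "dim_vec v"]) auto

lemma add_mult_vec_dim:
  "dim_col A = dim_vec v \<Longrightarrow> dim_row A = dim_row B \<Longrightarrow> dim_col A = dim_col B \<Longrightarrow>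
     (A + B) *\<^sub>v v = A *\<^sub>v v + B *\<^sub>v (v :: 'k::field vec)"
  by (rule add_mult_distrib_mat_vec[of _ "dim_row A" "dim_vec v"]) auto

lemma minus_mult_vec_dim:
  "dim_col A = dim_vec v \<Longrightarrow> dim_row A = dim_row B \<Longrightarrow> dim_col A = dim_col B \<Longrightarrow>
     (A - B) *\<^sub>v v = A *\<^sub>v v - B *\<^sub>v (v :: 'k::field vec)"
  by (rule minus_mult_distrib_mat_vec[of _ "dim_row A" "dim_vec v"]) auto

lemma mult_vec_smult_dim:
  "dim_col A = dim_vec v \<Longrightarrow> A *\<^sub>v (c \<cdot>\<^sub>v v) = c \<cdot>\<^sub>v (A *\<^sub>v (v :: 'k::field vec))"
  by (rule mult_mat_vec[of _ "dim_row A" "dim_vec v"]) auto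

lemma mult_vec_uminus_dim:
  "dim_col A = dim_vec v \<Longrightarrow> A *\<^sub>v (- v) = - (A *\<^sub>v (v :: 'k::field vec))"
  by (intro eq_vecI) auto

lemma smult_mult_vec_dim:
  "dim_col A = dim_vec v \<Longrightarrow> (c \<cdot>\<^sub>m A) *\<^sub>v v = c \<cdot>\<^sub>v (A *\<^sub>v (v :: 'k::field vec))"
  by (intro eq_vecI) auto

lemma mult_vec_zero_dim: "dim_col A = n \<Longrightarrow> A *\<^sub>v 0\<^sub>v n = (0\<^sub>v (dim_row A) :: 'k::field vec)"
  by (intro eq_vecI) auto

lemma zero_mult_vec_dim: "dim_vec v = m \<Longrightarrow> 0\<^sub>m n m *\<^sub>v v = (0\<^sub>v n :: 'k::field vec)"
  by (intro eq_vecI) auto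

lemma one_mult_vec_dim: "dim_vec v = n \<Longrightarrow> 1\<^sub>m n *\<^sub>v v = (v :: 'k::field vec)"
  by (rule one_mult_mat_vec) auto

lemmas mat_vec_dim = mult_vec_assoc_dim mult_vec_add_dim mult_vec_minus_dim add_mult_vec_dim
  minus_mult_vec_dim mult_vec_smult_dim mult_vec_uminus_dim smult_mult_vec_dim mult_vec_zero_dim
  zero_mult_vec_dim one_mult_vec_dim

lemma mult_unit_vec:
  fixes A :: "'k::field mat"
  assumes "k < dim_col A"
  shows "A *\<^sub>v unit_vec (dim_col A) k = col A k"
  using assms by (intro eq_vecI) auto

lemma mult_unit_vec_dim:
  "dim_col A = n \<Longrightarrow> k < n \<Longrightarrow> A *\<^sub>v unit_vec n k = col A k" for A :: "'k::field mat"
  using mult_unit_vec[of k A] by simp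

lemma mat_eqI_unit_vec:
  fixes A B :: "'k::field mat"
  assumes "dim_row A = dim_row B" "dim_col A = n" "dim_col B = n"
    and "\<And>k. k < n \<Longrightarrow> A *\<^sub>v unit_vec n k = B *\<^sub>v unit_vec n k"
  shows "A = B"
proof (rule eq_matI)
  fix i j assume ij: "i < dim_row B" "j < dim_col B"
  then have "col A j = col B j"
    using assms(4)[of j] mult_unit_vec[of j A] mult_unit_vec[of j B] assms by simp
  then have "col A j $ i = col B j $ i" by simp
  then show "A $$ (i, j) = B $$ (i, j)" using ij assms by simp
qed (use assms in auto)

lemma mat_eqI_vec:
  fixes A B :: "'k::field mat"
  assumes "dim_row A = dim_row B" "dim_col A = n" "dim_col B = n"
    and "\<And>v. dim_vec v = n \<Longrightarrow> A *\<^sub>v v = B *\<^sub>v v"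
  shows "A = B"
  using assms by (intro mat_eqI_unit_vec[of A B n]) auto

section \<open>Matrices given by columns, images, kernels and one-sided inverses\<close>

definition colmat :: "nat \<Rightarrow> nat \<Rightarrow> (nat \<Rightarrow> 'k vec) \<Rightarrow> 'k::field mat" where
  "colmat n m c = mat n m (\<lambda>(i, j). c j $ i)"

lemma dim_colmat [simp]: "dim_row (colmat n m c) = n" "dim_col (colmat n m c) = m"
  by (auto simp: colmat_def)

lemma colmat_unit_vec:
  assumes "k < m" "dim_vec (c k) = n"
  shows "colmat n m c *\<^sub>v unit_vec m k = c k"
  using mult_unit_vec[of k "colmat n m c"] assms by (intro eq_vecI) (auto simp: colmat_def)

lemma mat_image_iff: "w \<in> mat_image A \<longleftrightarrow> (\<exists>v. dim_vec v = dim_col A \<and> w = A *\<^sub>v v)"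
  by (auto simp: mat_image_def)

lemma mat_kernel_iff: "w \<in> mat_kernel A \<longleftrightarrow> dim_vec w = dim_col A \<and> A *\<^sub>v w = 0\<^sub>v (dim_row A)"
  by (auto simp: mat_kernel_def)

text \<open>A preimage under \<open>B\<close> is chosen for each column of \<open>A\<close>; these
  preimages are the columns of \<open>C\<close>.\<close>

lemma factor_through_image:
  fixes A B :: "'k::field mat"
  assumes "dim_row A = dim_row B"
    and "\<And>v. dim_vec v = dim_col A \<Longrightarrow> A *\<^sub>v v \<in> mat_image B"
  obtains C where "C \<in> carrier_mat (dim_col B) (dim_col A)" "B * C = A"
proof -
  have "\<forall>k. \<exists>w. k < dim_col A \<longrightarrow> dim_vec w = dim_col B \<and> A *\<^sub>v unit_vec (dim_col A) k = B *\<^sub>v w"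
    using assms(2) by (force simp: mat_image_iff)
  then obtain c where c: "\<And>k. k < dim_col A \<Longrightarrow> dim_vec (c k) = dim_col B"
      "\<And>k. k < dim_col A \<Longrightarrow> A *\<^sub>v unit_vec (dim_col A) k = B *\<^sub>v c k"
    by metis
  let ?C = "colmat (dim_col B) (dim_col A) c"
  have "B * ?C = A"
    by (rule mat_eqI_unit_vec[where n = "dim_col A"])
       (use assms c in \<open>auto simp: mat_vec_dim colmat_unit_vec\<close>)
  then show ?thesis by (intro that[of ?C]) auto
qed

lemma surj_right_inverse:
  fixes A :: "'k::field mat"
  assumes "mat_image A = carrier_vec (dim_row A)"
  obtains R where "R \<in> carrier_mat (dim_col A) (dim_row A)" "A * R = 1\<^sub>m (dim_row A)"
proof -
  obtain R where "R \<in> carrier_mat (dim_col A) (dim_col (1\<^sub>m (dim_row A) :: 'k mat))"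
      "A * R = 1\<^sub>m (dim_row A)"
    by (rule factor_through_image[of "1\<^sub>m (dim_row A)" A])
       (use assms in \<open>auto simp: one_mult_vec_dim\<close>)
  then show ?thesis using that by simp
qed

lemma right_inverse_surj:
  fixes A R :: "'k::field mat"
  assumes "R \<in> carrier_mat (dim_col A) (dim_row A)" "A * R = 1\<^sub>m (dim_row A)"
  shows "mat_image A = carrier_vec (dim_row A)"
proof -
  have "w \<in> mat_image A" if "dim_vec w = dim_row A" for w
  proof -
    have "A *\<^sub>v (R *\<^sub>v w) = w"
      using assms that mult_vec_assoc_dim[of A R w] by (auto simp: one_mult_vec_dim)
    then show ?thesis using assms by (auto simp: mat_image_iff intro!: exI[of _ "R *\<^sub>v w"])
  qed
  then show ?thesis by (auto simp: mat_image_iff)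
qed

lemma left_inverse_inj:
  fixes A L :: "'k::field mat"
  assumes "L \<in> carrier_mat (dim_col A) (dim_row A)" "L * A = 1\<^sub>m (dim_col A)"
  shows "inj_on (\<lambda>v. A *\<^sub>v v) (carrier_vec (dim_col A))"
proof (rule inj_on_inverseI[of _ "\<lambda>v. L *\<^sub>v v"])
  fix v :: "'k vec" assume "v \<in> carrier_vec (dim_col A)"
  then show "L *\<^sub>v (A *\<^sub>v v) = v"
    using assms mult_vec_assoc_dim[of L A v] by (auto simp: one_mult_vec_dim)
qed

lemma injI_kernel:
  fixes A :: "'k::field mat"
  assumes "\<And>v. dim_vec v = dim_col A \<Longrightarrow> A *\<^sub>v v = 0\<^sub>v (dim_row A) \<Longrightarrow> v = 0\<^sub>v (dim_col A)"
  shows "inj_on (\<lambda>v. A *\<^sub>v v) (carrier_vec (dim_col A))"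
proof (rule inj_onI)
  fix v w assume vw: "v \<in> carrier_vec (dim_col A)" "w \<in> carrier_vec (dim_col A)" "A *\<^sub>v v = A *\<^sub>v w"
  then have "v - w = 0\<^sub>v (dim_col A)"
    by (intro assms) (auto simp: mat_vec_dim)
  then have *: "(v - w) $ i = 0" if "i < dim_col A" for i using that by simp
  show "v = w" using vw * by (intro eq_vecI) auto
qed

lemma inj_mat_cancel:
  fixes A B C :: "'k::field mat"
  assumes "inj_on (\<lambda>v. A *\<^sub>v v) (carrier_vec (dim_col A))"
    and "dim_row B = dim_col A" "dim_row C = dim_col A" "A * B = A * C"
  shows "B = C"
proof -
  have d: "dim_col B = dim_col C"
    using arg_cong[OF assms(4), of dim_col] by simp
  show ?thesis
  proof (rule mat_eqI_vec[where n = "dim_col B"])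
    fix v :: "'k vec" assume "dim_vec v = dim_col B"
    then have "A *\<^sub>v (B *\<^sub>v v) = A *\<^sub>v (C *\<^sub>v v)"
      using assms d by (metis mult_vec_assoc_dim)
    then show "B *\<^sub>v v = C *\<^sub>v v"
      using assms by (auto simp: inj_on_def)
  qed (use assms d in auto)
qed

lemma sum_apply: "(\<Sum>i\<in>A. f i) x = (\<Sum>i\<in>A. f i x)" for f :: "'i \<Rightarrow> 'a \<Rightarrow> 'b::comm_monoid_add"
  by (induction A rule: infinite_finite_induct) auto

text \<open>
  The library has left inverses of linear maps between whole types only, so a vector is extended by
  zero to a function on all natural numbers.
\<close>
lemma inj_left_inverse:
  fixes A :: "'k::field mat"
  assumes "inj_on (\<lambda>v. A *\<^sub>v v) (carrier_vec (dim_col A))"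
  obtains L where "L \<in> carrier_mat (dim_col A) (dim_row A)" "L * A = 1\<^sub>m (dim_col A)"
proof -
  define n m where "n = dim_row A" and "m = dim_col A"
  define sc :: "'k \<Rightarrow> (nat \<Rightarrow> 'k) \<Rightarrow> nat \<Rightarrow> 'k" where "sc c x = (\<lambda>i. c * x i)" for c x
  interpret vs: vector_space sc
    by unfold_locales (auto simp: sc_def fun_eq_iff algebra_simps)
  interpret vs: vector_space_pair sc sc ..
  define ext :: "'k vec \<Rightarrow> nat \<Rightarrow> 'k" where "ext v = (\<lambda>i. if i < dim_vec v then v $ i else 0)" for v
  define f where "f x = ext (A *\<^sub>v vec m x)" for x :: "nat \<Rightarrow> 'k"
  \<comment> \<open>\<open>f\<close> ignores all coordinates from \<open>m\<close> on, so it can be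
    injective only on \<open>S\<close>.\<close>
  define S where "S = {x :: nat \<Rightarrow> 'k. \<forall>j\<ge>m. x j = 0}"
  have lin: "Vector_Spaces.linear sc sc f"
  proof (unfold_locales)
    fix x y
    have "A *\<^sub>v vec m (x + y) = A *\<^sub>v vec m x + A *\<^sub>v vec m y"
      by (subst mult_vec_add_dim[symmetric]) (auto simp: m_def intro!: arg_cong[of _ _ "(*\<^sub>v) A"] eq_vecI)
    then show "f (x + y) = f x + f y" by (auto simp: f_def ext_def fun_eq_iff)
  next
    fix c x
    have "A *\<^sub>v vec m (sc c x) = c \<cdot>\<^sub>v (A *\<^sub>v vec m x)"
      by (subst mult_vec_smult_dim[symmetric])
         (auto simp: m_def sc_def intro!: arg_cong[of _ _ "(*\<^sub>v) A"] eq_vecI)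
    then show "f (sc c x) = sc c (f x)" by (auto simp: f_def ext_def fun_eq_iff sc_def)
  qed
  have sub: "vs.subspace S"
    by (auto simp: vs.subspace_def S_def sc_def)
  have inj: "inj_on f S"
  proof (rule inj_onI)
    fix x y assume xy: "x \<in> S" "y \<in> S" "f x = f y"
    have "A *\<^sub>v vec m x = A *\<^sub>v vec m y"
    proof (rule eq_vecI)
      fix i assume "i < dim_vec (A *\<^sub>v vec m y)"
      then show "(A *\<^sub>v vec m x) $ i = (A *\<^sub>v vec m y) $ i"
        using fun_cong[OF xy(3), of i] by (simp add: f_def ext_def)
    qed auto
    then have e: "vec m x = vec m y"
      using assms by (auto simp: inj_on_def m_def)
    have "x j = y j" for j
    proof (cases "j < m")
      case True then show ?thesis using arg_cong[OF e, of "\<lambda>v. v $ j"] by simp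
    next
      case False then show ?thesis using xy by (simp add: S_def)
    qed
    then show "x = y" by auto
  qed
  obtain g where g: "Vector_Spaces.linear sc sc g" "\<And>x. x \<in> S \<Longrightarrow> g (f x) = x"
    using vs.linear_exists_left_inverse_on[OF lin sub inj] by blast
  interpret g: Vector_Spaces.linear sc sc g by (rule g(1))
  define \<delta> :: "nat \<Rightarrow> nat \<Rightarrow> 'k" where "\<delta> i = (\<lambda>j. if j = i then 1 else 0)" for i
  \<comment> \<open>Only the first \<open>m\<close> coordinates of \<open>g (\<delta> i)\<close> are
    kept; \<open>g\<close> may have values outside \<open>S\<close>.\<close>
  define L where "L = mat m n (\<lambda>(j, i). g (\<delta> i) j)"
  have "L * A = 1\<^sub>m m"
  proof (rule eq_matI)
    fix j l assume jl: "j < dim_row (1\<^sub>m m)" "l < dim_col (1\<^sub>m m)"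
    have fl: "f (\<delta> l) = (\<Sum>i<n. sc (A $$ (i, l)) (\<delta> i))"
    proof
      fix p
      have "(\<Sum>i<n. sc (A $$ (i, l)) (\<delta> i)) p = (\<Sum>i<n. if i = p then A $$ (i, l) else 0)"
        unfolding sum_apply by (intro sum.cong) (auto simp: sc_def \<delta>_def)
      also have "\<dots> = (if p < n then A $$ (p, l) else 0)" by simp
      also have "\<dots> = f (\<delta> l) p"
      proof -
        have "vec m (\<delta> l) = unit_vec m l" by (intro eq_vecI) (auto simp: \<delta>_def unit_vec_def)
        then show ?thesis using jl mult_unit_vec[of l A]
          by (auto simp: f_def ext_def n_def m_def)
      qed
      finally show "f (\<delta> l) p = (\<Sum>i<n. sc (A $$ (i, l)) (\<delta> i)) p" by simp
    qed
    have "\<delta> l = g (f (\<delta> l))" using jl by (intro g(2)[symmetric]) (auto simp: S_def \<delta>_def)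
    also have "\<dots> = (\<Sum>i<n. sc (A $$ (i, l)) (g (\<delta> i)))"
      unfolding fl by (simp add: g.sum g.scale)
    finally have "\<delta> l j = (\<Sum>i<n. sc (A $$ (i, l)) (g (\<delta> i))) j" by (rule fun_cong)
    also have "\<dots> = (\<Sum>i<n. A $$ (i, l) * g (\<delta> i) j)"
      unfolding sum_apply by (simp add: sc_def)
    finally show "(L * A) $$ (j, l) = 1\<^sub>m m $$ (j, l)"
      using jl by (auto simp: L_def scalar_prod_def n_def m_def \<delta>_def atLeast0LessThan mult.commute)
  qed (auto simp: L_def m_def)
  then show ?thesis by (intro that[of L]) (auto simp: L_def m_def n_def)
qed

lemma square_inverse_commute:
  fixes A B :: "'k::field mat"
  assumes "A \<in> carrier_mat n n" "B \<in> carrier_mat n n" "A * B = 1\<^sub>m n"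
  shows "B * A = 1\<^sub>m n"
  using mat_mult_left_right_inverse assms by blast

subsection \<open>Homomorphisms\<close>

lemma d4_module_dim:
  assumes "d4_module M"
  shows "dim_row (act M g) = mdim M" "dim_col (act M g) = mdim M"
  using assms by (auto simp: d4_module_def Let_def)

lemma d4_hom_iff:
  "d4_hom M N F \<longleftrightarrow>
     dim_row F = mdim N \<and> dim_col F = mdim M \<and> (\<forall>g. F * act M g = act N g * F)"
  by (auto simp: d4_hom_def)

lemma d4_hom_dim:
  assumes "d4_hom M N F"
  shows "dim_row F = mdim N" "dim_col F = mdim M"
  using assms by (auto simp: d4_hom_def)

lemma d4_hom_vec:
  assumes "d4_hom M N F" "d4_module M" "d4_module N" "dim_vec v = mdim M"
  shows "F *\<^sub>v (act M g *\<^sub>v v) = act N g *\<^sub>v (F *\<^sub>v v)"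
  using assms mult_vec_assoc_dim[of F "act M g" v] mult_vec_assoc_dim[of "act N g" F v]
  by (auto simp: d4_hom_iff d4_module_dim)

lemma d4_homI_vec:
  assumes "d4_module M" "d4_module N" "dim_row F = mdim N" "dim_col F = mdim M"
    and "\<And>g v. dim_vec v = mdim M \<Longrightarrow> F *\<^sub>v (act M g *\<^sub>v v) = act N g *\<^sub>v (F *\<^sub>v v)"
  shows "d4_hom M N F"
  unfolding d4_hom_iff
proof (intro conjI allI)
  fix g show "F * act M g = act N g * F"
    by (rule mat_eqI_vec[where n = "mdim M"]) (use assms in \<open>auto simp: d4_module_dim mat_vec_dim\<close>)
qed (use assms in auto)

lemma d4_hom_comp:
  assumes "d4_hom M N F" "d4_hom N K G" "d4_module M" "d4_module N" "d4_module K"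
  shows "d4_hom M K (G * F)"
  by (rule d4_homI_vec) (use assms in \<open>simp_all add: d4_hom_dim d4_module_dim mat_vec_dim d4_hom_vec\<close>)

lemma d4_hom_id:
  assumes "d4_module M"
  shows "d4_hom M M (1\<^sub>m (mdim M))"
  using assms by (simp add: d4_hom_iff d4_module_dim one_mult_dim)

lemma d4_hom_inverse:
  assumes "d4_hom M N F" "d4_module M" "d4_module N" "G \<in> carrier_mat (mdim M) (mdim N)"
    and "G * F = 1\<^sub>m (mdim M)" "F * G = 1\<^sub>m (mdim N)"
  shows "d4_hom N M G"
  unfolding d4_hom_iff
proof (intro conjI allI)
  fix g
  note d = d4_hom_dim[OF assms(1)] d4_module_dim[OF assms(2)] d4_module_dim[OF assms(3)]
  have "G * act N g = G * act N g * (F * G)"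
    using assms d by (simp add: one_mult_dim)
  also have "\<dots> = G * (act N g * F) * G"
    using assms(4) d by (simp add: mult_assoc_dim)
  also have "act N g * F = F * act M g" using assms(1) by (simp add: d4_hom_iff)
  also have "G * (F * act M g) * G = (G * F) * act M g * G"
    using assms(4) d by (simp add: mult_assoc_dim)
  also have "\<dots> = act M g * G"
    using assms d by (simp add: one_mult_dim)
  finally show "G * act N g = act M g * G" .
qed (use assms in auto)

lemma d4_isoI:
  assumes "d4_hom M N F" "d4_module M" "d4_module N" "G \<in> carrier_mat (mdim M) (mdim N)"
    and "G * F = 1\<^sub>m (mdim M)" "F * G = 1\<^sub>m (mdim N)"
  shows "M \<cong>\<^sub>D N"
  unfolding d4_iso_def using assms d4_hom_inverse[OF assms] by blast

lemma d4_isoE: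
  assumes "M \<cong>\<^sub>D N"
  obtains F G where "d4_hom M N F" "d4_hom N M G" "G * F = 1\<^sub>m (mdim M)" "F * G = 1\<^sub>m (mdim N)"
  using assms by (auto simp: d4_iso_def)

lemma d4_iso_refl: "d4_module M \<Longrightarrow> M \<cong>\<^sub>D M"
  unfolding d4_iso_def
  by (intro exI[of _ "1\<^sub>m (mdim M)"] conjI) (simp_all add: d4_hom_id one_mult_dim)

lemma d4_iso_sym: "M \<cong>\<^sub>D N \<Longrightarrow> N \<cong>\<^sub>D M"
  by (auto simp: d4_iso_def)

lemma d4_iso_trans:
  assumes "M \<cong>\<^sub>D N" "N \<cong>\<^sub>D K" and m: "d4_module M" "d4_module N" "d4_module K"
  shows "M \<cong>\<^sub>D K"
proof -
  obtain F G where F: "d4_hom M N F" "d4_hom N M G" "G * F = 1\<^sub>m (mdim M)" "F * G = 1\<^sub>m (mdim N)"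
    using assms(1) by (rule d4_isoE)
  obtain F' G' where F': "d4_hom N K F'" "d4_hom K N G'" "G' * F' = 1\<^sub>m (mdim N)" "F' * G' = 1\<^sub>m (mdim K)"
    using assms(2) by (rule d4_isoE)
  note d = d4_hom_dim[OF F(1)] d4_hom_dim[OF F(2)] d4_hom_dim[OF F'(1)] d4_hom_dim[OF F'(2)]
  have "G * G' * (F' * F) = G * (G' * F') * F" using d by (simp add: mult_assoc_dim)
  then have 1: "G * G' * (F' * F) = 1\<^sub>m (mdim M)" using F F' d by (simp add: one_mult_dim)
  have "F' * F * (G * G') = F' * (F * G) * G'" using d by (simp add: mult_assoc_dim)
  then have 2: "F' * F * (G * G') = 1\<^sub>m (mdim K)" using F F' d by (simp add: one_mult_dim)
  show ?thesis
    unfolding d4_iso_def using 1 2 d4_hom_comp[OF F(1) F'(1) m] d4_hom_comp[OF F'(2) F(2) m(3,2,1)] by blast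
qed

lemma mat_image_submodule:
  assumes "d4_hom M N F" "d4_module M" "d4_module N"
  shows "d4_submodule N (mat_image F)"
proof -
  note d = d4_hom_dim[OF assms(1)] d4_module_dim[OF assms(2)] d4_module_dim[OF assms(3)]
  have z: "0\<^sub>v (mdim N) \<in> mat_image F"
    using d by (auto simp: mat_image_iff mult_vec_zero_dim intro!: exI[of _ "0\<^sub>v (mdim M)"])
  have a: "F *\<^sub>v v + F *\<^sub>v w \<in> mat_image F" if "dim_vec v = mdim M" "dim_vec w = mdim M" for v w
    using that d by (auto simp: mat_image_iff mat_vec_dim intro!: exI[of _ "v + w"])
  have s: "x \<cdot>\<^sub>v (F *\<^sub>v v) \<in> mat_image F" if "dim_vec v = mdim M" for x v
    using that d by (auto simp: mat_image_iff mat_vec_dim intro!: exI[of _ "x \<cdot>\<^sub>v v"])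
  have g: "act N g *\<^sub>v (F *\<^sub>v v) \<in> mat_image F" if "dim_vec v = mdim M" for g v
    using that d assms by (auto simp: mat_image_iff d4_hom_vec intro!: exI[of _ "act M g *\<^sub>v v"])
  show ?thesis
    unfolding d4_submodule_def using z a s g d by (auto simp: mat_image_iff)
qed

lemma mat_kernel_submodule:
  assumes "d4_hom M N F" "d4_module M" "d4_module N"
  shows "d4_submodule M (mat_kernel F)"
proof -
  note d = d4_hom_dim[OF assms(1)] d4_module_dim[OF assms(2)] d4_module_dim[OF assms(3)]
  show ?thesis
    unfolding d4_submodule_def subset_iff Ball_def mat_kernel_iff
    using d d4_hom_vec[OF assms] by (auto simp: mat_vec_dim)
qed


subsection \<open>Uniqueness of syzygies and cosyzygies\<close>

lemma projective_lift:
  assumes "d4_projective Q" "d4_module M" "d4_module N" "d4_epi M N f" "d4_hom Q N h"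
  obtains h' where "d4_hom Q M h'" "f * h' = h"
  using assms unfolding d4_projective_def by metis

lemma injective_extend:
  assumes "d4_injective I" "d4_module M" "d4_module N" "d4_mono M N f" "d4_hom M I h"
  obtains h' where "d4_hom N I h'" "h' * f = h"
  using assms unfolding d4_injective_def by metis

text \<open>\<open>f\<close> lifts through \<open>f'\<close> to \<open>g\<close>. The image of
  \<open>g\<close> and the kernel of \<open>f'\<close> together span \<open>Q'\<close>, so
  \<open>g\<close> is onto; projectivity of \<open>Q'\<close> gives a right inverse
  \<open>h\<close>, and the same argument shows that \<open>h\<close> is onto, hence inverse to
  \<open>g\<close>.\<close>

lemma projective_cover_unique:
  fixes M :: "'k::field d4_mod"
  assumes Q: "projective_cover Q f M" "projective_cover Q' f' M" and M: "d4_module M"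
  obtains g g' where "d4_hom Q Q' g" "d4_hom Q' Q g'" "g' * g = 1\<^sub>m (mdim Q)" "g * g' = 1\<^sub>m (mdim Q')"
    "f' * g = f"
proof -
  have pr: "d4_projective Q" "d4_projective Q'" and m: "d4_module Q" "d4_module Q'"
    and f: "d4_epi Q M f" "d4_epi Q' M f'" "d4_hom Q M f" "d4_hom Q' M f'"
    using Q by (auto simp: projective_cover_def d4_projective_def d4_epi_def)
  have sup: "\<And>U. d4_submodule Q U \<Longrightarrow> {u + w | u w. u \<in> U \<and> w \<in> mat_kernel f} = carrier_vec (mdim Q)
      \<Longrightarrow> U = carrier_vec (mdim Q)"
    and sup': "\<And>U. d4_submodule Q' U \<Longrightarrow> {u + w | u w. u \<in> U \<and> w \<in> mat_kernel f'} = carrier_vec (mdim Q')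
      \<Longrightarrow> U = carrier_vec (mdim Q')"
    using Q unfolding projective_cover_def by blast+
  obtain g where g: "d4_hom Q Q' g" "f' * g = f"
    using projective_lift[OF pr(1) m(2) M f(2) f(3)] .
  note d = d4_hom_dim[OF f(3)] d4_hom_dim[OF f(4)] d4_hom_dim[OF g(1)]
  have fg: "f' *\<^sub>v (g *\<^sub>v v) = f *\<^sub>v v" if "dim_vec v = mdim Q" for v
    using that g(2) d mult_vec_assoc_dim[of f' g v] by simp
  have img: "mat_image g = carrier_vec (mdim Q')"
  proof (rule sup'[OF mat_image_submodule[OF g(1) m]], intro equalityI subsetI)
    fix q :: "'k vec" assume q: "q \<in> carrier_vec (mdim Q')"
    have "f' *\<^sub>v q \<in> mat_image f"
      using f(1) q d by (auto simp: d4_epi_def)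
    then obtain v where v: "dim_vec v = mdim Q" "f' *\<^sub>v q = f *\<^sub>v v"
      using d by (auto simp: mat_image_iff)
    have "q = g *\<^sub>v v + (q - g *\<^sub>v v)"
      using q d by (intro eq_vecI) auto
    moreover have "q - g *\<^sub>v v \<in> mat_kernel f'"
      using q v d by (auto simp: mat_kernel_iff mat_vec_dim fg)
    ultimately show "q \<in> {u + w |u w. u \<in> mat_image g \<and> w \<in> mat_kernel f'}"
      using v d by (auto simp: mat_image_iff)
  qed (use d in \<open>auto simp: mat_kernel_iff mat_image_iff\<close>)
  then have epi: "d4_epi Q Q' g" using g by (simp add: d4_epi_def)
  obtain h where h: "d4_hom Q' Q h" "g * h = 1\<^sub>m (mdim Q')"
    using projective_lift[OF pr(2) m epi d4_hom_id[OF m(2)]] .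
  note d = d d4_hom_dim[OF h(1)]
  have gh: "g *\<^sub>v (h *\<^sub>v v) = v" if "dim_vec v = mdim Q'" for v
    using that h(2) d mult_vec_assoc_dim[of g h v] by (simp add: one_mult_vec_dim)
  have imh: "mat_image h = carrier_vec (mdim Q)"
  proof (rule sup[OF mat_image_submodule[OF h(1) m(2,1)]], intro equalityI subsetI)
    fix q :: "'k vec" assume q: "q \<in> carrier_vec (mdim Q)"
    have "q = h *\<^sub>v (g *\<^sub>v q) + (q - h *\<^sub>v (g *\<^sub>v q))"
      using q d by (intro eq_vecI) auto
    moreover have "f *\<^sub>v (q - h *\<^sub>v (g *\<^sub>v q)) = 0\<^sub>v (mdim M)"
      using q d by (simp add: fg[symmetric] mat_vec_dim gh)
    ultimately show "q \<in> {u + w |u w. u \<in> mat_image h \<and> w \<in> mat_kernel f}"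
      using q d by (force simp: mat_image_iff mat_kernel_iff)
  qed (use d in \<open>auto simp: mat_kernel_iff mat_image_iff\<close>)
  have "h * g = 1\<^sub>m (mdim Q)"
  proof (rule mat_eqI_vec[where n = "mdim Q"])
    fix v :: "'k vec" assume "dim_vec v = mdim Q"
    then obtain w where "dim_vec w = mdim Q'" "v = h *\<^sub>v w"
      using imh d by (metis carrier_vec_iff mat_image_iff)
    then show "h * g *\<^sub>v v = 1\<^sub>m (mdim Q) *\<^sub>v v"
      using d by (simp add: mat_vec_dim gh)
  qed (use d in auto)
  then show ?thesis using that g h by blast
qed

text \<open>\<open>f'\<close> extends along \<open>f\<close> to \<open>g\<close>. The kernel of
  \<open>g\<close> meets the essential image of \<open>f\<close> in 0 because \<open>f'\<close> is
  injective, so \<open>g\<close> is injective and has a retraction \<open>h\<close>. The kernel of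
  \<open>h\<close> meets the image of \<open>f'\<close> in 0, so \<open>h\<close> is injective too
  and cancels in h g h = h.\<close>

lemma injective_envelope_unique:
  fixes M :: "'k::field d4_mod"
  assumes I: "injective_envelope I f M" "injective_envelope I' f' M" and M: "d4_module M"
  obtains g g' where "d4_hom I I' g" "d4_hom I' I g'" "g' * g = 1\<^sub>m (mdim I)" "g * g' = 1\<^sub>m (mdim I')"
    "g * f = f'"
proof -
  have inj: "d4_injective I" "d4_injective I'" and m: "d4_module I" "d4_module I'"
    and f: "d4_mono M I f" "d4_mono M I' f'" "d4_hom M I f" "d4_hom M I' f'"
    using I by (auto simp: injective_envelope_def d4_injective_def d4_mono_def)
  have ess: "\<And>U. d4_submodule I U \<Longrightarrow> U \<inter> mat_image f = {0\<^sub>v (mdim I)} \<Longrightarrow> U = {0\<^sub>v (mdim I)}"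
    and ess': "\<And>U. d4_submodule I' U \<Longrightarrow> U \<inter> mat_image f' = {0\<^sub>v (mdim I')} \<Longrightarrow> U = {0\<^sub>v (mdim I')}"
    using I unfolding injective_envelope_def by blast+
  obtain g where g: "d4_hom I I' g" "g * f = f'"
    using injective_extend[OF inj(2) M m(1) f(1) f(4)] .
  note d = d4_hom_dim[OF f(3)] d4_hom_dim[OF f(4)] d4_hom_dim[OF g(1)]
  have gf: "g *\<^sub>v (f *\<^sub>v v) = f' *\<^sub>v v" if "dim_vec v = mdim M" for v
    using that g(2) d mult_vec_assoc_dim[of g f v] by simp
  have f'0: "v = 0\<^sub>v (mdim M)" if "dim_vec v = mdim M" "f' *\<^sub>v v = 0\<^sub>v (mdim I')" for v
    using f(2) that d inj_onD[of "\<lambda>v. f' *\<^sub>v v" "carrier_vec (mdim M)" v "0\<^sub>v (mdim M)"]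
    by (simp add: d4_mono_def mult_vec_zero_dim)
  have "mat_kernel g = {0\<^sub>v (mdim I)}"
  proof (rule ess[OF mat_kernel_submodule[OF g(1) m]], intro equalityI subsetI)
    fix q :: "'k vec" assume "q \<in> mat_kernel g \<inter> mat_image f"
    then obtain v where "dim_vec v = mdim M" "q = f *\<^sub>v v" "g *\<^sub>v q = 0\<^sub>v (mdim I')"
      using d by (auto simp: mat_image_iff mat_kernel_iff)
    then show "q \<in> {0\<^sub>v (mdim I)}" using f'0[of v] gf[of v] d by (simp add: mult_vec_zero_dim)
  next
    fix q :: "'k vec" assume "q \<in> {0\<^sub>v (mdim I)}"
    then show "q \<in> mat_kernel g \<inter> mat_image f"
      using d by (auto simp: mat_image_iff mat_kernel_iff mult_vec_zero_dim intro!: exI[of _ "0\<^sub>v (mdim M)"])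
  qed
  then have "inj_on (\<lambda>v. g *\<^sub>v v) (carrier_vec (dim_col g))"
    using d by (intro injI_kernel) (auto simp: mat_kernel_iff set_eq_iff)
  then have mono: "d4_mono I I' g" using g d by (simp add: d4_mono_def)
  obtain h where h: "d4_hom I' I h" "h * g = 1\<^sub>m (mdim I)"
    using injective_extend[OF inj(1) m mono d4_hom_id[OF m(1)]] .
  note d = d d4_hom_dim[OF h(1)]
  have hg: "h *\<^sub>v (g *\<^sub>v v) = v" if "dim_vec v = mdim I" for v
    using that h(2) d mult_vec_assoc_dim[of h g v] by (simp add: one_mult_vec_dim)
  have f0: "v = 0\<^sub>v (mdim M)" if "dim_vec v = mdim M" "f *\<^sub>v v = 0\<^sub>v (mdim I)" for v
    using that f'0[of v] gf[of v] d by (simp add: mult_vec_zero_dim)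
  have ker: "mat_kernel h = {0\<^sub>v (mdim I')}"
  proof (rule ess'[OF mat_kernel_submodule[OF h(1) m(2,1)]], intro equalityI subsetI)
    fix q :: "'k vec" assume "q \<in> mat_kernel h \<inter> mat_image f'"
    then obtain v where v: "dim_vec v = mdim M" "q = f' *\<^sub>v v" "h *\<^sub>v q = 0\<^sub>v (mdim I)"
      using d by (auto simp: mat_image_iff mat_kernel_iff)
    then have "f *\<^sub>v v = 0\<^sub>v (mdim I)" using hg[of "f *\<^sub>v v"] gf[of v] d by simp
    then show "q \<in> {0\<^sub>v (mdim I')}" using f0[of v] v d by (simp add: mult_vec_zero_dim)
  next
    fix q :: "'k vec" assume "q \<in> {0\<^sub>v (mdim I')}"
    then show "q \<in> mat_kernel h \<inter> mat_image f'"
      using d by (auto simp: mat_image_iff mat_kernel_iff mult_vec_zero_dim intro!: exI[of _ "0\<^sub>v (mdim M)"])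
  qed
  have "g * h = 1\<^sub>m (mdim I')"
  proof (rule inj_mat_cancel[of h])
    show "inj_on ((*\<^sub>v) h) (carrier_vec (dim_col h))"
      using ker d by (intro injI_kernel) (auto simp: mat_kernel_iff set_eq_iff)
  qed (use d h in \<open>simp_all add: mult_assoc_dim[symmetric] one_mult_dim\<close>)
  then show ?thesis using that g h by blast
qed

text \<open>The isomorphism \<open>g\<close> of covers over \<open>M\<close> carries kernel to
  kernel. It is restricted by factoring through \<open>i\<close> and \<open>i'\<close>; cancelling
  these monomorphisms turns identities in the covers into identities for \<open>C\<close> and
  \<open>C'\<close>.\<close>

lemma syzygy_unique:
  fixes M :: "'k::field d4_mod"
  assumes "is_syzygy M K" "is_syzygy M K'" and M: "d4_module M"
  shows "K \<cong>\<^sub>D K'"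
proof -
  obtain Q f i where Q: "projective_cover Q f M" "d4_mono K Q i" "mat_image i = mat_kernel f"
    and K: "d4_module K" using assms(1) by (auto simp: is_syzygy_def)
  obtain Q' f' i' where Q': "projective_cover Q' f' M" "d4_mono K' Q' i'" "mat_image i' = mat_kernel f'"
    and K': "d4_module K'" using assms(2) by (auto simp: is_syzygy_def)
  have m: "d4_module Q" "d4_module Q'" and f: "d4_hom Q M f" "d4_hom Q' M f'"
    using Q Q' by (auto simp: projective_cover_def d4_projective_def d4_epi_def)
  obtain g g' where g: "d4_hom Q Q' g" "d4_hom Q' Q g'" "g' * g = 1\<^sub>m (mdim Q)"
      "g * g' = 1\<^sub>m (mdim Q')" "f' * g = f"
    using projective_cover_unique[OF Q(1) Q'(1) M] .
  have i: "d4_hom K Q i" "d4_hom K' Q' i'" using Q Q' by (auto simp: d4_mono_def)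
  note d = d4_hom_dim[OF f(1)] d4_hom_dim[OF f(2)] d4_hom_dim[OF g(1)] d4_hom_dim[OF g(2)]
    d4_hom_dim[OF i(1)] d4_hom_dim[OF i(2)]
  have inj: "inj_on (\<lambda>v. i *\<^sub>v v) (carrier_vec (dim_col i))" "inj_on (\<lambda>v. i' *\<^sub>v v) (carrier_vec (dim_col i'))"
    using Q Q' d by (auto simp: d4_mono_def)
  have "f * g' = f' * (g * g')" using g(5) d by (simp add: mult_assoc_dim[symmetric] del: assoc_mult_mat)
  then have fg': "f * g' = f'" using g(4) d by (simp add: one_mult_dim)
  have "(g * i) *\<^sub>v v \<in> mat_image i'" if "dim_vec v = dim_col (g * i)" for v
  proof -
    have "i *\<^sub>v v \<in> mat_kernel f" using that d by (auto simp: Q(3)[symmetric] mat_image_iff)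
    then have "f' *\<^sub>v (g *\<^sub>v (i *\<^sub>v v)) = 0\<^sub>v (mdim M)"
      using that d g(5) mult_vec_assoc_dim[of f' g "i *\<^sub>v v"] by (simp add: mat_kernel_iff)
    then show ?thesis using that d by (simp add: Q'(3) mat_kernel_iff mat_vec_dim)
  qed
  then obtain C where C: "C \<in> carrier_mat (mdim K') (mdim K)" "i' * C = g * i"
    using factor_through_image[of "g * i" i'] d by auto
  have "(g' * i') *\<^sub>v v \<in> mat_image i" if "dim_vec v = dim_col (g' * i')" for v
  proof -
    have "i' *\<^sub>v v \<in> mat_kernel f'" using that d by (auto simp: Q'(3)[symmetric] mat_image_iff)
    then have "f *\<^sub>v (g' *\<^sub>v (i' *\<^sub>v v)) = 0\<^sub>v (mdim M)"
      using that d fg' mult_vec_assoc_dim[of f g' "i' *\<^sub>v v"] by (simp add: mat_kernel_iff)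
    then show ?thesis using that d by (simp add: Q(3) mat_kernel_iff mat_vec_dim)
  qed
  then obtain C' where C': "C' \<in> carrier_mat (mdim K) (mdim K')" "i * C' = g' * i'"
    using factor_through_image[of "g' * i'" i] d by auto
  note d = d d4_module_dim[OF K] d4_module_dim[OF K'] d4_module_dim[OF m(1)] d4_module_dim[OF m(2)]
  have dC: "dim_row C = mdim K'" "dim_col C = mdim K" "dim_row C' = mdim K" "dim_col C' = mdim K'"
    using C C' by auto
  have hom: "d4_hom K K' C"
    unfolding d4_hom_iff
  proof (intro conjI allI)
    fix a
    show "C * act K a = act K' a * C"
    proof (rule inj_mat_cancel[OF inj(2)])
      have "i' * (C * act K a) = g * (i * act K a)"
        using C d dC by (simp add: mult_assoc_dim[symmetric] del: assoc_mult_mat)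
      also have "i * act K a = act Q a * i" using i by (simp add: d4_hom_iff)
      also have "g * (act Q a * i) = (g * act Q a) * i" using d by (simp add: mult_assoc_dim)
      also have "g * act Q a = act Q' a * g" using g by (simp add: d4_hom_iff)
      also have "act Q' a * g * i = (act Q' a * i') * C" using C d dC by (simp add: mult_assoc_dim)
      also have "act Q' a * i' = i' * act K' a" using i by (simp add: d4_hom_iff)
      finally show "i' * (C * act K a) = i' * (act K' a * C)" using d dC by (simp add: mult_assoc_dim)
    qed (use d dC in auto)
  qed (use dC in auto)
  have "C' * C = 1\<^sub>m (mdim K)"
  proof (rule inj_mat_cancel[OF inj(1)])
    have "i * (C' * C) = g' * (i' * C)" using C' d dC by (simp add: mult_assoc_dim[symmetric] del: assoc_mult_mat)
    also have "\<dots> = (g' * g) * i" using C d dC by (simp add: mult_assoc_dim)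
    finally show "i * (C' * C) = i * 1\<^sub>m (mdim K)" using g d by (simp add: one_mult_dim)
  qed (use d dC in auto)
  moreover have "C * C' = 1\<^sub>m (mdim K')"
  proof (rule inj_mat_cancel[OF inj(2)])
    have "i' * (C * C') = g * (i * C')" using C d dC by (simp add: mult_assoc_dim[symmetric] del: assoc_mult_mat)
    also have "\<dots> = (g * g') * i'" using C' d dC by (simp add: mult_assoc_dim)
    finally show "i' * (C * C') = i' * 1\<^sub>m (mdim K')" using g d by (simp add: one_mult_dim)
  qed (use d dC in auto)
  ultimately show ?thesis by (intro d4_isoI[OF hom K K', of C']) (use dC in auto)
qed

section \<open>Maps out of quotients and uniqueness of cosyzygies\<close>

lemma factor_through_surj:
  fixes A B :: "'k::field mat"
  assumes "dim_col A = dim_col B" "mat_image B = carrier_vec (dim_row B)"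
    and "\<And>v. v \<in> mat_kernel B \<Longrightarrow> A *\<^sub>v v = 0\<^sub>v (dim_row A)"
  obtains C where "C \<in> carrier_mat (dim_row A) (dim_row B)" "C * B = A"
proof -
  obtain R where R: "R \<in> carrier_mat (dim_col B) (dim_row B)" "B * R = 1\<^sub>m (dim_row B)"
    using surj_right_inverse[OF assms(2)] .
  \<comment> \<open>\<open>R B v - v\<close> lies in the kernel of \<open>B\<close>, where
    \<open>A\<close> vanishes.\<close>
  have "A * R * B = A"
  proof (rule mat_eqI_vec[where n = "dim_col B"])
    fix v :: "'k vec" assume v: "dim_vec v = dim_col B"
    have "B *\<^sub>v (R *\<^sub>v (B *\<^sub>v v)) = B *\<^sub>v v"
      using R v mult_vec_assoc_dim[of B R "B *\<^sub>v v"] by (simp add: one_mult_vec_dim)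
    then have "A *\<^sub>v (R *\<^sub>v (B *\<^sub>v v) - v) = 0\<^sub>v (dim_row A)"
      using R v by (intro assms(3)) (simp add: mat_kernel_iff mat_vec_dim)
    then have *: "(A *\<^sub>v (R *\<^sub>v (B *\<^sub>v v)) - A *\<^sub>v v) = 0\<^sub>v (dim_row A)"
      using R v assms(1) by (simp add: mat_vec_dim)
    have "A *\<^sub>v (R *\<^sub>v (B *\<^sub>v v)) = A *\<^sub>v v"
    proof (rule eq_vecI)
      fix i assume "i < dim_vec (A *\<^sub>v v)"
      then show "(A *\<^sub>v (R *\<^sub>v (B *\<^sub>v v))) $ i = (A *\<^sub>v v) $ i"
        using arg_cong[OF *, of "\<lambda>v. v $ i"] by simp
    qed auto
    then show "A * R * B *\<^sub>v v = A *\<^sub>v v"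
      using R v assms(1) by (simp add: mat_vec_dim)
  qed (use assms in auto)
  then show ?thesis using that[of "A * R"] R by simp
qed

lemma surj_mat_cancel:
  fixes A B C :: "'k::field mat"
  assumes "mat_image A = carrier_vec (dim_row A)"
    and "dim_col B = dim_row A" "dim_col C = dim_row A" "B * A = C * A"
  shows "B = C"
proof -
  obtain R where R: "R \<in> carrier_mat (dim_col A) (dim_row A)" "A * R = 1\<^sub>m (dim_row A)"
    using surj_right_inverse[OF assms(1)] .
  have "B * A * R = C * A * R" using assms(4) by simp
  then show ?thesis using R assms(2,3) by (simp add: mult_assoc_dim one_mult_dim)
qed

text \<open>The isomorphism \<open>g\<close> of envelopes carries the image of \<open>f\<close> to
  that of \<open>f'\<close>, so it descends to the quotients; cancelling the epimorphisms
  \<open>p\<close> and \<open>p'\<close> gives the identities for \<open>C\<close> and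
  \<open>C'\<close>.\<close>

lemma cosyzygy_unique:
  fixes M :: "'k::field d4_mod"
  assumes "is_cosyzygy M K" "is_cosyzygy M K'" and M: "d4_module M"
  shows "K \<cong>\<^sub>D K'"
proof -
  obtain Q f p where Q: "injective_envelope Q f M" "d4_epi Q K p" "mat_kernel p = mat_image f"
    and K: "d4_module K" using assms(1) by (auto simp: is_cosyzygy_def)
  obtain Q' f' p' where Q': "injective_envelope Q' f' M" "d4_epi Q' K' p'" "mat_kernel p' = mat_image f'"
    and K': "d4_module K'" using assms(2) by (auto simp: is_cosyzygy_def)
  have m: "d4_module Q" "d4_module Q'" and f: "d4_hom M Q f" "d4_hom M Q' f'"
    using Q Q' by (auto simp: injective_envelope_def d4_injective_def d4_mono_def)
  obtain g g' where g: "d4_hom Q Q' g" "d4_hom Q' Q g'" "g' * g = 1\<^sub>m (mdim Q)"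
      "g * g' = 1\<^sub>m (mdim Q')" "g * f = f'"
    using injective_envelope_unique[OF Q(1) Q'(1) M] .
  have p: "d4_hom Q K p" "d4_hom Q' K' p'" using Q Q' by (auto simp: d4_epi_def)
  note d = d4_hom_dim[OF f(1)] d4_hom_dim[OF f(2)] d4_hom_dim[OF g(1)] d4_hom_dim[OF g(2)]
    d4_hom_dim[OF p(1)] d4_hom_dim[OF p(2)]
  have surj: "mat_image p = carrier_vec (dim_row p)" "mat_image p' = carrier_vec (dim_row p')"
    using Q Q' d by (auto simp: d4_epi_def)
  have "g' * f' = (g' * g) * f" using g(5) d by (simp add: mult_assoc_dim)
  then have g'f': "g' * f' = f" using g(3) d by (simp add: one_mult_dim)
  have pg: "(p' * g) *\<^sub>v v = 0\<^sub>v (dim_row (p' * g))" if v: "v \<in> mat_kernel p" for v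
  proof -
    obtain w where w: "dim_vec w = mdim M" "v = f *\<^sub>v w" using v d by (auto simp: Q(3) mat_image_iff)
    then have "g *\<^sub>v v = f' *\<^sub>v w" using g(5) d mult_vec_assoc_dim[of g f w] by simp
    then have "g *\<^sub>v v \<in> mat_kernel p'" using w d by (auto simp: Q'(3) mat_image_iff)
    then show ?thesis using w d by (simp add: mat_kernel_iff mat_vec_dim)
  qed
  obtain C where C: "C \<in> carrier_mat (mdim K') (mdim K)" "C * p = p' * g"
    by (rule factor_through_surj[OF _ surj(1) pg]) (use d in simp_all)
  have pg': "(p * g') *\<^sub>v v = 0\<^sub>v (dim_row (p * g'))" if v: "v \<in> mat_kernel p'" for v
  proof -
    obtain w where w: "dim_vec w = mdim M" "v = f' *\<^sub>v w" using v d by (auto simp: Q'(3) mat_image_iff)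
    then have "g' *\<^sub>v v = f *\<^sub>v w" using g'f' d mult_vec_assoc_dim[of g' f' w] by simp
    then have "g' *\<^sub>v v \<in> mat_kernel p" using w d by (auto simp: Q(3) mat_image_iff)
    then show ?thesis using w d by (simp add: mat_kernel_iff mat_vec_dim)
  qed
  obtain C' where C': "C' \<in> carrier_mat (mdim K) (mdim K')" "C' * p' = p * g'"
    by (rule factor_through_surj[OF _ surj(2) pg']) (use d in simp_all)
  note d = d d4_module_dim[OF K] d4_module_dim[OF K'] d4_module_dim[OF m(1)] d4_module_dim[OF m(2)]
  have dC: "dim_row C = mdim K'" "dim_col C = mdim K" "dim_row C' = mdim K" "dim_col C' = mdim K'"
    using C C' by auto
  have hom: "d4_hom K K' C"
    unfolding d4_hom_iff
  proof (intro conjI allI)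
    fix a
    show "C * act K a = act K' a * C"
    proof (rule surj_mat_cancel[OF surj(1)])
      have "C * act K a * p = C * (p * act Q a)"
        using p d dC by (simp add: mult_assoc_dim d4_hom_iff)
      also have "\<dots> = (p' * g) * act Q a" using C d dC by (simp add: mult_assoc_dim[symmetric] del: assoc_mult_mat)
      also have "\<dots> = p' * (act Q' a * g)" using g d by (simp add: mult_assoc_dim d4_hom_iff)
      also have "\<dots> = (p' * act Q' a) * g" using d by (simp add: mult_assoc_dim)
      also have "\<dots> = act K' a * (p' * g)" using p d by (simp add: mult_assoc_dim d4_hom_iff)
      finally show "C * act K a * p = act K' a * C * p" using C d dC by (simp add: mult_assoc_dim)
    qed (use d dC in auto)
  qed (use dC in auto)
  have "C' * C = 1\<^sub>m (mdim K)"
  proof (rule surj_mat_cancel[OF surj(1)])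
    have "C' * C * p = (C' * p') * g" using C d dC by (simp add: mult_assoc_dim)
    also have "\<dots> = p * (g' * g)" using C' d dC by (simp add: mult_assoc_dim)
    finally show "C' * C * p = 1\<^sub>m (mdim K) * p" using g d by (simp add: one_mult_dim)
  qed (use d dC in auto)
  moreover have "C * C' = 1\<^sub>m (mdim K')"
  proof (rule surj_mat_cancel[OF surj(2)])
    have "C * C' * p' = (C * p) * g'" using C' d dC by (simp add: mult_assoc_dim)
    also have "\<dots> = p' * (g * g')" using C d dC by (simp add: mult_assoc_dim)
    finally show "C * C' * p' = 1\<^sub>m (mdim K') * p'" using g d by (simp add: one_mult_dim)
  qed (use d dC in auto)
  ultimately show ?thesis by (intro d4_isoI[OF hom K K', of C']) (use dC in auto)
qed

lemma is_syzygy_iso: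
  fixes M :: "'k::field d4_mod"
  assumes "is_syzygy M K" "M \<cong>\<^sub>D M'" "d4_module M" "d4_module M'"
  shows "is_syzygy M' K"
proof -
  obtain Q f i where Q: "projective_cover Q f M" "d4_mono K Q i" "mat_image i = mat_kernel f"
    and K: "d4_module K" using assms(1) by (auto simp: is_syzygy_def)
  obtain F G where F: "d4_hom M M' F" "d4_hom M' M G" "G * F = 1\<^sub>m (mdim M)" "F * G = 1\<^sub>m (mdim M')"
    using assms(2) by (rule d4_isoE)
  have m: "d4_module Q" and f: "d4_hom Q M f" "mat_image f = carrier_vec (dim_row f)"
    using Q by (auto simp: projective_cover_def d4_projective_def d4_epi_def d4_hom_iff)
  note d = d4_hom_dim[OF F(1)] d4_hom_dim[OF F(2)] d4_hom_dim[OF f(1)]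
  have GF: "G *\<^sub>v (F *\<^sub>v v) = v" if "dim_vec v = mdim M" for v
    using that F(3) d mult_vec_assoc_dim[of G F v] by (simp add: one_mult_vec_dim)
  have ker: "mat_kernel (F * f) = mat_kernel f"
  proof (intro equalityI subsetI)
    fix v assume "v \<in> mat_kernel (F * f)"
    then show "v \<in> mat_kernel f"
      using d GF[of "f *\<^sub>v v"] by (auto simp: mat_kernel_iff mat_vec_dim)
  qed (use d in \<open>auto simp: mat_kernel_iff mat_vec_dim\<close>)
  obtain R where R: "R \<in> carrier_mat (dim_col f) (dim_row f)" "f * R = 1\<^sub>m (dim_row f)"
    using surj_right_inverse[OF f(2)] .
  have "F * f * (R * G) = F * (f * R) * G" using R(1) d by (simp add: mult_assoc_dim)
  then have "F * f * (R * G) = 1\<^sub>m (mdim M')" using R F d by (simp add: one_mult_dim)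
  then have "mat_image (F * f) = carrier_vec (dim_row (F * f))"
    using R d by (intro right_inverse_surj[of "R * G"]) auto
  then have "d4_epi Q M' (F * f)"
    using d4_hom_comp[OF f(1) F(1) m assms(3,4)] d by (simp add: d4_epi_def)
  then have "projective_cover Q (F * f) M'"
    using Q(1) ker unfolding projective_cover_def by simp
  then show ?thesis using Q K ker unfolding is_syzygy_def by metis
qed

lemma is_cosyzygy_iso:
  fixes M :: "'k::field d4_mod"
  assumes "is_cosyzygy M K" "M \<cong>\<^sub>D M'" "d4_module M" "d4_module M'"
  shows "is_cosyzygy M' K"
proof -
  obtain Q f p where Q: "injective_envelope Q f M" "d4_epi Q K p" "mat_kernel p = mat_image f"
    and K: "d4_module K" using assms(1) by (auto simp: is_cosyzygy_def)
  obtain F G where F: "d4_hom M M' F" "d4_hom M' M G" "G * F = 1\<^sub>m (mdim M)" "F * G = 1\<^sub>m (mdim M')"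
    using assms(2) by (rule d4_isoE)
  have m: "d4_module Q" and f: "d4_hom M Q f" "inj_on (\<lambda>v. f *\<^sub>v v) (carrier_vec (dim_col f))"
    using Q by (auto simp: injective_envelope_def d4_injective_def d4_mono_def d4_hom_iff)
  note d = d4_hom_dim[OF F(1)] d4_hom_dim[OF F(2)] d4_hom_dim[OF f(1)]
  have GF: "G *\<^sub>v (F *\<^sub>v v) = v" if "dim_vec v = mdim M" for v
    using that F(3) d mult_vec_assoc_dim[of G F v] by (simp add: one_mult_vec_dim)
  have im: "mat_image (f * G) = mat_image f"
  proof (intro equalityI subsetI)
    fix w assume "w \<in> mat_image f"
    then obtain v where "dim_vec v = mdim M" "w = f *\<^sub>v v" using d by (auto simp: mat_image_iff)
    then show "w \<in> mat_image (f * G)"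
      using d GF[of v] by (auto simp: mat_image_iff mat_vec_dim intro!: exI[of _ "F *\<^sub>v v"])
  next
    fix w assume "w \<in> mat_image (f * G)"
    then obtain v where "dim_vec v = mdim M'" "w = f *\<^sub>v (G *\<^sub>v v)"
      using d by (auto simp: mat_image_iff mat_vec_dim)
    then show "w \<in> mat_image f" using d by (auto simp: mat_image_iff intro!: exI[of _ "G *\<^sub>v v"])
  qed
  obtain L where L: "L \<in> carrier_mat (dim_col f) (dim_row f)" "L * f = 1\<^sub>m (dim_col f)"
    using inj_left_inverse[OF f(2)] .
  have "F * L * (f * G) = F * (L * f) * G" using L(1) d by (simp add: mult_assoc_dim)
  then have "F * L * (f * G) = 1\<^sub>m (mdim M')" using L F d by (simp add: one_mult_dim)
  then have "inj_on (\<lambda>v. (f * G) *\<^sub>v v) (carrier_vec (dim_col (f * G)))"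
    using L d by (intro left_inverse_inj[of "F * L"]) auto
  then have "d4_mono M' Q (f * G)"
    using d4_hom_comp[OF F(2) f(1) assms(4,3) m] d by (simp add: d4_mono_def)
  then have "injective_envelope Q (f * G) M'"
    using Q(1) im unfolding injective_envelope_def by simp
  then show ?thesis using Q K im unfolding is_cosyzygy_def by metis
qed

subsection \<open>Kronecker products\<close>

text \<open>The vector v \<otimes> w in the lexicographic coordinates used by
  \<open>kron\<close>.\<close>

definition kronv :: "'k::field vec \<Rightarrow> 'k vec \<Rightarrow> 'k vec" where
  "kronv v w = vec (dim_vec v * dim_vec w) (\<lambda>i. v $ (i div dim_vec w) * w $ (i mod dim_vec w))"

lemma dim_kronv [simp]: "dim_vec (kronv v w) = dim_vec v * dim_vec w"
  by (simp add: kronv_def)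

lemma dim_kron [simp]:
  "dim_row (kron A B) = dim_row A * dim_row B" "dim_col (kron A B) = dim_col A * dim_col B"
  by (simp_all add: kron_def)

lemma div_mod_less:
  fixes i m n :: nat
  assumes "i < m * n"
  shows "i div n < m" "i mod n < n"
  using assms by (auto simp: less_mult_imp_div_less) (metis mod_less_divisor mult_0_right not_gr_zero not_less_zero)

lemma index_kronv [simp]:
  "i < dim_vec v * dim_vec w \<Longrightarrow> kronv v w $ i = v $ (i div dim_vec w) * w $ (i mod dim_vec w)"
  by (simp add: kronv_def)

lemma index_kron [simp]:
  "i < dim_row A * dim_row B \<Longrightarrow> j < dim_col A * dim_col B \<Longrightarrow>
    kron A B $$ (i, j) = A $$ (i div dim_row B, j div dim_col B) * B $$ (i mod dim_row B, j mod dim_col B)"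
  by (simp add: kron_def)

lemma kronv_linear:
  "dim_vec v = dim_vec v' \<Longrightarrow> kronv (v + v') w = kronv v w + kronv v' w"
  "dim_vec w = dim_vec w' \<Longrightarrow> kronv v (w + w') = kronv v w + kronv v w'"
  "dim_vec v = dim_vec v' \<Longrightarrow> kronv (v - v') w = kronv v w - kronv v' w"
  "dim_vec w = dim_vec w' \<Longrightarrow> kronv v (w - w') = kronv v w - kronv v w'"
  "kronv (c \<cdot>\<^sub>v v) w = c \<cdot>\<^sub>v kronv v w"
  "kronv v (c \<cdot>\<^sub>v w) = c \<cdot>\<^sub>v kronv v w"
  "kronv (- v) w = - kronv v w"
  "kronv v (- w) = - kronv v w"
  by (auto intro!: eq_vecI simp: div_mod_less algebra_simps)

lemma kronv_zero [simp]:
  "kronv (0\<^sub>v m) w = 0\<^sub>v (m * dim_vec w)"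
  "kronv v (0\<^sub>v n) = 0\<^sub>v (dim_vec v * n)"
  by (auto intro!: eq_vecI simp: div_mod_less)

lemma sum_div_mod:
  fixes f :: "nat \<Rightarrow> nat \<Rightarrow> 'a::comm_monoid_add"
  shows "(\<Sum>k<m * n. f (k div n) (k mod n)) = (\<Sum>i<m. \<Sum>j<n. f i j)"
proof -
  have "(\<Sum>k<m * n. f (k div n) (k mod n)) = (\<Sum>i<m. \<Sum>k=i * n..<i * n + n. f (k div n) (k mod n))"
    by (rule sum.nat_group[symmetric])
  also have "\<dots> = (\<Sum>i<m. \<Sum>j<n. f i j)"
  proof (rule sum.cong[OF refl])
    fix i
    have "(\<Sum>k=i * n..<i * n + n. f (k div n) (k mod n)) =
        (\<Sum>j=0..<n. f ((j + i * n) div n) ((j + i * n) mod n))"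
      using sum.shift_bounds_nat_ivl[of "\<lambda>k. f (k div n) (k mod n)" 0 "i * n" n] by (simp add: add.commute)
    also have "\<dots> = (\<Sum>j<n. f i j)"
      unfolding atLeast0LessThan by (rule sum.cong) auto
    finally show "(\<Sum>k=i * n..<i * n + n. f (k div n) (k mod n)) = (\<Sum>j<n. f i j)" .
  qed
  finally show ?thesis .
qed

lemma kron_mult_kronv:
  assumes "dim_col A = dim_vec v" "dim_col B = dim_vec w"
  shows "kron A B *\<^sub>v kronv v w = kronv (A *\<^sub>v v) (B *\<^sub>v w)"
proof (rule eq_vecI)
  fix i assume "i < dim_vec (kronv (A *\<^sub>v v) (B *\<^sub>v w))"
  then have i: "i < dim_row A * dim_row B" by simp
  let ?m = "dim_vec v" and ?n = "dim_vec w"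
  let ?f = "\<lambda>p q. A $$ (i div dim_row B, p) * B $$ (i mod dim_row B, q) * (v $ p * w $ q)"
  have "(kron A B *\<^sub>v kronv v w) $ i = (\<Sum>k<?m * ?n. ?f (k div ?n) (k mod ?n))"
    using i assms by (simp add: scalar_prod_def atLeast0LessThan)
  also have "\<dots> = (\<Sum>p<?m. \<Sum>q<?n. ?f p q)" by (rule sum_div_mod)
  also have "\<dots> = kronv (A *\<^sub>v v) (B *\<^sub>v w) $ i"
    using i assms div_mod_less[OF i]
    by (simp add: scalar_prod_def atLeast0LessThan sum_product mult_ac)
  finally show "(kron A B *\<^sub>v kronv v w) $ i = kronv (A *\<^sub>v v) (B *\<^sub>v w) $ i" .
qed (use assms in simp)

lemma unit_vec_kronv:
  assumes "k < m * n"
  shows "(unit_vec (m * n) k :: 'k::field vec) = kronv (unit_vec m (k div n)) (unit_vec n (k mod n))"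
  using div_mod_less[OF assms] assms
  by (intro eq_vecI) (auto simp: div_mod_less, metis div_mult_mod_eq)

lemma mat_eqI_kronv:
  fixes A B :: "'k::field mat"
  assumes "dim_row A = dim_row B" "dim_col A = m * n" "dim_col B = m * n"
    and "\<And>p q. p < m \<Longrightarrow> q < n \<Longrightarrow>
      A *\<^sub>v kronv (unit_vec m p) (unit_vec n q) = B *\<^sub>v kronv (unit_vec m p) (unit_vec n q)"
  shows "A = B"
  using assms by (intro mat_eqI_unit_vec[of A B "m * n"]) (auto simp: unit_vec_kronv div_mod_less)

lemma kron_mult:
  assumes "dim_col A = dim_row C" "dim_col B = dim_row D"
  shows "kron A B * kron C D = kron (A * C) (B * D)"
  by (rule mat_eqI_kronv[where m = "dim_col C" and n = "dim_col D"])
     (use assms in \<open>auto simp: mult_vec_assoc_dim kron_mult_kronv\<close>)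

lemma kron_one: "kron (1\<^sub>m m) (1\<^sub>m n) = 1\<^sub>m (m * n)"
  by (rule mat_eqI_kronv[where m = m and n = n])
     (auto simp: kron_mult_kronv one_mult_vec_dim)

lemma transpose_kron: "transpose_mat (kron A B) = kron (transpose_mat A) (transpose_mat B)"
  by (intro eq_matI) (auto simp: div_mod_less)


subsection \<open>Direct sums, multiples and tensor products\<close>

text \<open>The relations are oriented as rewrite rules that bring every word into the order a, d,
  c, b, read from the outermost factor inwards.\<close>

lemma d4_module_vec:
  assumes "d4_module M" "dim_vec v = mdim M"
  shows "act M Gb *\<^sub>v (act M Ga *\<^sub>v v) = - (act M Ga *\<^sub>v (act M Gb *\<^sub>v v))"
    "act M Gb *\<^sub>v (act M Gd *\<^sub>v v) = - (act M Gd *\<^sub>v (act M Gb *\<^sub>v v))"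
    "act M Gc *\<^sub>v (act M Ga *\<^sub>v v) = - (act M Ga *\<^sub>v (act M Gc *\<^sub>v v))"
    "act M Gc *\<^sub>v (act M Gd *\<^sub>v v) = - (act M Gd *\<^sub>v (act M Gc *\<^sub>v v))"
    "act M Gb *\<^sub>v (act M Gc *\<^sub>v v) = act M Gc *\<^sub>v (act M Gb *\<^sub>v v)"
    "act M Ga *\<^sub>v (act M Ga *\<^sub>v v) = 0\<^sub>v (mdim M)"
    "act M Gb *\<^sub>v (act M Gb *\<^sub>v v) = v"
    "act M Gc *\<^sub>v (act M Gc *\<^sub>v v) = v"
    "act M Gd *\<^sub>v (act M Gd *\<^sub>v v) = 0\<^sub>v (mdim M)"
    "act M Gd *\<^sub>v (act M Ga *\<^sub>v v) =
       v - act M Gc *\<^sub>v (act M Gb *\<^sub>v v) - act M Ga *\<^sub>v (act M Gd *\<^sub>v v)"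
proof -
  note d = d4_module_dim[OF assms(1)]
  let ?n = "mdim M" and ?a = "act M Ga" and ?b = "act M Gb" and ?c = "act M Gc" and ?d = "act M Gd"
  have r: "?b * ?a = - (?a * ?b)" "?d * ?b = - (?b * ?d)" "?c * ?a = - (?a * ?c)"
    "?d * ?c = - (?c * ?d)" "?b * ?c = ?c * ?b" "?a * ?a = 0\<^sub>m ?n ?n" "?b * ?b = 1\<^sub>m ?n"
    "?c * ?c = 1\<^sub>m ?n" "?d * ?d = 0\<^sub>m ?n ?n" "?d * ?a + ?a * ?d = 1\<^sub>m ?n - ?b * ?c"
    using assms(1) by (simp_all add: d4_module_def Let_def)
  note v = r[THEN arg_cong[of _ _ "\<lambda>A. A *\<^sub>v v"]]
  have neg: "x = - y \<Longrightarrow> y = - x" for x y :: "'a vec" by simp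
  show "?b *\<^sub>v (?a *\<^sub>v v) = - (?a *\<^sub>v (?b *\<^sub>v v))" 
    "?c *\<^sub>v (?a *\<^sub>v v) = - (?a *\<^sub>v (?c *\<^sub>v v))"
    "?b *\<^sub>v (?c *\<^sub>v v) = ?c *\<^sub>v (?b *\<^sub>v v)"
    "?a *\<^sub>v (?a *\<^sub>v v) = 0\<^sub>v ?n" "?b *\<^sub>v (?b *\<^sub>v v) = v" "?c *\<^sub>v (?c *\<^sub>v v) = v"
    "?d *\<^sub>v (?d *\<^sub>v v) = 0\<^sub>v ?n"
    using v d assms(2) by (simp_all add: mat_vec_dim)
  show "?b *\<^sub>v (?d *\<^sub>v v) = - (?d *\<^sub>v (?b *\<^sub>v v))"
    by (rule neg) (use v(2) d assms(2) in \<open>simp add: mat_vec_dim\<close>)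
  show "?c *\<^sub>v (?d *\<^sub>v v) = - (?d *\<^sub>v (?c *\<^sub>v v))"
    by (rule neg) (use v(4) d assms(2) in \<open>simp add: mat_vec_dim\<close>)
  have bc: "?b *\<^sub>v (?c *\<^sub>v v) = ?c *\<^sub>v (?b *\<^sub>v v)"
    using v(5) d assms(2) by (simp add: mat_vec_dim)
  have *: "?d *\<^sub>v (?a *\<^sub>v v) + ?a *\<^sub>v (?d *\<^sub>v v) = v - ?c *\<^sub>v (?b *\<^sub>v v)"
    using v(10) d assms(2) bc by (simp add: mat_vec_dim)
  show "?d *\<^sub>v (?a *\<^sub>v v) = v - ?c *\<^sub>v (?b *\<^sub>v v) - ?a *\<^sub>v (?d *\<^sub>v v)"
    unfolding *[symmetric] using d by (intro eq_vecI) auto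
qed

text \<open>The basis enters as a family \<open>v k\<close> so that it can be supplied in a form on
  which the action is known, such as products \<open>kronv\<close>.\<close>

lemma d4_moduleI_vec:
  assumes dim: "\<And>g. dim_row (act M g) = mdim M" "\<And>g. dim_col (act M g) = mdim M"
    and "\<And>k. k < mdim M \<Longrightarrow> v k = unit_vec (mdim M) k"
    and
    "\<And>k. k < mdim M \<Longrightarrow> act M Gb *\<^sub>v (act M Ga *\<^sub>v v k) = - (act M Ga *\<^sub>v (act M Gb *\<^sub>v v k))"
    "\<And>k. k < mdim M \<Longrightarrow> act M Gd *\<^sub>v (act M Gb *\<^sub>v v k) = - (act M Gb *\<^sub>v (act M Gd *\<^sub>v v k))"
    "\<And>k. k < mdim M \<Longrightarrow> act M Gc *\<^sub>v (act M Ga *\<^sub>v v k) = - (act M Ga *\<^sub>v (act M Gc *\<^sub>v v k))"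
    "\<And>k. k < mdim M \<Longrightarrow> act M Gd *\<^sub>v (act M Gc *\<^sub>v v k) = - (act M Gc *\<^sub>v (act M Gd *\<^sub>v v k))"
    "\<And>k. k < mdim M \<Longrightarrow> act M Gb *\<^sub>v (act M Gc *\<^sub>v v k) = act M Gc *\<^sub>v (act M Gb *\<^sub>v v k)"
    "\<And>k. k < mdim M \<Longrightarrow> act M Ga *\<^sub>v (act M Ga *\<^sub>v v k) = 0\<^sub>v (mdim M)"
    "\<And>k. k < mdim M \<Longrightarrow> act M Gb *\<^sub>v (act M Gb *\<^sub>v v k) = v k"
    "\<And>k. k < mdim M \<Longrightarrow> act M Gc *\<^sub>v (act M Gc *\<^sub>v v k) = v k"
    "\<And>k. k < mdim M \<Longrightarrow> act M Gd *\<^sub>v (act M Gd *\<^sub>v v k) = 0\<^sub>v (mdim M)"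
    "\<And>k. k < mdim M \<Longrightarrow> act M Gd *\<^sub>v (act M Ga *\<^sub>v v k) + act M Ga *\<^sub>v (act M Gd *\<^sub>v v k) =
       v k - act M Gb *\<^sub>v (act M Gc *\<^sub>v v k)"
  shows "d4_module M"
proof -
  note u = assms(3)[symmetric]
  have v: "dim_vec (v k) = mdim M" if "k < mdim M" for k using that by (simp add: assms(3))
  show ?thesis
    unfolding d4_module_def Let_def
    by (intro conjI; (intro mat_eqI_unit_vec[where n = "mdim M"])?)
       (use dim in \<open>simp_all add: mat_vec_dim u v assms(4-)\<close>)
qed

lemma d4_tensor_simps [simp]:
  "mdim (M \<otimes>\<^sub>D N) = mdim M * mdim N"
  "act (M \<otimes>\<^sub>D N) Ga = kron (act M Ga) (act N Gb) + kron (1\<^sub>m (mdim M)) (act N Ga)"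
  "act (M \<otimes>\<^sub>D N) Gb = kron (act M Gb) (act N Gb)"
  "act (M \<otimes>\<^sub>D N) Gc = kron (act M Gc) (act N Gc)"
  "act (M \<otimes>\<^sub>D N) Gd = kron (act M Gd) (act N Gc) + kron (1\<^sub>m (mdim M)) (act N Gd)"
  by (simp_all add: d4_tensor_def)

lemma d4_tensor_kronv:
  assumes "d4_module M" "d4_module N" "dim_vec v = mdim M" "dim_vec w = mdim N"
  shows
    "act (M \<otimes>\<^sub>D N) Ga *\<^sub>v kronv v w = kronv (act M Ga *\<^sub>v v) (act N Gb *\<^sub>v w) + kronv v (act N Ga *\<^sub>v w)"
    "act (M \<otimes>\<^sub>D N) Gb *\<^sub>v kronv v w = kronv (act M Gb *\<^sub>v v) (act N Gb *\<^sub>v w)"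
    "act (M \<otimes>\<^sub>D N) Gc *\<^sub>v kronv v w = kronv (act M Gc *\<^sub>v v) (act N Gc *\<^sub>v w)"
    "act (M \<otimes>\<^sub>D N) Gd *\<^sub>v kronv v w = kronv (act M Gd *\<^sub>v v) (act N Gc *\<^sub>v w) + kronv v (act N Gd *\<^sub>v w)"
  using assms by (simp_all add: mat_vec_dim d4_module_dim kron_mult_kronv)

text \<open>The comultiplication respects the relations. For da + ad the mixed terms d \<otimes> (ca
  + ac) and a \<otimes> (db + bd) vanish, and (1 - bc) \<otimes> bc + 1 \<otimes> (1 - bc) = 1 - bc
  \<otimes> bc remains.\<close>

lemma d4_tensor_relations:
  fixes M N :: "'k::field d4_mod"
  assumes "d4_module M" "d4_module N" "dim_vec v = mdim M" "dim_vec w = mdim N"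
  defines "T \<equiv> act (M \<otimes>\<^sub>D N)" and "x \<equiv> kronv v w"
  shows
    "T Gb *\<^sub>v (T Ga *\<^sub>v x) = - (T Ga *\<^sub>v (T Gb *\<^sub>v x))"
    "T Gd *\<^sub>v (T Gb *\<^sub>v x) = - (T Gb *\<^sub>v (T Gd *\<^sub>v x))"
    "T Gc *\<^sub>v (T Ga *\<^sub>v x) = - (T Ga *\<^sub>v (T Gc *\<^sub>v x))"
    "T Gd *\<^sub>v (T Gc *\<^sub>v x) = - (T Gc *\<^sub>v (T Gd *\<^sub>v x))"
    "T Gb *\<^sub>v (T Gc *\<^sub>v x) = T Gc *\<^sub>v (T Gb *\<^sub>v x)"
    "T Ga *\<^sub>v (T Ga *\<^sub>v x) = 0\<^sub>v (mdim M * mdim N)"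
    "T Gb *\<^sub>v (T Gb *\<^sub>v x) = x"
    "T Gc *\<^sub>v (T Gc *\<^sub>v x) = x"
    "T Gd *\<^sub>v (T Gd *\<^sub>v x) = 0\<^sub>v (mdim M * mdim N)"
    "T Gd *\<^sub>v (T Ga *\<^sub>v x) + T Ga *\<^sub>v (T Gd *\<^sub>v x) = x - T Gb *\<^sub>v (T Gc *\<^sub>v x)"
proof -
  have d: "dim_col (T g) = mdim M * mdim N" for g
    by (cases g) (use assms in \<open>simp_all add: d4_module_dim T_def\<close>)
  note t = d4_tensor_kronv[OF assms(1,2), folded T_def]
  note simps = x_def t d assms(1-4) d4_module_dim d4_module_vec mult_vec_add_dim kronv_linear

  note idx = index_kronv index_add_vec index_minus_vec index_uminus_vec index_zero_vec dim_kronv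
    dim_mult_mat_vec div_mod_less

  note simps' = simps mult_vec_uminus_dim mult_vec_minus_dim mult_vec_zero_dim
  show
    "T Gb *\<^sub>v (T Ga *\<^sub>v x) = - (T Ga *\<^sub>v (T Gb *\<^sub>v x))"
    "T Gd *\<^sub>v (T Gb *\<^sub>v x) = - (T Gb *\<^sub>v (T Gd *\<^sub>v x))"
    "T Gc *\<^sub>v (T Ga *\<^sub>v x) = - (T Ga *\<^sub>v (T Gc *\<^sub>v x))"
    "T Gd *\<^sub>v (T Gc *\<^sub>v x) = - (T Gc *\<^sub>v (T Gd *\<^sub>v x))"
    "T Gb *\<^sub>v (T Gc *\<^sub>v x) = T Gc *\<^sub>v (T Gb *\<^sub>v x)"
    "T Ga *\<^sub>v (T Ga *\<^sub>v x) = 0\<^sub>v (mdim M * mdim N)"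
    "T Gb *\<^sub>v (T Gb *\<^sub>v x) = x"
    "T Gc *\<^sub>v (T Gc *\<^sub>v x) = x"
    "T Gd *\<^sub>v (T Gd *\<^sub>v x) = 0\<^sub>v (mdim M * mdim N)"
    "T Gd *\<^sub>v (T Ga *\<^sub>v x) + T Ga *\<^sub>v (T Gd *\<^sub>v x) = x - T Gb *\<^sub>v (T Gc *\<^sub>v x)"
    by (simp_all add: simps' del: index_mult_mat_vec)
       ((intro eq_vecI; simp add: algebra_simps assms(1-4) d4_module_dim del: index_mult_mat_vec index_kronv)+)
qed

lemma d4_module_tensor:
  assumes "d4_module M" "d4_module N"
  shows "d4_module (M \<otimes>\<^sub>D N)"
proof (rule d4_moduleI_vec[where v =
      "\<lambda>k. kronv (unit_vec (mdim M) (k div mdim N)) (unit_vec (mdim N) (k mod mdim N))"], goal_cases)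
  case (1 g) then show ?case by (cases g) (use assms in \<open>simp_all add: d4_module_dim\<close>)
next
  case (2 g) then show ?case by (cases g) (use assms in \<open>simp_all add: d4_module_dim\<close>)
next
  case (3 k) then show ?case by (simp add: unit_vec_kronv)
qed (use d4_tensor_relations[OF assms] in \<open>simp_all del: d4_tensor_simps(2-)\<close>)

lemma d4_iso_tensor:
  assumes "M \<cong>\<^sub>D M'" "N \<cong>\<^sub>D N'" "d4_module M" "d4_module M'" "d4_module N" "d4_module N'"
  shows "M \<otimes>\<^sub>D N \<cong>\<^sub>D M' \<otimes>\<^sub>D N'"
proof -
  obtain F F' where F: "d4_hom M M' F" "d4_hom M' M F'" "F' * F = 1\<^sub>m (mdim M)" "F * F' = 1\<^sub>m (mdim M')"
    using assms(1) by (rule d4_isoE)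
  obtain G G' where G: "d4_hom N N' G" "d4_hom N' N G'" "G' * G = 1\<^sub>m (mdim N)" "G * G' = 1\<^sub>m (mdim N')"
    using assms(2) by (rule d4_isoE)
  note d = d4_hom_dim[OF F(1)] d4_hom_dim[OF F(2)] d4_hom_dim[OF G(1)] d4_hom_dim[OF G(2)]
  have "d4_hom (M \<otimes>\<^sub>D N) (M' \<otimes>\<^sub>D N') (kron F G)"
    unfolding d4_hom_iff
  proof (intro conjI allI)
    fix g
    show "kron F G * act (M \<otimes>\<^sub>D N) g = act (M' \<otimes>\<^sub>D N') g * kron F G"
      using F(1) G(1) assms d
      by (cases g) (simp_all add: d4_module_dim mult_add_distrib_dim add_mult_distrib_dim kron_mult
        d4_hom_iff one_mult_dim)
  qed (use d in simp_all)
  then show ?thesis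
    by (rule d4_isoI[where G = "kron F' G'"])
       (use assms F G d in \<open>simp_all add: d4_module_tensor kron_mult kron_one\<close>)
qed

section \<open>Direct sums and multiples\<close>

lemma d4_sum_simps [simp]:
  "mdim (M \<oplus>\<^sub>D N) = mdim M + mdim N"
  "act (M \<oplus>\<^sub>D N) g = four_block_mat (act M g) (0\<^sub>m (mdim M) (mdim N)) (0\<^sub>m (mdim N) (mdim M)) (act N g)"
  by (simp_all add: d4_sum_def)

definition diag2 :: "'k::field mat \<Rightarrow> 'k mat \<Rightarrow> 'k mat" where
  "diag2 A B = four_block_mat A (0\<^sub>m (dim_row A) (dim_col B)) (0\<^sub>m (dim_row B) (dim_col A)) B"

lemma dim_diag2 [simp]:
  "dim_row (diag2 A B) = dim_row A + dim_row B" "dim_col (diag2 A B) = dim_col A + dim_col B"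
  by (simp_all add: diag2_def)

lemma diag2_mult:
  assumes "dim_col A = dim_row C" "dim_col B = dim_row D"
  shows "diag2 A B * diag2 C D = diag2 (A * C) (B * D)"
  unfolding diag2_def
  by (subst mult_four_block_mat[of _ "dim_row A" "dim_row C" _ "dim_row D" _ "dim_row B" _ _ "dim_col C" _ "dim_col D"])
     (use assms in \<open>simp_all add: zero_mult_dim\<close>)

lemma diag2_add:
  assumes "dim_row A = dim_row C" "dim_col A = dim_col C" "dim_row B = dim_row D" "dim_col B = dim_col D"
  shows "diag2 A B + diag2 C D = diag2 (A + C) (B + D)"
    "diag2 A B - diag2 C D = diag2 (A - C) (B - D)"
  unfolding diag2_def by (intro eq_matI; use assms in simp)+

lemma diag2_uminus: "- diag2 A B = diag2 (- A) (- B)"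
  unfolding diag2_def by (intro eq_matI) auto

lemma diag2_one: "diag2 (1\<^sub>m m) (1\<^sub>m n) = 1\<^sub>m (m + n)"
  and diag2_zero: "diag2 (0\<^sub>m m m') (0\<^sub>m n n') = 0\<^sub>m (m + n) (m' + n')"
  unfolding diag2_def by simp_all

lemma act_sum:
  assumes "d4_module M" "d4_module N"
  shows "act (M \<oplus>\<^sub>D N) g = diag2 (act M g) (act N g)"
  using assms by (simp add: diag2_def d4_module_dim)

lemma d4_module_sum:
  assumes "d4_module M" "d4_module N"
  shows "d4_module (M \<oplus>\<^sub>D N)"
  using assms d4_module_dim[OF assms(1)] d4_module_dim[OF assms(2)] unfolding d4_module_def Let_def act_sum[OF assms]
  by (simp add: diag2_mult diag2_add diag2_uminus diag2_one[symmetric] diag2_zero[symmetric] del: d4_sum_simps(2))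

lemma d4_iso_sum:
  assumes "M \<cong>\<^sub>D M'" "N \<cong>\<^sub>D N'" "d4_module M" "d4_module M'" "d4_module N" "d4_module N'"
  shows "M \<oplus>\<^sub>D N \<cong>\<^sub>D M' \<oplus>\<^sub>D N'"
proof -
  obtain F F' where F: "d4_hom M M' F" "d4_hom M' M F'" "F' * F = 1\<^sub>m (mdim M)" "F * F' = 1\<^sub>m (mdim M')"
    using assms(1) by (rule d4_isoE)
  obtain G G' where G: "d4_hom N N' G" "d4_hom N' N G'" "G' * G = 1\<^sub>m (mdim N)" "G * G' = 1\<^sub>m (mdim N')"
    using assms(2) by (rule d4_isoE)
  note d = d4_hom_dim[OF F(1)] d4_hom_dim[OF F(2)] d4_hom_dim[OF G(1)] d4_hom_dim[OF G(2)]
  have "d4_hom (M \<oplus>\<^sub>D N) (M' \<oplus>\<^sub>D N') (diag2 F G)"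
    using F(1) G(1) assms d unfolding d4_hom_iff
    by (simp add: act_sum diag2_mult d4_module_dim del: d4_sum_simps(2))
  then show ?thesis
    by (rule d4_isoI[where G = "diag2 F' G'"])
       (use assms F G d in \<open>simp_all add: d4_module_sum diag2_mult diag2_one\<close>)
qed

text \<open>The sum of n copies of \<open>M\<close> is k^n \<otimes> \<open>M\<close> with the
  generators acting on the second factor only. This makes the iterated block matrices computable on
  vectors \<open>kronv (unit_vec n k) w\<close>.\<close>

lemma d4_copies_kron:
  assumes "\<And>g. act M g \<in> carrier_mat (mdim M) (mdim M)"
  shows "n \<odot>\<^sub>D M = \<lparr> mdim = n * mdim M, act = \<lambda>g. kron (1\<^sub>m n) (act M g) \<rparr>"
proof (induction n)
  case 0
  then show ?case by (auto simp: d4_copies_def d4_zero_def fun_eq_iff intro!: eq_matI)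
next
  case (Suc n)
  have "kron (1\<^sub>m (Suc n)) (act M g) =
      four_block_mat (act M g) (0\<^sub>m (mdim M) (n * mdim M)) (0\<^sub>m (n * mdim M) (mdim M)) (kron (1\<^sub>m n) (act M g))" for g
  proof (rule eq_matI)
    fix i j
    let ?m = "mdim M"
    assume "i < dim_row (four_block_mat (act M g) (0\<^sub>m ?m (n * ?m)) (0\<^sub>m (n * ?m) ?m) (kron (1\<^sub>m n) (act M g)))"
      "j < dim_col (four_block_mat (act M g) (0\<^sub>m ?m (n * ?m)) (0\<^sub>m (n * ?m) ?m) (kron (1\<^sub>m n) (act M g)))"
    then have ij: "i < Suc n * ?m" "j < Suc n * ?m" using assms[of g] by auto
    show "kron (1\<^sub>m (Suc n)) (act M g) $$ (i, j) =
      four_block_mat (act M g) (0\<^sub>m ?m (n * ?m)) (0\<^sub>m (n * ?m) ?m) (kron (1\<^sub>m n) (act M g)) $$ (i, j)"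
      using ij div_mod_less[OF ij(1)] div_mod_less[OF ij(2)] assms[of g]
      by (auto simp: le_div_geq le_mod_geq not_less div_mod_less)
  qed (use assms in auto)
  moreover have "Suc n \<odot>\<^sub>D M = M \<oplus>\<^sub>D (n \<odot>\<^sub>D M)"
    by (simp add: d4_copies_def)
  ultimately show ?case using Suc by (simp add: d4_sum_def fun_eq_iff)
qed

lemma d4_copies_simps:
  assumes "d4_module M"
  shows "mdim (n \<odot>\<^sub>D M) = n * mdim M" "act (n \<odot>\<^sub>D M) g = kron (1\<^sub>m n) (act M g)"
  using d4_copies_kron[of M n] assms by (simp_all add: d4_module_dim)

lemma d4_module_copies:
  assumes "d4_module M"
  shows "d4_module (n \<odot>\<^sub>D M)"
proof (induction n)
  case 0
  have "d4_module (d4_zero :: 'a d4_mod)"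
    unfolding d4_module_def Let_def by (auto simp: d4_zero_def intro!: eq_matI)
  then show ?case by (simp add: d4_copies_def)
next
  case (Suc n)
  then show ?case using assms d4_module_sum by (simp add: d4_copies_def)
qed

lemma d4_iso_copies:
  assumes "M \<cong>\<^sub>D N" "d4_module M" "d4_module N"
  shows "n \<odot>\<^sub>D M \<cong>\<^sub>D n \<odot>\<^sub>D N"
proof (induction n)
  case 0
  then show ?case using d4_iso_refl[OF d4_module_copies[OF assms(2), of 0]] by (simp add: d4_copies_def)
next
  case (Suc n)
  then show ?case
    using d4_iso_sum[OF assms(1) Suc assms(2,3)] assms by (simp add: d4_copies_def d4_module_copies[unfolded d4_copies_def])
qed


subsection \<open>Transposition\<close>

definition d4_dual :: "'k::field d4_mod \<Rightarrow> 'k d4_mod" where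
  "d4_dual M = \<lparr> mdim = mdim M, act = \<lambda>g. transpose_mat (act M g) \<rparr>"

lemma d4_dual_simps [simp]:
  "mdim (d4_dual M) = mdim M" "act (d4_dual M) g = transpose_mat (act M g)"
  by (simp_all add: d4_dual_def)

lemma d4_dual_dual [simp]: "d4_dual (d4_dual M) = M"
  by (simp add: d4_dual_def)

lemma transpose_mult_dim:
  "dim_col A = dim_row B \<Longrightarrow> transpose_mat (A * B) = transpose_mat B * transpose_mat (A :: 'k::field mat)"
  by (rule transpose_mult[of _ "dim_row A" "dim_row B" _ "dim_col B"]) auto

lemma transpose_arith_dim:
  "dim_row A = dim_row B \<Longrightarrow> dim_col A = dim_col B \<Longrightarrow>
     transpose_mat (A + B) = transpose_mat A + transpose_mat (B :: 'k::field mat)"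
  "dim_row A = dim_row B \<Longrightarrow> dim_col A = dim_col B \<Longrightarrow>
     transpose_mat (A - B) = transpose_mat A - transpose_mat (B :: 'k::field mat)"
  "transpose_mat (- A) = - transpose_mat A"
  by (intro eq_matI; simp)+

text \<open>The defining relations are symmetric under reversing products.\<close>
lemma d4_module_dual:
  assumes "d4_module M"
  shows "d4_module (d4_dual M)"
proof -
  note d = d4_module_dim[OF assms]
  let ?n = "mdim M" and ?a = "act M Ga" and ?b = "act M Gb" and ?c = "act M Gc" and ?d = "act M Gd"
  have r: "?b * ?a = - (?a * ?b)" "?d * ?b = - (?b * ?d)" "?c * ?a = - (?a * ?c)"
    "?d * ?c = - (?c * ?d)" "?b * ?c = ?c * ?b" "?a * ?a = 0\<^sub>m ?n ?n" "?b * ?b = 1\<^sub>m ?n"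
    "?c * ?c = 1\<^sub>m ?n" "?d * ?d = 0\<^sub>m ?n ?n" "?d * ?a + ?a * ?d = 1\<^sub>m ?n - ?b * ?c"
    using assms(1) by (simp_all add: d4_module_def Let_def)
  note t = r[THEN arg_cong[of _ _ transpose_mat]]
  have s: "transpose_mat ?b * transpose_mat ?a = - (transpose_mat ?a * transpose_mat ?b)"
    "transpose_mat ?d * transpose_mat ?b = - (transpose_mat ?b * transpose_mat ?d)"
    "transpose_mat ?c * transpose_mat ?a = - (transpose_mat ?a * transpose_mat ?c)"
    "transpose_mat ?d * transpose_mat ?c = - (transpose_mat ?c * transpose_mat ?d)"
    using t(1-4) d by (simp_all add: transpose_mult_dim transpose_arith_dim)
  have s': "transpose_mat ?d * transpose_mat ?a + transpose_mat ?a * transpose_mat ?d =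
      1\<^sub>m ?n - transpose_mat ?b * transpose_mat ?c"
    using t(10) d
    by (subst comm_add_mat[of _ ?n ?n])
       (simp_all add: transpose_mult_dim transpose_arith_dim r(5))
  have s'': "transpose_mat ?b * transpose_mat ?c = transpose_mat ?c * transpose_mat ?b"
    using arg_cong[OF r(5), of transpose_mat] d by (simp add: transpose_mult_dim)
  show ?thesis
    unfolding d4_module_def Let_def
    using t(6-9) s s' s'' d by (simp add: transpose_mult_dim transpose_arith_dim r(5))
qed

lemma d4_hom_dual:
  assumes "d4_hom M N F" "d4_module M" "d4_module N"
  shows "d4_hom (d4_dual N) (d4_dual M) (transpose_mat F)"
  unfolding d4_hom_iff
proof (intro conjI allI)
  fix g
  have "transpose_mat (F * act M g) = transpose_mat (act N g * F)"
    using assms(1) by (simp add: d4_hom_iff)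
  then show "transpose_mat F * act (d4_dual N) g = act (d4_dual M) g * transpose_mat F"
    using assms by (simp add: transpose_mult_dim d4_hom_dim d4_module_dim)
qed (use assms in \<open>simp_all add: d4_hom_dim\<close>)

lemma d4_iso_dual:
  assumes "M \<cong>\<^sub>D N" "d4_module M" "d4_module N"
  shows "d4_dual M \<cong>\<^sub>D d4_dual N"
proof -
  obtain F G where F: "d4_hom M N F" "d4_hom N M G" "G * F = 1\<^sub>m (mdim M)" "F * G = 1\<^sub>m (mdim N)"
    using assms(1) by (rule d4_isoE)
  note d = d4_hom_dim[OF F(1)] d4_hom_dim[OF F(2)]
  have "d4_hom (d4_dual M) (d4_dual N) (transpose_mat G)"
    using d4_hom_dual[OF F(2) assms(3,2)] .
  then show ?thesis
    by (rule d4_isoI[where G = "transpose_mat F"])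
       (use F d assms in \<open>simp_all add: d4_module_dual transpose_mult_dim[symmetric]\<close>)
qed

text \<open>An equality, with the factors in the same order: each summand of \<Delta> of a generator
  is a tensor of generators or 1, so transposition finds no product to reverse.\<close>

lemma d4_dual_tensor: "d4_dual (M \<otimes>\<^sub>D N) = d4_dual M \<otimes>\<^sub>D d4_dual N"
  if "d4_module M" "d4_module N"
proof -
  have "act (d4_dual (M \<otimes>\<^sub>D N)) g = act (d4_dual M \<otimes>\<^sub>D d4_dual N) g" for g
    using that by (cases g) (simp_all add: transpose_kron transpose_arith_dim d4_module_dim)
  then show ?thesis by (intro d4_mod.equality ext) auto
qed

lemma d4_dual_sum: "d4_dual (M \<oplus>\<^sub>D N) = d4_dual M \<oplus>\<^sub>D d4_dual N"
  if "d4_module M" "d4_module N"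
proof -
  have "act (d4_dual (M \<oplus>\<^sub>D N)) g = act (d4_dual M \<oplus>\<^sub>D d4_dual N) g" for g
    using that by (auto simp: d4_module_dim intro!: eq_matI)
  then show ?thesis by (intro d4_mod.equality ext) auto
qed

lemma d4_dual_copies: "d4_dual (n \<odot>\<^sub>D M) = n \<odot>\<^sub>D d4_dual M" if "d4_module M"
proof -
  have "act (d4_dual (n \<odot>\<^sub>D M)) g = act (n \<odot>\<^sub>D d4_dual M) g" for g
    using that by (simp add: d4_copies_simps d4_module_dual transpose_kron)
  then show ?thesis
    by (intro d4_mod.equality ext) (auto simp: d4_copies_simps d4_module_dual that)
qed

text \<open>Over a field a monomorphism has a linear left inverse, so its transpose is an
  epimorphism; one lifts against it and transposes back.\<close>

lemma projective_dual_injective: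
  fixes Q :: "'k::field d4_mod"
  assumes "d4_projective Q"
  shows "d4_injective (d4_dual Q)"
  unfolding d4_injective_def
proof (intro conjI allI impI, goal_cases)
  case 1
  then show ?case using assms by (simp add: d4_projective_def d4_module_dual)
next
  case (2 M N f h)
  then have m: "d4_module M" "d4_module N" and f: "d4_mono M N f" "d4_hom M N f"
    and h: "d4_hom M (d4_dual Q) h"
    by (auto simp: d4_mono_def)
  have Q: "d4_module Q" using assms by (simp add: d4_projective_def)
  note d = d4_hom_dim[OF f(2)] d4_hom_dim[OF h]
  obtain L where L: "L \<in> carrier_mat (dim_col f) (dim_row f)" "L * f = 1\<^sub>m (dim_col f)"
    by (rule inj_left_inverse[of f]) (use f(1) d in \<open>simp add: d4_mono_def\<close>)
  have "mat_image (transpose_mat f) = carrier_vec (dim_row (transpose_mat f))"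
    by (rule right_inverse_surj[of "transpose_mat L"])
       (use L in \<open>simp_all add: transpose_mult_dim[symmetric]\<close>)
  then have "d4_epi (d4_dual N) (d4_dual M) (transpose_mat f)"
    using d4_hom_dual[OF f(2) m] d by (simp add: d4_epi_def)
  moreover have "d4_hom Q (d4_dual M) (transpose_mat h)"
    using d4_hom_dual[OF h m(1) d4_module_dual[OF Q]] by simp
  ultimately obtain k where k: "d4_hom Q (d4_dual N) k" "transpose_mat f * k = transpose_mat h"
    using projective_lift[OF assms d4_module_dual[OF m(2)] d4_module_dual[OF m(1)]] by blast
  have "transpose_mat (transpose_mat f * k) = h" using k(2) by simp
  then have "transpose_mat k * f = h"
    using d d4_hom_dim[OF k(1)] by (simp add: transpose_mult_dim)
  moreover have "d4_hom N (d4_dual Q) (transpose_mat k)"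
    using d4_hom_dual[OF k(1) Q d4_module_dual[OF m(2)]] by simp
  ultimately show ?case by blast
qed


subsection \<open>Splitting off a direct summand\<close>

text \<open>The pair of \<open>p\<close> and \<open>q\<close> is a homomorphism \<open>F\<close> to
  the sum, while the sections \<open>i\<close> and \<open>j\<close> are merely linear. Correcting
  \<open>j\<close> by \<open>i q j\<close> gives a right inverse \<open>G\<close> of
  \<open>F\<close>, and equality of dimensions makes it two-sided.\<close>

lemma d4_split:
  fixes X Y Q :: "'k::field d4_mod"
  assumes m: "d4_module X" "d4_module Y" "d4_module Q"
    and "d4_hom X Y p" "d4_hom X Q q" "i \<in> carrier_mat (mdim X) (mdim Q)" "j \<in> carrier_mat (mdim X) (mdim Y)"
    and "q * i = 1\<^sub>m (mdim Q)" "p * i = 0\<^sub>m (mdim Y) (mdim Q)" "p * j = 1\<^sub>m (mdim Y)"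
    and dim: "mdim X = mdim Y + mdim Q"
  shows "X \<cong>\<^sub>D Y \<oplus>\<^sub>D Q"
proof -
  note d = d4_hom_dim[OF assms(4)] d4_hom_dim[OF assms(5)]
  have dj: "dim_row i = mdim X" "dim_col i = mdim Q" "dim_row j = mdim X" "dim_col j = mdim Y"
    using assms by auto
  let ?y = "mdim Y" and ?q = "mdim Q" and ?x = "mdim X"
  \<comment> \<open>Blocks of width or height 0 express stacking and juxtaposition as four-block
    matrices.\<close>
  define F where "F = four_block_mat p (0\<^sub>m ?y 0) q (0\<^sub>m ?q 0)"
  define G where "G = four_block_mat (j - i * (q * j)) i (0\<^sub>m 0 ?y) (0\<^sub>m 0 ?q)"
  have 0: "1\<^sub>m ?y - 0\<^sub>m ?y ?y = (1\<^sub>m ?y :: 'k mat)" by (intro eq_matI) auto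
  have "p * (j - i * (q * j)) = p * j - (p * i) * (q * j)"
    using d dj by (simp add: mult_minus_distrib_dim mult_assoc_dim)
  then have 1: "p * (j - i * (q * j)) = 1\<^sub>m ?y"
    using assms(9,10) d dj 0 by (simp add: zero_mult_dim)
  have "q * (j - i * (q * j)) = q * j - (q * i) * (q * j)"
    using d dj by (simp add: mult_minus_distrib_dim mult_assoc_dim)
  then have 2: "q * (j - i * (q * j)) = 0\<^sub>m ?q ?y"
    using assms(8) d dj by (simp add: one_mult_dim)
  have "F * G = four_block_mat (1\<^sub>m ?y) (0\<^sub>m ?y ?q) (0\<^sub>m ?q ?y) (1\<^sub>m ?q)"
    unfolding F_def G_def
    by (subst mult_four_block_mat[of _ ?y ?x _ 0 _ ?q _ _ ?y _ ?q])
       (use assms 1 2 d dj in \<open>auto intro!: eq_matI\<close>)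
  then have FG: "F * G = 1\<^sub>m (?y + ?q)" by simp
  have c: "F \<in> carrier_mat (?y + ?q) (?y + ?q)" "G \<in> carrier_mat (?y + ?q) (?y + ?q)"
    using d dj dim by (simp_all add: F_def G_def)
  have "d4_hom X (Y \<oplus>\<^sub>D Q) F"
    unfolding d4_hom_iff
  proof (intro conjI allI)
    fix g
    have x: "act X g = four_block_mat (act X g) (0\<^sub>m ?x 0) (0\<^sub>m 0 ?x) (0\<^sub>m 0 0)"
      using m by (auto intro!: eq_matI simp: d4_module_dim)
    have "F * act X g = four_block_mat (p * act X g) (0\<^sub>m ?y 0) (q * act X g) (0\<^sub>m ?q 0)"
      unfolding F_def
      by (subst x, subst mult_four_block_mat[of _ ?y ?x _ 0 _ ?q _ _ ?x _ 0])
         (use m d in \<open>auto simp: d4_module_dim intro!: eq_matI\<close>)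
    also have "\<dots> = act (Y \<oplus>\<^sub>D Q) g * F"
      unfolding F_def d4_sum_simps
      by (subst mult_four_block_mat[of _ ?y ?y _ ?q _ ?q _ _ ?x _ 0])
         (use m d assms(4,5) in \<open>auto simp: d4_module_dim d4_hom_iff intro!: eq_matI\<close>)
    finally show "F * act X g = act (Y \<oplus>\<^sub>D Q) g * F" .
  qed (use c dim in simp_all)
  then show ?thesis
    by (rule d4_isoI[where G = G])
       (use c FG m square_inverse_commute[OF c FG] dim in \<open>simp_all add: d4_module_sum\<close>)
qed

subsection \<open>Minimal resolutions\<close>

text \<open>From \<open>b = c\<close> and c^2 = 1 follows bc = 1, so the right-hand side 1 - bc of
  the last relation vanishes.\<close>

lemma d4_module_da:
  assumes "d4_module M" "act M Gb = act M Gc" "dim_vec v = mdim M"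
  shows "act M Gd *\<^sub>v (act M Ga *\<^sub>v v) = - (act M Ga *\<^sub>v (act M Gd *\<^sub>v v))"
proof -
  have "act M Gc *\<^sub>v (act M Gb *\<^sub>v v) = v"
    using d4_module_vec(8)[OF assms(1,3)] assms(2) by simp
  then show ?thesis
    using d4_module_vec(10)[OF assms(1,3)] assms by (auto intro!: eq_vecI simp: d4_module_dim)
qed

text \<open>Nakayama's lemma for the ideal generated by a and d, whose third power acts as 0 here: Q
  = U + aQ + dQ puts adQ into \<open>U\<close>, then aQ and dQ, and then Q.\<close>

lemma superfluous_kernel:
  fixes Q :: "'k::field d4_mod"
  assumes Q: "d4_module Q" "act Q Gb = act Q Gc"
    and rad: "\<And>w. w \<in> mat_kernel f \<Longrightarrow>
      \<exists>y z. dim_vec y = mdim Q \<and> dim_vec z = mdim Q \<and> w = act Q Ga *\<^sub>v y + act Q Gd *\<^sub>v z"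
    and U: "d4_submodule Q U" "{u + w | u w. u \<in> U \<and> w \<in> mat_kernel f} = carrier_vec (mdim Q)"
  shows "U = carrier_vec (mdim Q)"
proof -
  let ?a = "act Q Ga" and ?d = "act Q Gd"
  note dim = d4_module_dim[OF Q(1)] and rel = d4_module_vec(6,9)[OF Q(1)] d4_module_da[OF Q]
  have Ud: "dim_vec u = mdim Q" if "u \<in> U" for u
    using U(1) that by (auto simp: d4_submodule_def)
  have Ug: "act Q g *\<^sub>v u \<in> U" if "u \<in> U" for u g
    using U(1) that by (auto simp: d4_submodule_def)
  have Uadd: "u + v \<in> U" if "u \<in> U" "v \<in> U" for u v
    using U(1) that by (auto simp: d4_submodule_def)
  have Uneg: "- u \<in> U" if "u \<in> U" for u
  proof -
    have "(- 1) \<cdot>\<^sub>v u \<in> U" using U(1) that by (auto simp: d4_submodule_def)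
    moreover have "(- 1) \<cdot>\<^sub>v u = - u" by (intro eq_vecI) auto
    ultimately show ?thesis by simp
  qed
  have dec: "\<exists>u\<in>U. \<exists>y z. dim_vec y = mdim Q \<and> dim_vec z = mdim Q \<and> q = u + (?a *\<^sub>v y + ?d *\<^sub>v z)"
    if "dim_vec q = mdim Q" for q
  proof -
    have "q \<in> {u + w | u w. u \<in> U \<and> w \<in> mat_kernel f}" using U(2) that by simp
    then show ?thesis using rad by blast
  qed
  have ad: "?a *\<^sub>v (?d *\<^sub>v q) \<in> U" if q: "dim_vec q = mdim Q" for q
  proof -
    obtain u y z where u: "u \<in> U" "dim_vec y = mdim Q" "dim_vec z = mdim Q"
      "q = u + (?a *\<^sub>v y + ?d *\<^sub>v z)" using dec[OF q] by auto
    \<comment> \<open>The part from aQ + dQ disappears because a d a = - a a d = 0 and d d =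
      0.\<close>
    have "?a *\<^sub>v (?d *\<^sub>v q) = ?a *\<^sub>v (?d *\<^sub>v u)"
      using u Ud[OF u(1)] dim by (auto simp: mat_vec_dim rel simp del: index_mult_mat_vec intro!: eq_vecI)
    then show ?thesis using Ug u by simp
  qed
  have a: "?a *\<^sub>v q \<in> U" if q: "dim_vec q = mdim Q" for q
  proof -
    obtain u y z where u: "u \<in> U" "dim_vec y = mdim Q" "dim_vec z = mdim Q"
      "q = u + (?a *\<^sub>v y + ?d *\<^sub>v z)" using dec[OF q] by auto
    have "?a *\<^sub>v q = ?a *\<^sub>v u + ?a *\<^sub>v (?d *\<^sub>v z)"
      using u Ud[OF u(1)] dim by (auto simp: mat_vec_dim rel simp del: index_mult_mat_vec intro!: eq_vecI)
    then show ?thesis using Ug[OF u(1)] ad[OF u(3)] Uadd by simp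
  qed
  have d: "?d *\<^sub>v q \<in> U" if q: "dim_vec q = mdim Q" for q
  proof -
    obtain u y z where u: "u \<in> U" "dim_vec y = mdim Q" "dim_vec z = mdim Q"
      "q = u + (?a *\<^sub>v y + ?d *\<^sub>v z)" using dec[OF q] by auto
    have "?d *\<^sub>v q = ?d *\<^sub>v u + - (?a *\<^sub>v (?d *\<^sub>v y))"
      using u Ud[OF u(1)] dim by (auto simp: mat_vec_dim rel simp del: index_mult_mat_vec intro!: eq_vecI)
    then show ?thesis using Ug[OF u(1)] ad[OF u(2)] Uadd Uneg by simp
  qed
  have "q \<in> U" if q: "dim_vec q = mdim Q" for q
  proof -
    obtain u y z where "u \<in> U" "dim_vec y = mdim Q" "dim_vec z = mdim Q"
      "q = u + (?a *\<^sub>v y + ?d *\<^sub>v z)" using dec[OF q] by auto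
    then show ?thesis using a d Uadd by simp
  qed
  then show ?thesis using Ud by auto
qed

text \<open>A vector of \<open>U\<close> killed by a and d lies in \<open>S\<close>, hence is 0. For
  u in \<open>U\<close> this applies to a d u, then to a u and d u, and then to u itself.\<close>

lemma essential_image:
  fixes I :: "'k::field d4_mod"
  assumes I: "d4_module I" "act I Gb = act I Gc"
    and soc: "\<And>x. dim_vec x = mdim I \<Longrightarrow> act I Ga *\<^sub>v x = 0\<^sub>v (mdim I) \<Longrightarrow> act I Gd *\<^sub>v x = 0\<^sub>v (mdim I)
      \<Longrightarrow> x \<in> S"
    and U: "d4_submodule I U" "U \<inter> S = {0\<^sub>v (mdim I)}"
  shows "U = {0\<^sub>v (mdim I)}"
proof -
  let ?a = "act I Ga" and ?d = "act I Gd"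
  note dim = d4_module_dim[OF I(1)] and rel = d4_module_vec(6,9)[OF I(1)] d4_module_da[OF I]
  have Ud: "dim_vec u = mdim I" if "u \<in> U" for u
    using U(1) that by (auto simp: d4_submodule_def)
  have Ug: "act I g *\<^sub>v u \<in> U" if "u \<in> U" for u g
    using U(1) that by (auto simp: d4_submodule_def)
  have z: "u = 0\<^sub>v (mdim I)" if "u \<in> U" "?a *\<^sub>v u = 0\<^sub>v (mdim I)" "?d *\<^sub>v u = 0\<^sub>v (mdim I)" for u
  proof -
    have "u \<in> U \<inter> S" using soc[OF Ud[OF that(1)] that(2,3)] that(1) by simp
    then show ?thesis using U(2) by simp
  qed
  have "u = 0\<^sub>v (mdim I)" if u: "u \<in> U" for u
  proof -
    have ad: "?a *\<^sub>v (?d *\<^sub>v u) = 0\<^sub>v (mdim I)"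
      by (rule z) (use Ug[OF Ug[OF u]] Ud[OF u] dim in
        \<open>simp_all add: rel mult_vec_uminus_dim mult_vec_zero_dim\<close>)
    have "?a *\<^sub>v u = 0\<^sub>v (mdim I)"
      by (rule z) (use Ug[OF u] Ud[OF u] ad in \<open>simp_all add: rel\<close>)
    moreover have "?d *\<^sub>v u = 0\<^sub>v (mdim I)"
      by (rule z) (use Ug[OF u] Ud[OF u] ad in \<open>simp_all add: rel\<close>)
    ultimately show ?thesis by (rule z[OF u])
  qed
  moreover have "0\<^sub>v (mdim I) \<in> U" using U(1) by (simp add: d4_submodule_def)
  ultimately show ?thesis by blast
qed

text \<open>
  The sequence \<open>0 \<rightarrow> K \<rightarrow> Q \<rightarrow> M \<rightarrow> 0\<close> is split exact over the field (by \<open>R\<close> and \<open>L\<close>), and its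
  minimality is witnessed by \<open>Y\<close> and \<open>Z\<close>.
\<close>
locale minimal_presentation =
  fixes M K Q :: "'k::field d4_mod" and f i R L Y Z :: "'k mat"
  assumes modules: "d4_module M" "d4_module K" "d4_projective Q"
    and bc: "act Q Gb = act Q Gc"
    and homs: "d4_hom Q M f" "d4_hom K Q i"
    and carriers: "R \<in> carrier_mat (mdim Q) (mdim M)" "L \<in> carrier_mat (mdim K) (mdim Q)"
      "Y \<in> carrier_mat (mdim Q) (mdim K)" "Z \<in> carrier_mat (mdim Q) (mdim K)"
    and splitting: "f * R = 1\<^sub>m (mdim M)" "L * i = 1\<^sub>m (mdim K)" "f * i = 0\<^sub>m (mdim M) (mdim K)"
      "R * f + i * L = 1\<^sub>m (mdim Q)"
    and minimal: "i = act Q Ga * Y + act Q Gd * Z"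
begin

lemma module_Q: "d4_module Q"
  using modules(3) by (simp add: d4_projective_def)

lemma dims:
  "dim_row f = mdim M" "dim_col f = mdim Q" "dim_row i = mdim Q" "dim_col i = mdim K"
  "dim_row R = mdim Q" "dim_col R = mdim M" "dim_row L = mdim K" "dim_col L = mdim Q"
  "dim_row Y = mdim Q" "dim_col Y = mdim K" "dim_row Z = mdim Q" "dim_col Z = mdim K"
  using carriers d4_hom_dim[OF homs(1)] d4_hom_dim[OF homs(2)] by auto

lemma kernel_eq: "mat_kernel f = mat_image i"
proof (intro equalityI subsetI)
  fix w assume w: "w \<in> mat_kernel f"
  have "w = (R * f + i * L) *\<^sub>v w" using w dims by (simp add: splitting one_mult_vec_dim mat_kernel_iff)
  also have "\<dots> = i *\<^sub>v (L *\<^sub>v w)"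
    using w dims by (auto simp: mat_vec_dim mat_kernel_iff intro!: eq_vecI simp del: index_mult_mat_vec)
  finally show "w \<in> mat_image i"
    using dims by (auto simp: mat_image_iff intro!: exI[of _ "L *\<^sub>v w"])
next
  fix w assume "w \<in> mat_image i"
  then obtain v where v: "dim_vec v = mdim K" "w = i *\<^sub>v v" using dims by (auto simp: mat_image_iff)
  then have "f *\<^sub>v w = (f * i) *\<^sub>v v" using dims by (simp add: mat_vec_dim)
  then show "w \<in> mat_kernel f" using v dims splitting by (simp add: mat_kernel_iff zero_mult_vec_dim)
qed

lemma cover: "projective_cover Q f M"
  unfolding projective_cover_def
proof (intro conjI allI impI)
  show "d4_epi Q M f"
    using homs right_inverse_surj[of R f] dims splitting by (simp add: d4_epi_def)
  fix U assume "d4_submodule Q U \<and> {u + w | u w. u \<in> U \<and> w \<in> mat_kernel f} = carrier_vec (mdim Q)"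
  moreover have "\<exists>y z. dim_vec y = mdim Q \<and> dim_vec z = mdim Q \<and> w = act Q Ga *\<^sub>v y + act Q Gd *\<^sub>v z"
    if w: "w \<in> mat_kernel f" for w
  proof -
    obtain v where v: "dim_vec v = mdim K" "w = i *\<^sub>v v"
      using w dims by (auto simp: mat_image_iff kernel_eq)
    then have "w = act Q Ga *\<^sub>v (Y *\<^sub>v v) + act Q Gd *\<^sub>v (Z *\<^sub>v v)"
      using dims d4_module_dim[OF module_Q] by (simp add: minimal mat_vec_dim)
    then show ?thesis using v dims by (intro exI[of _ "Y *\<^sub>v v"] exI[of _ "Z *\<^sub>v v"]) auto
  qed
  ultimately show "U = carrier_vec (mdim Q)"
    using superfluous_kernel[OF module_Q bc, of f U] by blast
qed (rule modules)

lemma syzygy: "is_syzygy M K"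
proof -
  have "d4_mono K Q i"
    using homs left_inverse_inj[of L i] dims splitting by (simp add: d4_mono_def)
  then show ?thesis
    unfolding is_syzygy_def using modules(2) cover kernel_eq[symmetric] by blast
qed

text \<open>Transposing a split exact sequence gives a split exact sequence in the opposite
  direction.\<close>

lemma dual_kernel_eq: "mat_kernel (transpose_mat i) = mat_image (transpose_mat f)"
proof (intro equalityI subsetI)
  fix w assume w: "w \<in> mat_kernel (transpose_mat i)"
  have "transpose_mat (R * f + i * L) = 1\<^sub>m (mdim Q)" by (simp add: splitting)
  then have s: "transpose_mat f * transpose_mat R + transpose_mat L * transpose_mat i = 1\<^sub>m (mdim Q)"
    using dims by (simp add: transpose_mult_dim transpose_arith_dim)
  have "w = (transpose_mat f * transpose_mat R + transpose_mat L * transpose_mat i) *\<^sub>v w"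
    unfolding s using w dims by (simp add: one_mult_vec_dim mat_kernel_iff)
  also have "\<dots> = transpose_mat f *\<^sub>v (transpose_mat R *\<^sub>v w)"
    using w dims by (auto simp: mat_vec_dim mat_kernel_iff intro!: eq_vecI simp del: index_mult_mat_vec)
  finally show "w \<in> mat_image (transpose_mat f)"
    using dims by (auto simp: mat_image_iff intro!: exI[of _ "transpose_mat R *\<^sub>v w"])
next
  fix w assume "w \<in> mat_image (transpose_mat f)"
  then obtain v where v: "dim_vec v = mdim M" "w = transpose_mat f *\<^sub>v v" using dims by (auto simp: mat_image_iff)
  then have "transpose_mat i *\<^sub>v w = transpose_mat (f * i) *\<^sub>v v"
    using dims by (simp add: mat_vec_dim transpose_mult_dim)
  then show "w \<in> mat_kernel (transpose_mat i)"
    using v dims splitting by (simp add: mat_kernel_iff zero_mult_vec_dim)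
qed

text \<open>The witnesses \<open>Y\<close> and \<open>Z\<close> serve a second time: transposing
  \<open>minimal\<close> shows that the transpose of \<open>i\<close> kills every vector of the dual
  that a and d kill, and its kernel is the image of the transpose of \<open>f\<close>.\<close>

lemma envelope: "injective_envelope (d4_dual Q) (transpose_mat f) (d4_dual M)"
  unfolding injective_envelope_def
proof (intro conjI allI impI)
  show "d4_injective (d4_dual Q)" using modules by (simp add: projective_dual_injective)
  show "d4_mono (d4_dual M) (d4_dual Q) (transpose_mat f)"
    using d4_hom_dual[OF homs(1) module_Q modules(1)] dims splitting
      left_inverse_inj[of "transpose_mat R" "transpose_mat f"]
    by (simp add: d4_mono_def transpose_mult_dim[symmetric])
  fix U assume "d4_submodule (d4_dual Q) U \<and>
    U \<inter> mat_image (transpose_mat f) = {0\<^sub>v (mdim (d4_dual Q))}"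
  moreover have "x \<in> mat_image (transpose_mat f)"
    if "dim_vec x = mdim Q" "transpose_mat (act Q Ga) *\<^sub>v x = 0\<^sub>v (mdim Q)"
      "transpose_mat (act Q Gd) *\<^sub>v x = 0\<^sub>v (mdim Q)" for x
  proof -
    have "transpose_mat i = transpose_mat Y * transpose_mat (act Q Ga) + transpose_mat Z * transpose_mat (act Q Gd)"
      unfolding minimal using dims d4_module_dim[OF module_Q]
      by (simp add: transpose_arith_dim transpose_mult_dim)
    then have "transpose_mat i *\<^sub>v x = 0\<^sub>v (mdim K)"
      using that dims d4_module_dim[OF module_Q] by (simp add: mat_vec_dim)
    then show ?thesis using that dims by (simp add: dual_kernel_eq[symmetric] mat_kernel_iff)
  qed
  ultimately show "U = {0\<^sub>v (mdim (d4_dual Q))}"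
    using essential_image[OF d4_module_dual[OF module_Q], of "mat_image (transpose_mat f)" U] bc by simp
qed

lemma cosyzygy: "is_cosyzygy (d4_dual M) (d4_dual K)"
proof -
  have "d4_epi (d4_dual Q) (d4_dual K) (transpose_mat i)"
    using d4_hom_dual[OF homs(2) modules(2) module_Q] dims splitting
      right_inverse_surj[of "transpose_mat L" "transpose_mat i"]
    by (simp add: d4_epi_def transpose_mult_dim[symmetric])
  then show ?thesis
    unfolding is_cosyzygy_def using d4_module_dual[OF modules(2)] envelope dual_kernel_eq by blast
qed

end

text \<open>The component number 1 is to keep the form in which the rules for
  \<open>unit_vec 4 1\<close> and \<open>xb n k 1\<close> are stated.\<close>

declare One_nat_def [simp del]

subsection \<open>The modules \<open>P(r)\<close>\<close>

definition par :: "bit \<Rightarrow> 'k::field" where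
  "par r = (if r = 0 then 1 else - 1)"

lemma par_square [simp]: "par r * par r = (1 :: 'k::field)" "par r * (par r * x) = (x :: 'k::field)"
  by (auto simp: par_def)

lemma par_add: "par (r + r') = (par r * par r' :: 'k::field)"
  by (cases r; cases r') (auto simp: par_def)

lemma par_succ: "par (r + 1) = (- par r :: 'k::field)"
  by (cases r) (auto simp: par_def)

text \<open>The basis vectors stand for \<open>1, a, d, ad\<close>.\<close>
definition P4 :: "bit \<Rightarrow> 'k::field d4_mod" where
  "P4 r = \<lparr> mdim = 4, act = (\<lambda>g. case g of
      Ga \<Rightarrow> mat 4 4 (\<lambda>(i, j). if i = 1 \<and> j = 0 \<or> i = 3 \<and> j = 2 then 1 else 0)
    | Gd \<Rightarrow> mat 4 4 (\<lambda>(i, j). if i = 2 \<and> j = 0 then 1 else if i = 3 \<and> j = 1 then - 1 else 0)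
    | _ \<Rightarrow> mat 4 4 (\<lambda>(i, j). if i = j then (if i = 0 \<or> i = 3 then par r else - par r) else 0)) \<rparr>"

lemma less_4_cases: "c < (4::nat) \<Longrightarrow> c = 0 \<or> c = 1 \<or> c = 2 \<or> c = 3"
  by linarith

lemma mdim_P4 [simp]: "mdim (P4 r) = 4"
  by (simp add: P4_def)

lemma dim_act_P4 [simp]: "dim_row (act (P4 r) g) = 4" "dim_col (act (P4 r) g) = 4"
  by (cases g; simp add: P4_def)+

lemma act_P4:
  "act (P4 r) Ga *\<^sub>v unit_vec 4 0 = unit_vec 4 1"
  "act (P4 r) Ga *\<^sub>v unit_vec 4 1 = 0\<^sub>v 4"
  "act (P4 r) Ga *\<^sub>v unit_vec 4 2 = unit_vec 4 3"
  "act (P4 r) Ga *\<^sub>v unit_vec 4 3 = 0\<^sub>v 4"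
  "act (P4 r) Gd *\<^sub>v unit_vec 4 0 = unit_vec 4 2"
  "act (P4 r) Gd *\<^sub>v unit_vec 4 1 = - unit_vec 4 3"
  "act (P4 r) Gd *\<^sub>v unit_vec 4 2 = 0\<^sub>v 4"
  "act (P4 r) Gd *\<^sub>v unit_vec 4 3 = 0\<^sub>v 4"
  "act (P4 r) Gb *\<^sub>v unit_vec 4 0 = par r \<cdot>\<^sub>v unit_vec 4 0"
  "act (P4 r) Gb *\<^sub>v unit_vec 4 1 = - par r \<cdot>\<^sub>v unit_vec 4 1"
  "act (P4 r) Gb *\<^sub>v unit_vec 4 2 = - par r \<cdot>\<^sub>v unit_vec 4 2"
  "act (P4 r) Gb *\<^sub>v unit_vec 4 3 = par r \<cdot>\<^sub>v unit_vec 4 3"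
  by (auto intro!: eq_vecI simp: mult_unit_vec_dim P4_def dest!: less_4_cases)

lemma act_P4_bc: "act (P4 r) Gc = act (P4 r) Gb"
  by (simp add: P4_def)

lemma d4_module_P4: "d4_module (P4 r)"
  by (rule d4_moduleI_vec[where v = "unit_vec 4"])
     (auto intro!: eq_vecI simp: act_P4 act_P4_bc mat_vec_dim dest!: less_4_cases)

text \<open>The exterior algebra is a Frobenius algebra: reversing the basis 1, a, d, ad identifies
  it with its dual, with signs that account for da = - ad. The parities of the four basis vectors
  are symmetric under reversal, so \<open>r\<close> stays the same.\<close>

lemma P4_dual: "d4_dual (P4 r) \<cong>\<^sub>D (P4 r :: 'k::field d4_mod)"
proof -
  define J :: "'k mat" where
    "J = mat 4 4 (\<lambda>(i, j). if i + j = 3 then (if j < 2 then 1 else - 1) else 0)"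
  have J: "J * J = - 1\<^sub>m 4"
    by (intro eq_matI)
       (auto simp: J_def scalar_prod_def numeral_eq_Suc less_Suc_eq)
  let ?P = "P4 r :: 'k d4_mod"
  have "d4_hom ?P (d4_dual ?P) J"
    unfolding d4_hom_iff
  proof (intro conjI allI)
    fix g show "J * act ?P g = act (d4_dual ?P) g * J"
      by (cases g; intro eq_matI)
         (auto simp: J_def P4_def scalar_prod_def numeral_eq_Suc less_Suc_eq)
  qed (simp_all add: J_def)
  then have "?P \<cong>\<^sub>D d4_dual ?P"
    by (rule d4_isoI[where G = "- J"])
       (use J in \<open>simp_all add: d4_module_P4 d4_module_dual J_def uminus_mult_dim\<close>)
  then show ?thesis by (rule d4_iso_sym)
qed

text \<open>Component \<open>c\<close> (0, 1, 2, 3 for 1, a, d, ad) of generator number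
  \<open>k\<close>. The index is an integer and yields 0 out of range, so that shifted indices need
  no case distinction.\<close>

definition xb :: "nat \<Rightarrow> int \<Rightarrow> nat \<Rightarrow> 'k::field vec" where
  "xb n k c = (if 0 \<le> k \<and> k < int n then kronv (unit_vec n (nat k)) (unit_vec 4 c) else 0\<^sub>v (n * 4))"

lemma dim_xb [simp]: "dim_vec (xb n k c) = n * 4"
  by (simp add: xb_def)

abbreviation PF :: "nat \<Rightarrow> bit \<Rightarrow> 'k::field d4_mod" where
  "PF n r \<equiv> n \<odot>\<^sub>D P4 r"

lemma PF_simps [simp]: "mdim (PF n r) = n * 4" "dim_row (act (PF n r) g) = n * 4" "dim_col (act (PF n r) g) = n * 4"
  by (simp_all add: d4_copies_simps d4_module_P4)

lemma d4_module_PF: "d4_module (PF n r)"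
  by (simp add: d4_module_copies d4_module_P4)

lemma act_PF_bc: "act (PF n r) Gc = act (PF n r) Gb"
  by (simp add: d4_copies_simps d4_module_P4 act_P4_bc)

lemma act_PF:
  "act (PF n r) Ga *\<^sub>v xb n k 0 = xb n k 1"
  "act (PF n r) Ga *\<^sub>v xb n k 1 = 0\<^sub>v (n * 4)"
  "act (PF n r) Ga *\<^sub>v xb n k 2 = xb n k 3"
  "act (PF n r) Ga *\<^sub>v xb n k 3 = 0\<^sub>v (n * 4)"
  "act (PF n r) Gd *\<^sub>v xb n k 0 = xb n k 2"
  "act (PF n r) Gd *\<^sub>v xb n k 1 = - xb n k 3"
  "act (PF n r) Gd *\<^sub>v xb n k 2 = 0\<^sub>v (n * 4)"
  "act (PF n r) Gd *\<^sub>v xb n k 3 = 0\<^sub>v (n * 4)"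
  "act (PF n r) Gb *\<^sub>v xb n k 0 = par r \<cdot>\<^sub>v xb n k 0"
  "act (PF n r) Gb *\<^sub>v xb n k 1 = - par r \<cdot>\<^sub>v xb n k 1"
  "act (PF n r) Gb *\<^sub>v xb n k 2 = - par r \<cdot>\<^sub>v xb n k 2"
  "act (PF n r) Gb *\<^sub>v xb n k 3 = par r \<cdot>\<^sub>v xb n k 3"
  by (auto simp: xb_def d4_copies_simps d4_module_P4 kron_mult_kronv act_P4 one_mult_vec_dim
      kronv_linear mult_vec_zero_dim intro!: eq_vecI)

lemma mat_eqI_xb:
  fixes A B :: "'k::field mat"
  assumes "dim_row A = dim_row B" "dim_col A = n * 4" "dim_col B = n * 4"
    and "\<And>k. 0 \<le> k \<Longrightarrow> k < int n \<Longrightarrow> A *\<^sub>v xb n k 0 = B *\<^sub>v xb n k 0"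
    and "\<And>k. 0 \<le> k \<Longrightarrow> k < int n \<Longrightarrow> A *\<^sub>v xb n k 1 = B *\<^sub>v xb n k 1"
    and "\<And>k. 0 \<le> k \<Longrightarrow> k < int n \<Longrightarrow> A *\<^sub>v xb n k 2 = B *\<^sub>v xb n k 2"
    and "\<And>k. 0 \<le> k \<Longrightarrow> k < int n \<Longrightarrow> A *\<^sub>v xb n k 3 = B *\<^sub>v xb n k 3"
  shows "A = B"
proof (rule mat_eqI_kronv[OF assms(1-3)])
  fix p q assume pq: "p < n" "q < (4::nat)"
  then have "kronv (unit_vec n p) (unit_vec 4 q) = (xb n (int p) q :: 'k vec)" by (simp add: xb_def)
  then show "A *\<^sub>v kronv (unit_vec n p) (unit_vec 4 q) = B *\<^sub>v kronv (unit_vec n p) (unit_vec 4 q)"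
    using assms(4-)[of "int p"] pq less_4_cases[of q] by auto
qed

section \<open>Homomorphisms out of multiples of P(r)\<close>

definition PF_map :: "nat \<Rightarrow> nat \<Rightarrow> (int \<Rightarrow> nat \<Rightarrow> 'k::field vec) \<Rightarrow> 'k mat" where
  "PF_map m n \<phi> = colmat m (n * 4) (\<lambda>q. \<phi> (int (q div 4)) (q mod 4))"

lemma dim_PF_map [simp]: "dim_row (PF_map m n \<phi>) = m" "dim_col (PF_map m n \<phi>) = n * 4"
  by (simp_all add: PF_map_def)

lemma PF_map_xb:
  assumes "c < 4" "\<And>k c. dim_vec (\<phi> k c) = m"
  shows "PF_map m n \<phi> *\<^sub>v xb n k c = (if 0 \<le> k \<and> k < int n then \<phi> k c else 0\<^sub>v m)"
proof (cases "0 \<le> k \<and> k < int n")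
  case True
  define q where "q = nat k * 4 + c"
  have q: "q div 4 = nat k" "q mod 4 = c" using assms(1) by (simp_all add: q_def)
  have "nat k < n" using True by linarith
  then have "q < n * 4" using assms(1) by (simp add: q_def)
  then have "xb n k c = (unit_vec (n * 4) q :: 'a vec)"
    using True by (simp add: xb_def unit_vec_kronv q)
  then show ?thesis using True q \<open>q < n * 4\<close> assms(2) by (simp add: PF_map_def colmat_unit_vec)
next
  case False
  then have "xb n k c = (0\<^sub>v (n * 4) :: 'a vec)" unfolding xb_def by (rule if_not_P)
  then show ?thesis unfolding if_not_P[OF False] by (simp add: mult_vec_zero_dim)
qed

text \<open>The candidate for the homomorphism that sends generator number k to \<open>v k\<close>;
  the values on the other components are forced.\<close>

definition PF_hom :: "nat \<Rightarrow> 'k::field d4_mod \<Rightarrow> (int \<Rightarrow> 'k vec) \<Rightarrow> 'k mat" where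
  "PF_hom n M v = PF_map (mdim M) n (\<lambda>k c.
     if c = 0 then v k else if c = 1 then act M Ga *\<^sub>v v k else if c = 2 then act M Gd *\<^sub>v v k
     else act M Ga *\<^sub>v (act M Gd *\<^sub>v v k))"

lemma dim_PF_hom [simp]: "dim_row (PF_hom n M v) = mdim M" "dim_col (PF_hom n M v) = n * 4"
  by (simp_all add: PF_hom_def)

lemma PF_hom_xb:
  assumes "d4_module M" "\<And>k. dim_vec (v k) = mdim M" "0 \<le> k" "k < int n"
  shows "PF_hom n M v *\<^sub>v xb n k 0 = v k"
    "PF_hom n M v *\<^sub>v xb n k 1 = act M Ga *\<^sub>v v k"
    "PF_hom n M v *\<^sub>v xb n k 2 = act M Gd *\<^sub>v v k"
    "PF_hom n M v *\<^sub>v xb n k 3 = act M Ga *\<^sub>v (act M Gd *\<^sub>v v k)"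
  using assms unfolding PF_hom_def by (simp_all add: PF_map_xb d4_module_dim)

text \<open>P(r) is universal for vectors on which b and c both act by the sign of r: there 1 - bc
  vanishes, so d a v = - a d v, which matches the entry -1 of \<open>P4\<close>.\<close>

lemma PF_hom_hom:
  assumes M: "d4_module M" and v: "\<And>k. dim_vec (v k) = mdim M"
    and b: "\<And>k. 0 \<le> k \<Longrightarrow> k < int n \<Longrightarrow> act M Gb *\<^sub>v v k = par r \<cdot>\<^sub>v v k"
    and c: "\<And>k. 0 \<le> k \<Longrightarrow> k < int n \<Longrightarrow> act M Gc *\<^sub>v v k = par r \<cdot>\<^sub>v v k"
  shows "d4_hom (PF n r) M (PF_hom n M v)"
  unfolding d4_hom_iff
proof (intro conjI allI)
  fix g
  have s: "par r \<cdot>\<^sub>v (par r \<cdot>\<^sub>v x) = x" for x :: "'a vec" by (intro eq_vecI) auto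
  have n1: "- (par r \<cdot>\<^sub>v x) = - par r \<cdot>\<^sub>v x" for x :: "'a vec"
    by (intro eq_vecI) auto
  have n3: "- (- par r \<cdot>\<^sub>v x) = par r \<cdot>\<^sub>v x" for x :: "'a vec"
    by (intro eq_vecI) auto
  have n4: "- par r \<cdot>\<^sub>v (- par r \<cdot>\<^sub>v x) = x" for x :: "'a vec"
    by (intro eq_vecI) auto
  have n5: "x - x = 0\<^sub>v m" if "dim_vec x = m" for x :: "'a vec" and m
    using that by (intro eq_vecI) auto
  have n2: "x - x - y = - y" if "dim_vec x = dim_vec y" for x y :: "'a vec"
    using that by (intro eq_vecI) auto
  have z: "- (0\<^sub>v m) = (0\<^sub>v m :: 'a vec)" "c \<cdot>\<^sub>v 0\<^sub>v m = (0\<^sub>v m :: 'a vec)" for m c by (intro eq_vecI; simp)+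
  show "PF_hom n M v * act (PF n r) g = act M g * PF_hom n M v"
    by (rule mat_eqI_xb[where n = n]; cases g)
       (use M v in \<open>simp_all add: mat_vec_dim d4_module_dim act_PF act_PF_bc PF_hom_xb d4_module_vec b c s n1 n2 n3 n4 n5 z\<close>)
qed simp_all

section \<open>Projectivity in characteristic different from 2\<close>

lemma two_neq_zero:
  assumes "CHAR('k::field) \<noteq> 2"
  shows "(2 :: 'k) \<noteq> 0"
proof
  assume "(2 :: 'k) = 0"
  then have "CHAR('k) dvd 2" using of_nat_eq_0_iff_char_dvd[where 'a = 'k, of 2] by simp
  then have "CHAR('k) = 1 \<or> CHAR('k) = 2" using two_is_prime_nat prime_nat_iff by blast
  then show False using assms by (auto simp: One_nat_def)
qed

lemma four_neq_zero:
  assumes "CHAR('k::field) \<noteq> 2"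
  shows "(4 :: 'k) \<noteq> 0"
proof -
  have "(4 :: 'k) = 2 * 2" by simp
  then show ?thesis using two_neq_zero[OF assms] by (metis mult_eq_0_iff)
qed

text \<open>Arbitrary lifts \<open>m0 k\<close> of the images of the generators need not be
  eigenvectors of b and c. They are projected by the idempotent (1 + x b)(1 + x c) / 4 with x =
  \<open>par r\<close>; it fixes the images of the generators in \<open>N\<close>, so the projected
  vectors are still lifts.\<close>

lemma PF_projective:
  assumes char: "CHAR('k::field) \<noteq> 2"
  shows "d4_projective (PF n r :: 'k d4_mod)"
  unfolding d4_projective_def
proof (intro conjI allI impI, goal_cases)
  case 1
  show ?case by (rule d4_module_PF)
next
  case (2 M N f h)
  then have m: "d4_module M" "d4_module N" and f: "d4_hom M N f" "mat_image f = carrier_vec (dim_row f)"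
    and h: "d4_hom (PF n r) N h" by (auto simp: d4_epi_def d4_hom_iff)
  note d = d4_module_dim[OF m(1)] d4_module_dim[OF m(2)] d4_hom_dim[OF f(1)] d4_hom_dim[OF h]
  obtain R where R: "R \<in> carrier_mat (dim_col f) (dim_row f)" "f * R = 1\<^sub>m (dim_row f)"
    using surj_right_inverse[OF f(2)] .
  define m0 where "m0 k = R *\<^sub>v (h *\<^sub>v xb n k 0)" for k
  let ?b = "act M Gb" and ?c = "act M Gc"
  define v where "v k = (1 / (2 * 2)) \<cdot>\<^sub>v
     (m0 k + par r \<cdot>\<^sub>v (?b *\<^sub>v m0 k) + par r \<cdot>\<^sub>v (?c *\<^sub>v m0 k) + ?c *\<^sub>v (?b *\<^sub>v m0 k))" for k
  have dm0: "dim_vec (m0 k) = mdim M" for k using R d by (simp add: m0_def)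
  have dv: "dim_vec (v k) = mdim M" for k using d by (simp add: v_def)
  have fm0: "f *\<^sub>v m0 k = h *\<^sub>v xb n k 0" for k
    using R d mult_vec_assoc_dim[of f R "h *\<^sub>v xb n k 0"] by (simp add: m0_def one_mult_vec_dim)
  have hb: "act N g *\<^sub>v (h *\<^sub>v xb n k c) = h *\<^sub>v (act (PF n r) g *\<^sub>v xb n k c)" for g k c
    using d4_hom_vec[OF h d4_module_PF m(2)] by simp
  note four = four_neq_zero[OF char]
  have b: "?b *\<^sub>v v k = par r \<cdot>\<^sub>v v k" for k
    unfolding v_def using dm0 d m(1)
    by (auto simp: mat_vec_dim d4_module_vec algebra_simps intro!: eq_vecI simp del: index_mult_mat_vec)
  have c: "?c *\<^sub>v v k = par r \<cdot>\<^sub>v v k" for k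
    unfolding v_def using dm0 d m(1)
    by (auto simp: mat_vec_dim d4_module_vec algebra_simps intro!: eq_vecI simp del: index_mult_mat_vec)
  have fg: "f *\<^sub>v (act M g *\<^sub>v x) = act N g *\<^sub>v (f *\<^sub>v x)" if "dim_vec x = mdim M" for g x
    using d4_hom_vec[OF f(1) m that] .
  have fv: "f *\<^sub>v v k = h *\<^sub>v xb n k 0" for k
  proof -
    have "f *\<^sub>v v k = (1 / 4) \<cdot>\<^sub>v (h *\<^sub>v xb n k 0 + h *\<^sub>v xb n k 0 + h *\<^sub>v xb n k 0 + h *\<^sub>v xb n k 0)"
      unfolding v_def using dm0 d
      by (auto simp: mat_vec_dim fg fm0 hb act_PF act_PF_bc intro!: eq_vecI simp del: index_mult_mat_vec)
    also have "\<dots> = h *\<^sub>v xb n k 0"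
      using four by (intro eq_vecI) (auto simp: field_simps simp del: index_mult_mat_vec)
    finally show ?thesis .
  qed
  have "d4_hom (PF n r) M (PF_hom n M v)"
    by (rule PF_hom_hom[OF m(1) dv]) (use b c in auto)
  moreover have "f * PF_hom n M v = h"
    by (rule mat_eqI_xb[where n = n])
       (use d dv m in \<open>simp_all add: mat_vec_dim PF_hom_xb fg fv hb act_PF\<close>)
  ultimately show ?case by blast
qed


subsection \<open>Models of the syzygies\<close>

text \<open>
  \<open>Kt s i\<close> for \<open>0 \<le> i \<le> s\<close> and \<open>Kb s i\<close> for \<open>0 \<le> i < s\<close> are bases of the top and of the socle of
  \<open>Km s \<rho>\<close>.  Indices out of range give \<open>0\<close>, so that most formulas hold for all integers.
\<close>

definition Kt :: "nat \<Rightarrow> int \<Rightarrow> 'k::field vec" where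
  "Kt s i = (if 0 \<le> i \<and> i \<le> int s then unit_vec (2 * s + 1) (nat i) else 0\<^sub>v (2 * s + 1))"

definition Kb :: "nat \<Rightarrow> int \<Rightarrow> 'k::field vec" where
  "Kb s i = (if 0 \<le> i \<and> i < int s then unit_vec (2 * s + 1) (s + 1 + nat i) else 0\<^sub>v (2 * s + 1))"

lemma dim_Kt [simp]: "dim_vec (Kt s i) = 2 * s + 1" and dim_Kb [simp]: "dim_vec (Kb s i) = 2 * s + 1"
  by (simp_all add: Kt_def Kb_def)

definition K_map :: "nat \<Rightarrow> nat \<Rightarrow> (int \<Rightarrow> 'k::field vec) \<Rightarrow> (int \<Rightarrow> 'k vec) \<Rightarrow> 'k mat" where
  "K_map m s \<phi> \<psi> = colmat m (2 * s + 1) (\<lambda>q. if q \<le> s then \<phi> (int q) else \<psi> (int q - int s - 1))"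

lemma dim_K_map [simp]: "dim_row (K_map m s \<phi> \<psi>) = m" "dim_col (K_map m s \<phi> \<psi>) = 2 * s + 1"
  by (simp_all add: K_map_def)

lemma K_map_Kt:
  assumes "\<And>i. dim_vec (\<phi> i) = m"
  shows "K_map m s \<phi> \<psi> *\<^sub>v Kt s i = (if 0 \<le> i \<and> i \<le> int s then \<phi> i else 0\<^sub>v m)"
  using assms by (auto simp: Kt_def K_map_def colmat_unit_vec mult_vec_zero_dim nat_le_iff)

lemma K_map_Kb:
  assumes "\<And>i. dim_vec (\<psi> i) = m"
  shows "K_map m s \<phi> \<psi> *\<^sub>v Kb s i = (if 0 \<le> i \<and> i < int s then \<psi> i else 0\<^sub>v m)"
  using assms by (auto simp: Kb_def K_map_def colmat_unit_vec mult_vec_zero_dim)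

lemma unit_vec_K_cases:
  assumes "q < 2 * s + 1"
  obtains i where "0 \<le> i" "i \<le> int s" "unit_vec (2 * s + 1) q = (Kt s i :: 'k::field vec)"
  | i where "0 \<le> i" "i < int s" "unit_vec (2 * s + 1) q = (Kb s i :: 'k vec)"
proof (cases "q \<le> s")
  case True
  then show ?thesis using that(1)[of "int q"] by (simp add: Kt_def)
next
  case False
  then show ?thesis using that(2)[of "int q - int s - 1"] assms
    by (simp add: Kb_def nat_diff_distrib of_nat_diff)
qed

lemma mat_eqI_K:
  fixes A B :: "'k::field mat"
  assumes "dim_row A = dim_row B" "dim_col A = 2 * s + 1" "dim_col B = 2 * s + 1"
    and "\<And>i. 0 \<le> i \<Longrightarrow> i \<le> int s \<Longrightarrow> A *\<^sub>v Kt s i = B *\<^sub>v Kt s i"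
    and "\<And>i. 0 \<le> i \<Longrightarrow> i < int s \<Longrightarrow> A *\<^sub>v Kb s i = B *\<^sub>v Kb s i"
  shows "A = B"
proof (rule mat_eqI_unit_vec[OF assms(1-3)])
  fix q assume "q < 2 * s + 1"
  then show "A *\<^sub>v unit_vec (2 * s + 1) q = B *\<^sub>v unit_vec (2 * s + 1) q"
    using assms(4,5) by (cases rule: unit_vec_K_cases[where 'k = 'k]) auto
qed

text \<open>\<open>\<rho>\<close> is the parity of the top; the socle has the opposite one. Each
  passage to the kernel of a cover changes the parity of the top, so the model of \<Omega>^s V(r) is
  \<open>Km s (r + of_nat s)\<close>.\<close>

definition Km :: "nat \<Rightarrow> bit \<Rightarrow> 'k::field d4_mod" where
  "Km s \<rho> = \<lparr> mdim = 2 * s + 1, act = (\<lambda>g. case g of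
      Ga \<Rightarrow> K_map (2 * s + 1) s (Kb s) (\<lambda>i. 0\<^sub>v (2 * s + 1))
    | Gd \<Rightarrow> K_map (2 * s + 1) s (\<lambda>i. Kb s (i - 1)) (\<lambda>i. 0\<^sub>v (2 * s + 1))
    | _ \<Rightarrow> K_map (2 * s + 1) s (\<lambda>i. par \<rho> \<cdot>\<^sub>v Kt s i) (\<lambda>i. - par \<rho> \<cdot>\<^sub>v Kb s i)) \<rparr>"

lemma Km_dims [simp]:
  "mdim (Km s \<rho>) = 2 * s + 1" "dim_row (act (Km s \<rho>) g) = 2 * s + 1" "dim_col (act (Km s \<rho>) g) = 2 * s + 1"
  by (cases g; simp add: Km_def)+

lemma act_Km_bc: "act (Km s \<rho>) Gc = act (Km s \<rho>) Gb"
  by (simp add: Km_def)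

lemma act_Km:
  "act (Km s \<rho>) Ga *\<^sub>v Kt s i = Kb s i"
  "act (Km s \<rho>) Ga *\<^sub>v Kb s i = 0\<^sub>v (2 * s + 1)"
  "act (Km s \<rho>) Gd *\<^sub>v Kt s i = Kb s (i - 1)"
  "act (Km s \<rho>) Gd *\<^sub>v Kb s i = 0\<^sub>v (2 * s + 1)"
  "act (Km s \<rho>) Gb *\<^sub>v Kt s i = par \<rho> \<cdot>\<^sub>v Kt s i"
  "act (Km s \<rho>) Gb *\<^sub>v Kb s i = - par \<rho> \<cdot>\<^sub>v Kb s i"
  by (auto simp: Km_def K_map_Kt K_map_Kb) (auto simp: Kt_def Kb_def intro!: eq_vecI)

lemma d4_module_Km: "d4_module (Km s \<rho>)"
proof (rule d4_moduleI_vec[where v = "unit_vec (2 * s + 1)"], goal_cases)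
  case (1 g) then show ?case by simp
next
  case (2 g) then show ?case by simp
next
  case (3 k) then show ?case by simp
qed ((erule unit_vec_K_cases[where 'k = 'a, OF order.strict_trans2[OF _ eq_refl[OF Km_dims(1)]]];
      auto intro!: eq_vecI simp: act_Km act_Km_bc mat_vec_dim simp del: index_mult_mat_vec)+)

text \<open>
  In a projective cover with generators \<open>x\<^sub>k \<mapsto> Kt s k\<close> the kernel is generated by the elements
  \<open>a x\<^bsub>k-1\<^esub> - d x\<^sub>k\<close>.
\<close>
lemma Km_presentation:
  fixes \<rho> :: bit
  assumes char: "CHAR('k::field) \<noteq> 2"
  obtains f i R L Y Z where
    "minimal_presentation (Km s \<rho> :: 'k d4_mod) (Km (s + 1) (\<rho> + 1)) (PF (s + 1) \<rho>) f i R L Y Z"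
proof -
  define n where "n = s + 1"
  define \<rho>' where "\<rho>' = \<rho> + 1"
  have n: "int n = int s + 1" by (simp add: n_def)
  define f :: "'k mat" where "f = PF_hom n (Km s \<rho>) (Kt s)"
  \<comment> \<open>The value on \<open>Kb n j\<close> is forced, since a (a x_(j-1) - d x_j) = - a
    d x_j.\<close>
  define i :: "'k mat" where "i = K_map (n * 4) n (\<lambda>j. xb n (j - 1) 1 - xb n j 2) (\<lambda>j. - xb n j 3)"
  \<comment> \<open>Of the two preimages a x_j and d x_(j+1) of \<open>Kb s j\<close>, the first is
    selected.\<close>
  define R :: "'k mat" where "R = K_map (n * 4) s (\<lambda>j. xb n j 0) (\<lambda>j. xb n j 1)"
  \<comment> \<open>Determined by i L = 1 - R f. On a x_k the right side vanishes except for k = s,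
    where f (a x_s) = 0; there a x_s is the image of \<open>Kt n (s + 1)\<close> under
    \<open>i\<close>, because x_(s+1) = 0.\<close>
  define L :: "'k mat" where "L = PF_map (2 * n + 1) n (\<lambda>k c.
       if c = 1 then if k = int s then Kt n (k + 1) else 0\<^sub>v (2 * n + 1)
       else if c = 2 then - Kt n k else if c = 3 then - Kb n k else 0\<^sub>v (2 * n + 1))"
  \<comment> \<open>These split a x_(j-1) - d x_j and - a d x_j = a (- d x_j) into a part from aQ
    and a part from dQ.\<close>
  define Y :: "'k mat" where "Y = K_map (n * 4) n (\<lambda>j. xb n (j - 1) 0) (\<lambda>j. - xb n j 2)"
  define Z :: "'k mat" where "Z = K_map (n * 4) n (\<lambda>j. - xb n j 0) (\<lambda>j. 0\<^sub>v (n * 4))"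
  have neg0: "- 0\<^sub>v m = (0\<^sub>v m :: 'k vec)" for m by (intro eq_vecI) auto
  have xb0: "xb n k c = 0\<^sub>v (n * 4)" if "\<not> (0 \<le> k \<and> k \<le> int s)" for k c
    unfolding xb_def n using that by auto
  have Kt0: "Kt s k = 0\<^sub>v (2 * s + 1)" if "\<not> (0 \<le> k \<and> k \<le> int s)" for k
    unfolding Kt_def using that by auto
  have Kb0: "Kb s k = 0\<^sub>v (2 * s + 1)" if "\<not> (0 \<le> k \<and> k < int s)" for k
    unfolding Kb_def using that by auto
  have [simp]: "dim_row f = 2 * s + 1" "dim_col f = n * 4" "dim_row i = n * 4" "dim_col i = 2 * n + 1"
    "dim_row R = n * 4" "dim_col R = 2 * s + 1" "dim_row L = 2 * n + 1" "dim_col L = n * 4"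
    "dim_row Y = n * 4" "dim_col Y = 2 * n + 1" "dim_row Z = n * 4" "dim_col Z = 2 * n + 1"
    by (simp_all add: f_def i_def R_def L_def Y_def Z_def)
  have f: "f *\<^sub>v xb n k 0 = Kt s k" "f *\<^sub>v xb n k 1 = Kb s k" "f *\<^sub>v xb n k 2 = Kb s (k - 1)"
    "f *\<^sub>v xb n k 3 = 0\<^sub>v (2 * s + 1)" for k
  proof -
    have "f *\<^sub>v xb n k 0 = Kt s k \<and> f *\<^sub>v xb n k 1 = Kb s k \<and> f *\<^sub>v xb n k 2 = Kb s (k - 1) \<and>
      f *\<^sub>v xb n k 3 = 0\<^sub>v (2 * s + 1)"
    proof (cases "0 \<le> k \<and> k \<le> int s")
      case True
      then show ?thesis unfolding f_def
        by (simp add: PF_hom_xb[OF d4_module_Km] act_Km n)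
    next
      case False
      then show ?thesis by (auto simp: xb0 Kt0 Kb0 mult_vec_zero_dim)
    qed
    then show "f *\<^sub>v xb n k 0 = Kt s k" "f *\<^sub>v xb n k 1 = Kb s k" "f *\<^sub>v xb n k 2 = Kb s (k - 1)"
      "f *\<^sub>v xb n k 3 = 0\<^sub>v (2 * s + 1)" by auto
  qed
  have i: "i *\<^sub>v Kt n j = xb n (j - 1) 1 - xb n j 2" "i *\<^sub>v Kb n j = - xb n j 3" for j
    unfolding i_def by (auto simp: K_map_Kt K_map_Kb xb0 neg0 n)
  have R: "R *\<^sub>v Kt s j = xb n j 0" "R *\<^sub>v Kb s j = (if j < int s then xb n j 1 else 0\<^sub>v (n * 4))" for j
    unfolding R_def by (auto simp: K_map_Kt K_map_Kb xb0)
  have Y: "Y *\<^sub>v Kt n j = xb n (j - 1) 0" "Y *\<^sub>v Kb n j = - xb n j 2" for j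
    unfolding Y_def by (auto simp: K_map_Kt K_map_Kb xb0 neg0 n)
  have Z: "Z *\<^sub>v Kt n j = - xb n j 0" "Z *\<^sub>v Kb n j = 0\<^sub>v (n * 4)" for j
    unfolding Z_def by (auto simp: K_map_Kt K_map_Kb xb0 neg0 n)
  have L: "L *\<^sub>v xb n k 0 = 0\<^sub>v (2 * n + 1)"
    "L *\<^sub>v xb n k 1 = (if k = int s then Kt n (k + 1) else 0\<^sub>v (2 * n + 1))"
    "L *\<^sub>v xb n k 2 = (if 0 \<le> k \<and> k \<le> int s then - Kt n k else 0\<^sub>v (2 * n + 1))"
    "L *\<^sub>v xb n k 3 = - Kb n k" for k
    unfolding L_def by (auto simp: PF_map_xb Kb_def neg0 n)
  have par: "par \<rho>' = (- par \<rho> :: 'k)"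
    unfolding \<rho>'_def by (rule par_succ)
  note simps = mat_vec_dim f i R Y Z L act_Km act_PF act_Km_bc act_PF_bc par
  have "minimal_presentation (Km s \<rho> :: 'k d4_mod) (Km (s + 1) (\<rho> + 1)) (PF (s + 1) \<rho>) f i R L Y Z"
    unfolding n_def[symmetric] \<rho>'_def[symmetric]
  proof (unfold_locales, goal_cases)
    case 3 show ?case by (rule PF_projective[OF char])
  next
    case 5 show ?case unfolding f_def
      by (rule PF_hom_hom) (auto simp: d4_module_Km act_Km act_Km_bc)
  next
    case 6 show ?case
      unfolding d4_hom_iff
    proof (intro conjI allI)
      fix g show "i * act (Km n \<rho>') g = act (PF n \<rho>) g * i"
        by (rule mat_eqI_K[where s = n]; cases g)
           (auto simp: simps algebra_simps intro!: eq_vecI simp del: index_mult_mat_vec)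
    qed simp_all
  next
    case 11 show ?case
      by (rule mat_eqI_K[where s = s]) (auto simp: simps)
  next
    case 12 show ?case
      by (rule mat_eqI_K[where s = n])
         (auto simp: simps n intro!: eq_vecI simp del: index_mult_mat_vec)
  next
    case 13 show ?case
      by (rule mat_eqI_K[where s = n]) (auto simp: simps intro!: eq_vecI simp del: index_mult_mat_vec)
  next
    case 14 show ?case
      by (rule mat_eqI_xb[where n = n])
         (auto simp: simps xb0 n intro!: eq_vecI simp del: index_mult_mat_vec)
  next
    case 15 show ?case
      by (rule mat_eqI_K[where s = n])
         (auto simp: simps intro!: eq_vecI simp del: index_mult_mat_vec)
  qed (simp_all add: d4_module_Km act_PF_bc)
  then show ?thesis by (rule that)
qed

lemma Km_zero: "Km 0 r = (V r :: 'k::field d4_mod)"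
proof -
  have "act (Km 0 r) g = act (V r :: 'k d4_mod) g" for g
    by (cases g; intro eq_matI)
       (auto simp: Km_def V_def Let_def K_map_def colmat_def Kt_def Kb_def par_def)
  moreover have "mdim (Km 0 r) = mdim (V r :: 'k d4_mod)" by (simp add: V_def Let_def)
  ultimately show ?thesis by (intro d4_mod.equality ext) auto
qed

subsection \<open>Identification of \<open>\<Omega>\<^sup>n V(r)\<close> and \<open>P(r)\<close>\<close>

text \<open>The chosen module is a syzygy because one exists, and uniqueness identifies it with the
  known one.\<close>

lemma syzygy_iso:
  fixes M :: "'k::field d4_mod"
  assumes "is_syzygy N K" "M \<cong>\<^sub>D N" "d4_module M" "d4_module N"
  shows "d4_module (syzygy M) \<and> syzygy M \<cong>\<^sub>D K"
proof -
  have "is_syzygy M K"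
    using is_syzygy_iso[OF assms(1) d4_iso_sym[OF assms(2)] assms(4,3)] .
  then have "is_syzygy M (syzygy M)" unfolding syzygy_def by (rule someI)
  then show ?thesis
    using syzygy_unique[OF _ \<open>is_syzygy M K\<close> assms(3)] by (auto simp: is_syzygy_def)
qed

lemma cosyzygy_iso:
  fixes M :: "'k::field d4_mod"
  assumes "is_cosyzygy N K" "M \<cong>\<^sub>D N" "d4_module M" "d4_module N"
  shows "d4_module (cosyzygy M) \<and> cosyzygy M \<cong>\<^sub>D K"
proof -
  have "is_cosyzygy M K"
    using is_cosyzygy_iso[OF assms(1) d4_iso_sym[OF assms(2)] assms(4,3)] .
  then have "is_cosyzygy M (cosyzygy M)" unfolding cosyzygy_def by (rule someI)
  then show ?thesis
    using cosyzygy_unique[OF _ \<open>is_cosyzygy M K\<close> assms(3)] by (auto simp: is_cosyzygy_def)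
qed

lemma Km_syzygy:
  assumes "CHAR('k::field) \<noteq> 2"
  shows "is_syzygy (Km s \<rho> :: 'k d4_mod) (Km (s + 1) (\<rho> + 1))"
    "is_cosyzygy (d4_dual (Km s \<rho> :: 'k d4_mod)) (d4_dual (Km (s + 1) (\<rho> + 1)))"
    "\<exists>f. projective_cover (PF (s + 1) \<rho>) f (Km s \<rho> :: 'k d4_mod)"
proof -
  obtain f i R L Y Z where
    "minimal_presentation (Km s \<rho> :: 'k d4_mod) (Km (s + 1) (\<rho> + 1)) (PF (s + 1) \<rho>) f i R L Y Z"
    using Km_presentation[OF assms] .
  then interpret minimal_presentation
    "Km s \<rho> :: 'k d4_mod" "Km (s + 1) (\<rho> + 1)" "PF (s + 1) \<rho>" f i R L Y Z .
  show "is_syzygy (Km s \<rho> :: 'k d4_mod) (Km (s + 1) (\<rho> + 1))" by (rule syzygy)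
  show "is_cosyzygy (d4_dual (Km s \<rho> :: 'k d4_mod)) (d4_dual (Km (s + 1) (\<rho> + 1)))" by (rule cosyzygy)
  show "\<exists>f. projective_cover (PF (s + 1) \<rho>) f (Km s \<rho> :: 'k d4_mod)" using cover by blast
qed

lemma Omega_nonneg:
  fixes r :: bit
  assumes "CHAR('k::field) \<noteq> 2"
  shows "d4_module (Omega (int s) (V r :: 'k d4_mod)) \<and> Omega (int s) (V r :: 'k d4_mod) \<cong>\<^sub>D Km s (r + of_nat s)"
proof (induction s)
  case 0
  have "r + of_nat 0 = r" by (simp only: of_nat_0 add_0_right)
  moreover have "d4_module (V r :: 'k d4_mod)" using d4_module_Km[of 0 r] by (simp add: Km_zero)
  ultimately show ?case
    using d4_iso_refl[of "V r :: 'k d4_mod"] by (simp add: Omega_def Km_zero del: of_nat_0)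
next
  case (Suc s)
  have e: "r + of_nat (s + 1) = r + of_nat s + 1" by (simp only: of_nat_add of_nat_1 add.assoc)
  have "Omega (int (Suc s)) (V r :: 'k d4_mod) = syzygy (Omega (int s) (V r))"
    by (simp add: Omega_def nat_add_distrib)
  moreover have "is_syzygy (Km s (r + of_nat s) :: 'k d4_mod) (Km (Suc s) (r + of_nat (Suc s)))"
    using Km_syzygy(1)[OF assms, of s "r + of_nat s"] unfolding Suc_eq_plus1 e .
  ultimately show ?case
    using syzygy_iso Suc d4_module_Km by metis
qed

lemma dual_Km_zero: "d4_dual (Km 0 r) = (V r :: 'k::field d4_mod)"
proof -
  have "transpose_mat (act (V r :: 'k d4_mod) g) = act (V r) g" for g
    by (cases g; intro eq_matI) (auto simp: V_def Let_def)
  then show ?thesis unfolding Km_zero by (intro d4_mod.equality ext) auto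
qed

lemma Omega_nonpos:
  fixes r :: bit
  assumes "CHAR('k::field) \<noteq> 2"
  shows "d4_module (Omega (- int s) (V r :: 'k d4_mod)) \<and>
    Omega (- int s) (V r :: 'k d4_mod) \<cong>\<^sub>D d4_dual (Km s (r + of_nat s))"
proof (induction s)
  case 0
  have "r + of_nat 0 = r" by (simp only: of_nat_0 add_0_right)
  moreover have "d4_module (V r :: 'k d4_mod)" using d4_module_Km[of 0 r] by (simp add: Km_zero)
  ultimately show ?case
    using d4_iso_refl[of "V r :: 'k d4_mod"] by (simp add: Omega_def dual_Km_zero del: of_nat_0)
next
  case (Suc s)
  have e: "r + of_nat (s + 1) = r + of_nat s + 1" by (simp only: of_nat_add of_nat_1 add.assoc)
  have "Omega (- int (Suc s)) (V r :: 'k d4_mod) = cosyzygy (Omega (- int s) (V r))"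
    by (cases s) (simp_all add: Omega_def nat_add_distrib)
  moreover have "is_cosyzygy (d4_dual (Km s (r + of_nat s) :: 'k d4_mod))
      (d4_dual (Km (Suc s) (r + of_nat (Suc s))))"
    using Km_syzygy(2)[OF assms, of s "r + of_nat s"] unfolding Suc_eq_plus1 e .
  ultimately show ?case
    using cosyzygy_iso Suc d4_module_Km d4_module_dual by metis
qed

text \<open>The cover of V(r) is read off from the presentation of \<open>Km 0 r\<close>, which has
  the single generator x_0.\<close>

lemma P_iso:
  fixes r :: bit
  assumes "CHAR('k::field) \<noteq> 2"
  shows "d4_module (P r :: 'k d4_mod) \<and> (P r :: 'k d4_mod) \<cong>\<^sub>D P4 r"
proof -
  have "PF 1 r = (P4 r :: 'k d4_mod)"
  proof -
    have "kron (1\<^sub>m 1) (act (P4 r :: 'k d4_mod) g) = act (P4 r) g" for g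
      by (intro eq_matI) auto
    then show ?thesis
      by (intro d4_mod.equality ext) (auto simp: d4_copies_simps d4_module_P4)
  qed
  then obtain f where f: "projective_cover (P4 r) f (V r :: 'k d4_mod)"
    using Km_syzygy(3)[OF assms, of 0 r] by (auto simp: Km_zero)
  then have "\<exists>f. projective_cover (P r) f (V r :: 'k d4_mod)"
    unfolding P_def by (rule_tac someI[of "\<lambda>Q. \<exists>f. projective_cover Q f (V r)"]) blast
  then obtain f' where f': "projective_cover (P r) f' (V r :: 'k d4_mod)" by blast
  have "d4_module (V r :: 'k d4_mod)" using d4_module_Km[of 0 r] by (simp add: Km_zero)
  from projective_cover_unique[OF f' f this] show ?thesis
    using f' unfolding d4_iso_def projective_cover_def d4_projective_def by metis
qed


subsection \<open>Symmetry of the tensor product\<close>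

definition flip :: "nat \<Rightarrow> nat \<Rightarrow> 'k::field mat" where
  "flip m n = mat (n * m) (m * n) (\<lambda>(p, q). if p div m = q mod n \<and> p mod m = q div n then 1 else 0)"

lemma dim_flip [simp]: "dim_row (flip m n) = n * m" "dim_col (flip m n) = m * n"
  by (simp_all add: flip_def)

lemma flip_kronv:
  assumes "dim_vec v = m" "dim_vec w = n"
  shows "flip m n *\<^sub>v kronv v w = kronv w v"
proof (rule eq_vecI)
  fix p assume "p < dim_vec (kronv w v)"
  then have p: "p < n * m" using assms by simp
  \<comment> \<open>The only column with a nonzero entry in row \<open>p\<close>.\<close>
  define q where "q = (p mod m) * n + p div m"
  have d: "p div m < n" "p mod m < m" using div_mod_less[OF p] by auto
  have q: "q div n = p mod m" "q mod n = p div m" using d(1) by (simp_all add: q_def)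
  have "p mod m * n + p div m < (p mod m + 1) * n" using d(1) by (simp add: algebra_simps)
  also have "\<dots> \<le> m * n" using d by (intro mult_right_mono) auto
  finally have qm: "q < m * n" by (simp add: q_def)
  have "q' = q" if "p div m = q' mod n \<and> p mod m = q' div n" for q'
    using that by (simp add: q_def)
  then have eq: "(p div m = q' mod n \<and> p mod m = q' div n) = (q' = q)" for q' using q by auto
  have "(flip m n *\<^sub>v kronv v w) $ p = (\<Sum>k<m * n. (if k = q then 1 else 0) * kronv v w $ k)"
    using p assms by (simp add: flip_def scalar_prod_def atLeast0LessThan eq)
  also have "\<dots> = (\<Sum>k<m * n. if k = q then kronv v w $ k else 0)"
    by (intro sum.cong) auto
  also have "\<dots> = kronv w v $ p" using p qm assms by (simp add: q mult.commute)
  finally show "(flip m n *\<^sub>v kronv v w) $ p = kronv w v $ p" .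
qed (use assms in simp)

text \<open>
  The flip with the Koszul sign rule, for the \<open>\<int>\<^sub>2\<close>-grading by the eigenvalues of \<open>b = c\<close>.
\<close>
definition braid :: "'k::field d4_mod \<Rightarrow> 'k d4_mod \<Rightarrow> 'k mat" where
  "braid M N = (1 / 2) \<cdot>\<^sub>m (flip (mdim M) (mdim N) *
     (kron (1\<^sub>m (mdim M)) (1\<^sub>m (mdim N)) + kron (1\<^sub>m (mdim M)) (act N Gb) +
      kron (act M Gb) (1\<^sub>m (mdim N)) - kron (act M Gb) (act N Gb)))"

text \<open>On eigenvectors of b with signs x and y the four terms add up to the factor (1 + x + y -
  x y) / 2, which is -1 for x = y = -1 and 1 otherwise. Expressed through b, the sign rule applies
  to all vectors at once.\<close>

lemma braid_kronv:
  assumes "d4_module M" "d4_module N" "dim_vec v = mdim M" "dim_vec w = mdim N"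
  shows "braid M N *\<^sub>v kronv v w = (1 / 2) \<cdot>\<^sub>v
    (kronv w v + kronv (act N Gb *\<^sub>v w) v + kronv w (act M Gb *\<^sub>v v) - kronv (act N Gb *\<^sub>v w) (act M Gb *\<^sub>v v))"
  using assms unfolding braid_def
  by (simp add: mat_vec_dim d4_module_dim kron_mult_kronv flip_kronv)

lemma dim_braid:
  assumes "d4_module M" "d4_module N"
  shows "dim_row (braid M N) = mdim N * mdim M" "dim_col (braid M N) = mdim M * mdim N"
  using assms by (simp_all add: braid_def d4_module_dim)

text \<open>The sign occurs twice and cancels: (1 + x + y - x y)^2 = 4 for all signs x and
  y.\<close>

lemma braid_inverse:
  fixes M N :: "'k::field d4_mod"
  assumes char: "CHAR('k) \<noteq> 2" and m: "d4_module M" "d4_module N"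
  shows "braid N M * braid M N = 1\<^sub>m (mdim M * mdim N)"
proof (rule mat_eqI_kronv[where m = "mdim M" and n = "mdim N"])
  fix p q
  define v w :: "'k vec" where "v = unit_vec (mdim M) p" and "w = unit_vec (mdim N) q"
  have [simp]: "dim_vec v = mdim M" "dim_vec w = mdim N" by (simp_all add: v_def w_def)
  note dim = d4_module_dim[OF m(1)] d4_module_dim[OF m(2)] dim_braid[OF m] dim_braid[OF m(2,1)]
  note simps = braid_kronv[OF m] braid_kronv[OF m(2,1)] d4_module_vec(7)[OF m(1)] d4_module_vec(7)[OF m(2)]
    dim mat_vec_dim
  let ?v = "act M Gb *\<^sub>v v" and ?w = "act N Gb *\<^sub>v w"
  have "braid N M * braid M N *\<^sub>v kronv v w =
     (1 / 2) \<cdot>\<^sub>v ((1 / 2) \<cdot>\<^sub>v (kronv v w + kronv v w + kronv v w + kronv v w))"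
    by (simp add: simps del: index_mult_mat_vec;
        intro eq_vecI; simp add: dim algebra_simps two_neq_zero[OF char] four_neq_zero[OF char]
          del: index_mult_mat_vec index_kronv)
  also have "\<dots> = kronv v w"
  proof (rule eq_vecI)
    fix i assume i: "i < dim_vec (kronv v w)"
    let ?x = "kronv v w $ i"
    have two: "1 / 2 * 2 = (1 :: 'k)" using two_neq_zero[OF char] by simp
    have "((1 / 2) \<cdot>\<^sub>v ((1 / 2) \<cdot>\<^sub>v (kronv v w + kronv v w + kronv v w + kronv v w))) $ i =
        1 / 2 * (1 / 2 * (?x + ?x + ?x + ?x))"
      using i by (simp del: index_kronv)
    also have "?x + ?x + ?x + ?x = 2 * (2 * ?x)" by simp
    also have "1 / 2 * (1 / 2 * (2 * (2 * ?x))) = (1 / 2 * 2) * ((1 / 2 * 2) * ?x)"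
      by (simp only: mult_ac)
    finally show "((1 / 2) \<cdot>\<^sub>v ((1 / 2) \<cdot>\<^sub>v (kronv v w + kronv v w + kronv v w + kronv v w))) $ i = ?x"
      unfolding two by simp
  qed simp
  finally show "braid N M * braid M N *\<^sub>v kronv (unit_vec (mdim M) p) (unit_vec (mdim N) q) =
      1\<^sub>m (mdim M * mdim N) *\<^sub>v kronv (unit_vec (mdim M) p) (unit_vec (mdim N) q)"
    by (simp add: v_def w_def one_mult_vec_dim)
qed (use m in \<open>simp_all add: dim_braid\<close>)

text \<open>With \<open>b = c\<close> the comultiplication makes both a and d act on products as odd
  derivations for one and the same grading, so the graded flip commutes with them.\<close>

lemma d4_tensor_comm:
  fixes M N :: "'k::field d4_mod"
  assumes char: "CHAR('k) \<noteq> 2" and m: "d4_module M" "d4_module N"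
    and bc: "act M Gb = act M Gc" "act N Gb = act N Gc"
  shows "M \<otimes>\<^sub>D N \<cong>\<^sub>D N \<otimes>\<^sub>D M"
proof -
  note [simp] = dim_braid[OF m] dim_braid[OF m(2,1)]
  note dim = d4_module_dim[OF m(1)] d4_module_dim[OF m(2)]
    d4_module_dim[OF d4_module_tensor[OF m]] d4_module_dim[OF d4_module_tensor[OF m(2,1)]]
  note t = d4_tensor_kronv[OF m] d4_tensor_kronv[OF m(2,1)] braid_kronv[OF m] braid_kronv[OF m(2,1)]
  note rel = d4_module_vec(1,2,7)[OF m(1)] d4_module_vec(1,2,7)[OF m(2)]
  note simps = t rel dim bc[symmetric] mat_vec_dim kronv_linear
  have "d4_hom (M \<otimes>\<^sub>D N) (N \<otimes>\<^sub>D M) (braid M N)"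
    unfolding d4_hom_iff
  proof (intro conjI allI)
    fix g show "braid M N * act (M \<otimes>\<^sub>D N) g = act (N \<otimes>\<^sub>D M) g * braid M N"
    proof (rule mat_eqI_kronv[where m = "mdim M" and n = "mdim N"])
      fix p q
      define v w :: "'k vec" where "v = unit_vec (mdim M) p" and "w = unit_vec (mdim N) q"
      have [simp]: "dim_vec v = mdim M" "dim_vec w = mdim N" by (simp_all add: v_def w_def)
      show "braid M N * act (M \<otimes>\<^sub>D N) g *\<^sub>v kronv (unit_vec (mdim M) p) (unit_vec (mdim N) q) =
          act (N \<otimes>\<^sub>D M) g * braid M N *\<^sub>v kronv (unit_vec (mdim M) p) (unit_vec (mdim N) q)"
        unfolding v_def[symmetric] w_def[symmetric]
        by (cases g; simp add: simps del: d4_tensor_simps(2-) index_mult_mat_vec;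
            intro eq_vecI; simp add: dim algebra_simps del: index_mult_mat_vec index_kronv)
    qed (simp_all add: dim del: d4_tensor_simps(2-))
  qed simp_all
  then show ?thesis
    by (rule d4_isoI[where G = "braid N M"])
       (use m in \<open>simp_all add: d4_module_tensor braid_inverse[OF char] mult.commute\<close>)
qed

subsection \<open>Tensor products of the models\<close>

definition KK_map where
  "KK_map m s t \<phi>tt \<phi>tb \<phi>bt \<phi>bb = colmat m ((2 * s + 1) * (2 * t + 1)) (\<lambda>k.
     let p = k div (2 * t + 1); q = k mod (2 * t + 1); i = int p - int s - 1; j = int q - int t - 1 in
     if p \<le> s then (if q \<le> t then \<phi>tt (int p) (int q) else \<phi>tb (int p) j)
     else (if q \<le> t then \<phi>bt i (int q) else \<phi>bb i j))"

lemma dim_KK_map [simp]: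
  "dim_row (KK_map m s t a b c d) = m" "dim_col (KK_map m s t a b c d) = (2 * s + 1) * (2 * t + 1)"
  unfolding KK_map_def by (rule dim_colmat)+

lemma colmat_kronv:
  assumes "p < m" "q < n" "dim_vec (c (p * n + q)) = l"
  shows "colmat l (m * n) c *\<^sub>v kronv (unit_vec m p) (unit_vec n q) = c (p * n + q)"
proof -
  have "p * n + q < (p + 1) * n" using assms(2) by (simp add: algebra_simps)
  also have "\<dots> \<le> m * n" using assms(1) by (intro mult_right_mono) auto
  finally have k: "p * n + q < m * n" .
  have "unit_vec (m * n) (p * n + q) = (kronv (unit_vec m p) (unit_vec n q) :: 'a vec)"
    using unit_vec_kronv[OF k] assms(2) by simp
  then show ?thesis using colmat_unit_vec[where c = c, OF k assms(3)] by simp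
qed

lemma KK_map_kronv:
  assumes "\<And>i j. dim_vec (a i j) = m" "\<And>i j. dim_vec (b i j) = m"
    "\<And>i j. dim_vec (c i j) = m" "\<And>i j. dim_vec (d i j) = m"
  shows
    "0 \<le> i \<Longrightarrow> i \<le> int s \<Longrightarrow> 0 \<le> j \<Longrightarrow> j \<le> int t \<Longrightarrow>
      KK_map m s t a b c d *\<^sub>v kronv (Kt s i) (Kt t j) = a i j"
    "0 \<le> i \<Longrightarrow> i \<le> int s \<Longrightarrow> 0 \<le> j \<Longrightarrow> j < int t \<Longrightarrow>
      KK_map m s t a b c d *\<^sub>v kronv (Kt s i) (Kb t j) = b i j"
    "0 \<le> i \<Longrightarrow> i < int s \<Longrightarrow> 0 \<le> j \<Longrightarrow> j \<le> int t \<Longrightarrow>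
      KK_map m s t a b c d *\<^sub>v kronv (Kb s i) (Kt t j) = c i j"
    "0 \<le> i \<Longrightarrow> i < int s \<Longrightarrow> 0 \<le> j \<Longrightarrow> j < int t \<Longrightarrow>
      KK_map m s t a b c d *\<^sub>v kronv (Kb s i) (Kb t j) = d i j"
  using assms unfolding KK_map_def Kt_def Kb_def Let_def
  by (simp_all add: nat_le_iff colmat_kronv nat_less_iff del: mult_Suc mult_Suc_right)

lemma mat_eqI_KK:
  fixes A B :: "'k::field mat"
  assumes "dim_row A = dim_row B" "dim_col A = (2 * s + 1) * (2 * t + 1)" "dim_col B = (2 * s + 1) * (2 * t + 1)"
    and tt: "\<And>i j. 0 \<le> i \<Longrightarrow> i \<le> int s \<Longrightarrow> 0 \<le> j \<Longrightarrow> j \<le> int t \<Longrightarrow>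
      A *\<^sub>v kronv (Kt s i) (Kt t j) = B *\<^sub>v kronv (Kt s i) (Kt t j)"
    and tb: "\<And>i j. 0 \<le> i \<Longrightarrow> i \<le> int s \<Longrightarrow> 0 \<le> j \<Longrightarrow> j < int t \<Longrightarrow>
      A *\<^sub>v kronv (Kt s i) (Kb t j) = B *\<^sub>v kronv (Kt s i) (Kb t j)"
    and bt: "\<And>i j. 0 \<le> i \<Longrightarrow> i < int s \<Longrightarrow> 0 \<le> j \<Longrightarrow> j \<le> int t \<Longrightarrow>
      A *\<^sub>v kronv (Kb s i) (Kt t j) = B *\<^sub>v kronv (Kb s i) (Kt t j)"
    and bb: "\<And>i j. 0 \<le> i \<Longrightarrow> i < int s \<Longrightarrow> 0 \<le> j \<Longrightarrow> j < int t \<Longrightarrow>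
      A *\<^sub>v kronv (Kb s i) (Kb t j) = B *\<^sub>v kronv (Kb s i) (Kb t j)"
  shows "A = B"
proof (rule mat_eqI_kronv[OF assms(1-3)])
  fix p q assume pq: "p < 2 * s + 1" "q < 2 * t + 1"
  show "A *\<^sub>v kronv (unit_vec (2 * s + 1) p) (unit_vec (2 * t + 1) q) =
      B *\<^sub>v kronv (unit_vec (2 * s + 1) p) (unit_vec (2 * t + 1) q)"
    by (rule unit_vec_K_cases[OF pq(1), where 'k = 'k]; rule unit_vec_K_cases[OF pq(2), where 'k = 'k];
        simp add: tt tb bt bb)
qed

section \<open>The product of a syzygy and a cosyzygy\<close>

lemma index_unit_vec_less: "j < n \<Longrightarrow> unit_vec n k $ j = (if j = k then 1 else 0)"
  by (simp add: unit_vec_def)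

text \<open>In the dual, \<open>Kb t j\<close> is the top vector g_j and \<open>Kt t j\<close> the
  socle vector h_j. The bounds on \<open>j\<close> matter: for j = t or j = -1 the vector
  \<open>Kb t j\<close> is 0, but \<open>Kt t t\<close> or \<open>Kt t 0\<close> would appear on the
  right.\<close>

lemma act_dual_Km:
  "act (d4_dual (Km t \<tau>)) Ga *\<^sub>v Kt t j = 0\<^sub>v (2 * t + 1)"
  "act (d4_dual (Km t \<tau>)) Gd *\<^sub>v Kt t j = 0\<^sub>v (2 * t + 1)"
  "0 \<le> j \<Longrightarrow> j < int t \<Longrightarrow> act (d4_dual (Km t \<tau>)) Ga *\<^sub>v Kb t j = Kt t j"
  "0 \<le> j \<Longrightarrow> j < int t \<Longrightarrow> act (d4_dual (Km t \<tau>)) Gd *\<^sub>v Kb t j = Kt t (j + 1)"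
  "act (d4_dual (Km t \<tau>)) Gb *\<^sub>v Kt t j = par \<tau> \<cdot>\<^sub>v Kt t j"
  "act (d4_dual (Km t \<tau>)) Gb *\<^sub>v Kb t j = - par \<tau> \<cdot>\<^sub>v Kb t j"
  by (auto simp: Km_def K_map_def colmat_def Kt_def Kb_def mult_unit_vec_dim mult_vec_zero_dim index_unit_vec_less
      intro!: eq_vecI)

lemma act_dual_Km_bc: "act (d4_dual (Km t \<tau>)) Gc = act (d4_dual (Km t \<tau>)) Gb"
  by (simp add: act_Km_bc)

abbreviation KC :: "nat \<Rightarrow> bit \<Rightarrow> nat \<Rightarrow> bit \<Rightarrow> 'k::field d4_mod" where
  "KC s \<rho> t \<tau> \<equiv> Km s \<rho> \<otimes>\<^sub>D d4_dual (Km t \<tau>)"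

lemma d4_module_KC: "d4_module (KC s \<rho> t \<tau>)"
  by (simp add: d4_module_tensor d4_module_dual d4_module_Km)

text \<open>The factors \<open>par \<tau>\<close> arise because in \<Delta>(a) and \<Delta>(d) the
  second factor is acted on by b or c.\<close>

lemma act_KC:
  fixes \<rho> \<tau> :: bit and s t :: nat
  defines "X \<equiv> KC s \<rho> t \<tau> :: 'k::field d4_mod"
  shows
    "act X Ga *\<^sub>v kronv (Kt s i) (Kt t j) = par \<tau> \<cdot>\<^sub>v kronv (Kb s i) (Kt t j)"
    "act X Gd *\<^sub>v kronv (Kt s i) (Kt t j) = par \<tau> \<cdot>\<^sub>v kronv (Kb s (i - 1)) (Kt t j)"
    "act X Gb *\<^sub>v kronv (Kt s i) (Kt t j) = (par \<rho> * par \<tau>) \<cdot>\<^sub>v kronv (Kt s i) (Kt t j)"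
    "act X Ga *\<^sub>v kronv (Kb s i) (Kt t j) = 0\<^sub>v ((2 * s + 1) * (2 * t + 1))"
    "act X Gd *\<^sub>v kronv (Kb s i) (Kt t j) = 0\<^sub>v ((2 * s + 1) * (2 * t + 1))"
    "act X Gb *\<^sub>v kronv (Kb s i) (Kt t j) = (- (par \<rho> * par \<tau>)) \<cdot>\<^sub>v kronv (Kb s i) (Kt t j)"
    "0 \<le> j \<Longrightarrow> j < int t \<Longrightarrow> act X Ga *\<^sub>v kronv (Kt s i) (Kb t j) =
       (- par \<tau>) \<cdot>\<^sub>v kronv (Kb s i) (Kb t j) + kronv (Kt s i) (Kt t j)"
    "0 \<le> j \<Longrightarrow> j < int t \<Longrightarrow> act X Gd *\<^sub>v kronv (Kt s i) (Kb t j) =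
       (- par \<tau>) \<cdot>\<^sub>v kronv (Kb s (i - 1)) (Kb t j) + kronv (Kt s i) (Kt t (j + 1))"
    "act X Gb *\<^sub>v kronv (Kt s i) (Kb t j) = (- (par \<rho> * par \<tau>)) \<cdot>\<^sub>v kronv (Kt s i) (Kb t j)"
    "0 \<le> j \<Longrightarrow> j < int t \<Longrightarrow> act X Ga *\<^sub>v kronv (Kb s i) (Kb t j) = kronv (Kb s i) (Kt t j)"
    "0 \<le> j \<Longrightarrow> j < int t \<Longrightarrow> act X Gd *\<^sub>v kronv (Kb s i) (Kb t j) = kronv (Kb s i) (Kt t (j + 1))"
    "act X Gb *\<^sub>v kronv (Kb s i) (Kb t j) = (par \<rho> * par \<tau>) \<cdot>\<^sub>v kronv (Kb s i) (Kb t j)"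
    "act X Gc = act X Gb"
  unfolding X_def
  by (simp_all add: d4_tensor_kronv d4_module_dual d4_module_Km act_Km act_Km_bc act_dual_Km
      act_dual_Km_bc kronv_linear del: d4_dual_simps(2) d4_tensor_simps(2-))
     (auto intro!: eq_vecI simp: act_Km_bc simp del: index_kronv)

lemma act_dual_PF:
  fixes r :: bit and n :: nat and k :: int
  defines "Q \<equiv> d4_dual (PF n r :: 'k::field d4_mod)"
  shows
    "act Q Ga *\<^sub>v xb n k 3 = xb n k 2"
    "act Q Gd *\<^sub>v xb n k 3 = - xb n k 1"
    "act Q Ga *\<^sub>v xb n k 1 = xb n k 0"
proof -
  let ?P = "P4 r :: 'k d4_mod"
  have "transpose_mat (act ?P Ga) *\<^sub>v unit_vec 4 3 = unit_vec 4 2"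
    "transpose_mat (act ?P Gd) *\<^sub>v unit_vec 4 3 = - unit_vec 4 1"
    "transpose_mat (act ?P Ga) *\<^sub>v unit_vec 4 1 = unit_vec 4 0"
    by (auto intro!: eq_vecI simp: mult_unit_vec_dim P4_def dest!: less_4_cases)
  then show
    "act Q Ga *\<^sub>v xb n k 3 = xb n k 2"
    "act Q Gd *\<^sub>v xb n k 3 = - xb n k 1"
    "act Q Ga *\<^sub>v xb n k 1 = xb n k 0"
    by (auto simp: Q_def xb_def d4_copies_simps d4_module_P4 transpose_kron kron_mult_kronv one_mult_vec_dim
        kronv_linear mult_vec_zero_dim intro!: eq_vecI simp del: index_mult_mat_vec)
qed

text \<open>
  A homomorphism \<open>X \<rightarrow> n P(r)\<close> is given by \<open>n\<close> linear forms on \<open>X\<close>, the coefficients at the socle.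
  So a free submodule on generators \<open>v k\<close> splits off as soon as the socle elements \<open>a d v k\<close> have
  a dual system of forms \<open>l k\<close> of the right parity.
\<close>
lemma split_free:
  fixes X :: "'k::field d4_mod"
  assumes X: "d4_module X" and v: "\<And>k. dim_vec (v k) = mdim X" and l: "\<And>k. dim_vec (l k) = mdim X"
    and vp: "\<And>k g. 0 \<le> k \<Longrightarrow> k < int n \<Longrightarrow> g \<in> {Gb, Gc} \<Longrightarrow> act X g *\<^sub>v v k = par r \<cdot>\<^sub>v v k"
    and lp: "\<And>k g. 0 \<le> k \<Longrightarrow> k < int n \<Longrightarrow> g \<in> {Gb, Gc} \<Longrightarrow>
      transpose_mat (act X g) *\<^sub>v l k = par r \<cdot>\<^sub>v l k"
    and pairing: "\<And>k k'. 0 \<le> k \<Longrightarrow> k < int n \<Longrightarrow> 0 \<le> k' \<Longrightarrow> k' < int n \<Longrightarrow>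
      l k \<bullet> v k' = 0 \<and> l k \<bullet> (act X Ga *\<^sub>v v k') = 0 \<and> l k \<bullet> (act X Gd *\<^sub>v v k') = 0 \<and>
      l k \<bullet> (act X Ga *\<^sub>v (act X Gd *\<^sub>v v k')) = (if k = k' then 1 else 0)"
  obtains q where "d4_hom X (PF n r) q" "q * PF_hom n X v = 1\<^sub>m (n * 4)"
proof -
  define B where "B = PF_hom n X v"
  define A where "A = transpose_mat (PF_hom n (d4_dual X) l)"
  \<comment> \<open>\<open>B\<close> maps the free module into \<open>X\<close>, and
    \<open>A\<close> maps \<open>X\<close> to the dual of the free module by means of the forms, so
    \<open>E\<close> compares the free module with its own dual.\<close>
  define E where "E = A * B"
  note dim = d4_module_dim[OF X]
  have hB: "d4_hom (PF n r) X B"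
    unfolding B_def by (rule PF_hom_hom) (use X v vp in auto)
  have "d4_hom (PF n r) (d4_dual X) (PF_hom n (d4_dual X) l)"
    by (rule PF_hom_hom) (use X l lp in \<open>auto simp: d4_module_dual\<close>)
  then have hA: "d4_hom X (d4_dual (PF n r)) A"
    unfolding A_def using d4_hom_dual[OF _ d4_module_PF d4_module_dual[OF X]] by simp
  have [simp]: "dim_row A = n * 4" "dim_col A = mdim X" "dim_row B = mdim X" "dim_col B = n * 4"
    "dim_row E = n * 4" "dim_col E = n * 4"
    by (simp_all add: A_def B_def E_def)
  have hE: "d4_hom (PF n r) (d4_dual (PF n r)) E"
    unfolding E_def by (rule d4_hom_comp[OF hB hA d4_module_PF X d4_module_dual[OF d4_module_PF]])
  have form: "(transpose_mat F *\<^sub>v x) \<bullet> y = x \<bullet> (F *\<^sub>v y)"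
    if "dim_row F = mdim X" "dim_col F = mdim X" "dim_vec x = mdim X" "dim_vec y = mdim X"
    for F :: "'k mat" and x y
    using that by (intro transpose_vec_mult_scalar[of _ "mdim X" "mdim X"]) auto
  \<comment> \<open>The coordinate of \<open>E x_k\<close> at component 3 of generator k' is
    \<open>l k'\<close> evaluated at d a (v k) = - a d (v k), whence the minus sign; the remaining
    pairings vanish.\<close>
  have E0: "E *\<^sub>v xb n k 0 = - xb n k 3" if k: "0 \<le> k" "k < int n" for k
  proof (rule eq_vecI)
    fix p assume "p < dim_vec (- xb n k 3 :: 'k vec)"
    then have p: "p < n * 4" by simp
    define k' where "k' = int (p div 4)"
    have k': "0 \<le> k'" "k' < int n" using div_mod_less[OF p] by (auto simp: k'_def)
    have c: "p mod 4 < 4" by simp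
    have u: "unit_vec (n * 4) p = (xb n k' (p mod 4) :: 'k vec)"
      using k' unit_vec_kronv[OF p] by (simp add: xb_def k'_def)
    have "(E *\<^sub>v xb n k 0) $ p = (A *\<^sub>v v k) $ p"
      using k v by (simp add: E_def mat_vec_dim B_def PF_hom_xb[OF X v])
    also have "\<dots> = (PF_hom n (d4_dual X) l *\<^sub>v xb n k' (p mod 4)) \<bullet> v k"
      unfolding u[symmetric] using p by (simp add: A_def mult_unit_vec_dim)
    also have "\<dots> = (if k = k' \<and> p mod 4 = 3 then - 1 else 0)"
    proof -
      have da: "l k' \<bullet> (act X Gd *\<^sub>v (act X Ga *\<^sub>v v k)) = (if k = k' then - 1 else 0)"
      proof -
        have "act X Gc *\<^sub>v (act X Gb *\<^sub>v v k) = v k"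
          using vp[OF k] v dim by (auto simp: mat_vec_dim intro!: eq_vecI simp del: index_mult_mat_vec)
        then have "act X Gd *\<^sub>v (act X Ga *\<^sub>v v k) = - (act X Ga *\<^sub>v (act X Gd *\<^sub>v v k))"
          using v dim by (auto simp: d4_module_vec(10)[OF X] intro!: eq_vecI simp del: index_mult_mat_vec)
        then show ?thesis using pairing[OF k' k] l v dim by (auto simp: scalar_prod_uminus_right)
      qed
      show ?thesis
        using less_4_cases[OF c] pairing[OF k' k] da k' l v dim
        by (auto simp: PF_hom_xb d4_module_dual X form)
    qed
    also have "\<dots> = (- xb n k 3) $ p"
      using p k k' by (auto simp: xb_def index_unit_vec_less div_mod_less k'_def)
    finally show "(E *\<^sub>v xb n k 0) $ p = (- xb n k 3) $ p" .
  qed simp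
  have Eg: "E *\<^sub>v (act (PF n r) g *\<^sub>v x) = act (d4_dual (PF n r)) g *\<^sub>v (E *\<^sub>v x)"
    if "dim_vec x = n * 4" for g x
    using d4_hom_vec[OF hE d4_module_PF d4_module_dual[OF d4_module_PF]] that by simp
  have mu: "act (d4_dual (PF n r)) g *\<^sub>v (- x) = - (act (d4_dual (PF n r)) g *\<^sub>v x)"
    if "dim_vec x = n * 4" for g and x :: "'k vec"
    using that by (intro mult_vec_uminus_dim) simp
  have E1: "E *\<^sub>v xb n k 1 = - xb n k 2" if k: "0 \<le> k" "k < int n" for k
    using Eg[of "xb n k 0" Ga] E0[OF k] by (simp add: act_PF mu act_dual_PF del: d4_dual_simps(2))
  have E2: "E *\<^sub>v xb n k 2 = xb n k 1" if k: "0 \<le> k" "k < int n" for k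
    using Eg[of "xb n k 0" Gd] E0[OF k] by (simp add: act_PF mu act_dual_PF del: d4_dual_simps(2))
  have E3: "E *\<^sub>v xb n k 3 = xb n k 0" if k: "0 \<le> k" "k < int n" for k
    using Eg[of "xb n k 2" Ga] E2[OF k] by (simp add: act_PF mu act_dual_PF del: d4_dual_simps(2))
  \<comment> \<open>\<open>E\<close> is the Frobenius self-duality of the free module; its square is
    -1, so - E inverts it and turns \<open>A\<close> into the required retraction.\<close>
  have EE: "E * E = - 1\<^sub>m (n * 4)"
    by (rule mat_eqI_xb[where n = n])
       (auto simp: mat_vec_dim mult_vec_uminus_dim E0 E1 E2 E3 intro!: eq_vecI simp del: index_mult_mat_vec)
  have hE': "d4_hom (d4_dual (PF n r)) (PF n r) (- E)"
    by (rule d4_hom_inverse[OF hE d4_module_PF d4_module_dual[OF d4_module_PF]])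
       (use EE in \<open>simp_all add: uminus_mult_dim\<close>)
  show ?thesis
  proof (rule that)
    show "d4_hom X (PF n r) (- E * A)"
      by (rule d4_hom_comp[OF hA hE' X d4_module_dual[OF d4_module_PF] d4_module_PF])
    have "- E * A * B = - E * E" by (simp add: E_def)
    then show "- E * A * PF_hom n X v = 1\<^sub>m (n * 4)"
      using EE by (simp add: B_def[symmetric] uminus_mult_dim)
  qed
qed

text \<open>
  The forms \<open>\<Lambda>\<close> are found as follows: up to sign, \<open>a d (e\<^sub>i \<otimes> g\<^sub>j)\<close> is the difference of the neighbours
  \<open>f\<^bsub>i-1\<^esub> \<otimes> h\<^sub>j\<close> and \<open>f\<^sub>i \<otimes> h\<^bsub>j+1\<^esub>\<close> on a diagonal, so the dual forms are partial sums along the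
  diagonal, started at an end where the neighbour is missing.  As \<open>t \<le> s\<close>, there is such an end.
\<close>
lemma KC_decomposition:
  fixes \<rho> \<tau> :: bit and s t :: nat
  assumes ts: "t \<le> s"
  shows "(KC s \<rho> t \<tau> :: 'k::field d4_mod) \<cong>\<^sub>D Km (s - t) (\<rho> + \<tau>) \<oplus>\<^sub>D PF ((s + 1) * t) (\<rho> + \<tau> + 1)"
proof -
  let ?X = "KC s \<rho> t \<tau> :: 'k d4_mod"
  define N where "N = (2 * s + 1) * (2 * t + 1)"
  define n where "n = (s + 1) * t"
  define u where "u = s - t"
  define \<epsilon> \<epsilon>' where "\<epsilon> = \<rho> + \<tau>" and "\<epsilon>' = \<rho> + \<tau> + 1"
  have par_\<epsilon>: "par \<epsilon> = (par \<rho> * par \<tau> :: 'k)" unfolding \<epsilon>_def by (rule par_add)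
  have par_\<epsilon>': "par \<epsilon>' = (- (par \<rho> * par \<tau>) :: 'k)" unfolding \<epsilon>'_def by (subst par_succ) (simp only: par_add)
  have u: "int u = int s - int t" using ts by (simp add: u_def)
  have X: "d4_module ?X" by (rule d4_module_KC)
  have [simp]: "mdim ?X = N" "dim_row (act ?X g) = N" "dim_col (act ?X g) = N" for g
    using d4_module_dim[OF X] by (simp_all add: N_def del: d4_tensor_simps(2-))
  note [simp del] = d4_tensor_simps
  have dk [simp]: "dim_vec (kronv v w) = N" if "dim_vec v = 2 * s + 1" "dim_vec w = 2 * t + 1"
    for v w :: "'k vec"
    using that by (simp add: N_def)
  note [simp del] = dim_kronv
  \<comment> \<open>Compatibility with a leaves no choice: a (e_i \<otimes> h_j) =
    \<open>par \<tau>\<close> f_i \<otimes> h_j determines the third family, and a (e_i \<otimes>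
    g_j) = - \<open>par \<tau>\<close> f_i \<otimes> g_j + e_i \<otimes> h_j, which must go to 0,
    determines the fourth.\<close>
  define p :: "'k mat" where "p = KK_map (2 * u + 1) s t (\<lambda>i j. Kt u (i - j)) (\<lambda>i j. 0\<^sub>v (2 * u + 1))
      (\<lambda>i j. par \<tau> \<cdot>\<^sub>v Kb u (i - j)) (\<lambda>i j. par \<tau> \<cdot>\<^sub>v Kt u (i - j))"
  have [simp]: "dim_row p = 2 * u + 1" "dim_col p = N" by (simp_all add: p_def N_def)
  have p0: "p *\<^sub>v 0\<^sub>v N = 0\<^sub>v (2 * u + 1)"
    by (simp add: mult_vec_zero_dim)
  have kz: "kronv (0\<^sub>v (2 * s + 1)) w = 0\<^sub>v N" if "dim_vec w = 2 * t + 1" for w :: "'k vec"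
    using that by (simp add: N_def)
  note act = act_KC[where s = s and t = t and \<rho> = \<rho> and \<tau> = \<tau> and 'k = 'k, folded N_def]
  have Kb_out: "Kb s i = 0\<^sub>v (2 * s + 1)" if "\<not> (0 \<le> i \<and> i < int s)" for i
    unfolding Kb_def using that by auto
  have u_out: "Kb u i = 0\<^sub>v (2 * u + 1)" if "i < 0 \<or> int s - int t \<le> i" for i
    unfolding Kb_def using that u by auto
  have u_out': "Kt u i = 0\<^sub>v (2 * u + 1)" if "i < 0 \<or> int s - int t < i" for i
    unfolding Kt_def using that u by auto
  have s0: "c \<cdot>\<^sub>v 0\<^sub>v m = (0\<^sub>v m :: 'k vec)" for c m by (intro eq_vecI) auto
  have p_tt: "p *\<^sub>v kronv (Kt s i) (Kt t j) = Kt u (i - j)" if "0 \<le> i" "i \<le> int s" "0 \<le> j" "j \<le> int t" for i j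
    unfolding p_def using that by (intro KK_map_kronv) auto
  have p_tb: "p *\<^sub>v kronv (Kt s i) (Kb t j) = 0\<^sub>v (2 * u + 1)"
    if "0 \<le> i" "i \<le> int s" "0 \<le> j" "j < int t" for i j
    unfolding p_def using that by (intro KK_map_kronv) auto
  \<comment> \<open>The values -1 and s of \<open>i\<close> are included because d and a lead there.
    Then \<open>Kb s i\<close> is 0, and the right-hand side vanishes too since \<open>i - j\<close>
    leaves the range.\<close>
  have p_bt: "p *\<^sub>v kronv (Kb s i) (Kt t j) = par \<tau> \<cdot>\<^sub>v Kb u (i - j)"
    if "- 1 \<le> i" "i \<le> int s" "0 \<le> j" "j \<le> int t" for i j
  proof (cases "0 \<le> i \<and> i < int s")
    case True then show ?thesis unfolding p_def using that by (intro KK_map_kronv) auto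
  next
    case False then show ?thesis using that by (auto simp: Kb_out u_out s0 p0 kz simp del: kronv_zero)
  qed
  have p_bb: "p *\<^sub>v kronv (Kb s i) (Kb t j) = par \<tau> \<cdot>\<^sub>v Kt u (i - j)"
    if "- 1 \<le> i" "i \<le> int s" "0 \<le> j" "j < int t" for i j
  proof (cases "0 \<le> i \<and> i < int s")
    case True then show ?thesis unfolding p_def using that by (intro KK_map_kronv) auto
  next
    case False then show ?thesis using that by (auto simp: Kb_out u_out' s0 p0 kz simp del: kronv_zero)
  qed
  note p = p_tt p_tb p_bt p_bb
  have hp: "d4_hom ?X (Km u \<epsilon>) p"
    unfolding d4_hom_iff
  proof (intro conjI allI)
    fix g show "p * act ?X g = act (Km u \<epsilon>) g * p"
      by (rule mat_eqI_KK[where s = s and t = t]; (simp add: N_def; fail)?; cases g)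
         (auto simp: mat_vec_dim act p p0 act_Km act_Km_bc par_\<epsilon> algebra_simps
           intro!: eq_vecI simp del: index_mult_mat_vec index_kronv dim_kronv)
  qed simp_all
  \<comment> \<open>The number k encodes the pair (i, j) by division with remainder by t.\<close>
  define v where "v k = (kronv (Kt s (k div int t)) (Kb t (k mod int t)) :: 'k vec)" for k
  have dv: "dim_vec (v k) = mdim ?X" for k by (simp add: v_def)
  \<comment> \<open>Up to \<open>par \<tau>\<close> this is the coefficient at f_p \<otimes> h_q of
    the form dual to a d (e_i \<otimes> g_j). For i \<le> j every pair (i', j') on the diagonal has
    i' \<le> j' < t \<le> s, so only the lower neighbour can be missing and the indicator of p \<ge>
    i works. For i > j one has i' \<ge> 1, only the upper neighbour can be missing, and minus the
    indicator of p < i works.\<close>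
  define \<Lambda> :: "int \<Rightarrow> int \<Rightarrow> int \<Rightarrow> int \<Rightarrow> 'k" where
    "\<Lambda> i j p q = (if p - q = i - j - 1
       then (if i \<le> j then (if i \<le> p then 1 else 0) else (if p < i then - 1 else 0)) else 0)" for i j p q
  \<comment> \<open>The form is treated as a map to a one-dimensional space, so that it can be given
    on the basis tensors.\<close>
  define L where "L k = KK_map 1 s t (\<lambda>i j. 0\<^sub>v 1) (\<lambda>i j. 0\<^sub>v 1)
    (\<lambda>p q. par \<tau> \<cdot>\<^sub>v vec 1 (\<lambda>_. \<Lambda> (k div int t) (k mod int t) p q)) (\<lambda>i j. 0\<^sub>v 1)" for k
  define l where "l k = row (L k) 0" for k
  have [simp]: "dim_row (L k) = 1" "dim_col (L k) = N" "dim_vec (l k) = N" for k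
    by (simp_all add: L_def N_def l_def)
  have L0: "L k *\<^sub>v 0\<^sub>v N = 0\<^sub>v 1" for k by (simp add: mult_vec_zero_dim)
  have L_t: "L k *\<^sub>v kronv (Kt s i) (Kt t j) = 0\<^sub>v 1" if "0 \<le> i" "i \<le> int s" "0 \<le> j" "j \<le> int t" for k i j
    unfolding L_def using that by (intro KK_map_kronv) auto
  have L_tb: "L k *\<^sub>v kronv (Kt s i) (Kb t j) = 0\<^sub>v 1" if "0 \<le> i" "i \<le> int s" "0 \<le> j" "j < int t" for k i j
    unfolding L_def using that by (intro KK_map_kronv) auto
  have L_bb: "L k *\<^sub>v kronv (Kb s i) (Kb t j) = 0\<^sub>v 1" if "0 \<le> j" "j < int t" for k i j
  proof (cases "0 \<le> i \<and> i < int s")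
    case True then show ?thesis unfolding L_def using that by (intro KK_map_kronv) auto
  next
    case False then show ?thesis by (simp add: Kb_out kz L0 del: kronv_zero)
  qed
  have L_bt: "L k *\<^sub>v kronv (Kb s i) (Kt t j) = (if 0 \<le> i \<and> i < int s
      then par \<tau> \<cdot>\<^sub>v vec 1 (\<lambda>_. \<Lambda> (k div int t) (k mod int t) i j) else 0\<^sub>v 1)"
    if "0 \<le> j" "j \<le> int t" for k i j
  proof (cases "0 \<le> i \<and> i < int s")
    case True
    then show ?thesis unfolding if_P[OF True] unfolding L_def using that by (intro KK_map_kronv) auto
  next
    case False then show ?thesis unfolding if_not_P[OF False] by (simp add: Kb_out kz L0 del: kronv_zero)
  qed
  have pair: "l k \<bullet> x = (L k *\<^sub>v x) $ 0" for k x by (simp add: l_def)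
  have range: "0 \<le> k div int t" "k div int t \<le> int s" "0 \<le> k mod int t" "k mod int t < int t"
    if "0 \<le> k" "k < int n" for k
  proof -
    have t: "0 < int t" using that by (cases t) (auto simp: n_def)
    show "0 \<le> k div int t" "0 \<le> k mod int t" "k mod int t < int t"
      using t that by (simp_all add: pos_imp_zdiv_nonneg_iff)
    show "k div int t \<le> int s"
    proof (rule ccontr)
      assume "\<not> k div int t \<le> int s"
      then have "(int s + 1) * int t \<le> (k div int t) * int t" using t by (intro mult_right_mono) auto
      also have "\<dots> \<le> k" using t by (simp add: minus_mod_eq_div_mult[symmetric])
      finally show False using that by (simp add: n_def algebra_simps)
    qed
  qed
  \<comment> \<open>This evaluates the form on a d (e_i' \<otimes> g_j') = \<open>par \<tau>\<close>
    (f_i' \<otimes> h_(j'+1) - f_(i'-1) \<otimes> h_j'), where a missing neighbour counts as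
    0.\<close>
  have delta: "(if 0 \<le> i' \<and> i' < int s then \<Lambda> i j i' (j' + 1) else 0) -
      (if 0 \<le> i' - 1 \<and> i' - 1 < int s then \<Lambda> i j (i' - 1) j' else 0) = (if i = i' \<and> j = j' then 1 else 0)"
    if "0 \<le> i" "i \<le> int s" "0 \<le> j" "j < int t" "0 \<le> i'" "i' \<le> int s" "0 \<le> j'" "j' < int t" for i j i' j'
    using that ts by (auto simp: \<Lambda>_def)
  obtain q where q: "d4_hom ?X (PF n \<epsilon>') q" "q * PF_hom n ?X v = 1\<^sub>m (n * 4)"
  proof (rule split_free[where X = ?X and v = v and l = l and n = n and r = \<epsilon>'])
    fix k g assume g: "g \<in> {Gb, Gc}"
    show "act ?X g *\<^sub>v v k = par \<epsilon>' \<cdot>\<^sub>v v k"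
      using g by (auto simp: v_def act par_\<epsilon>')
    have "L k * act ?X g = par \<epsilon>' \<cdot>\<^sub>m L k"
      by (rule mat_eqI_KK[where s = s and t = t]; (simp add: N_def; fail)?)
         (use g in \<open>auto simp: mat_vec_dim act par_\<epsilon>' L_t L_tb L_bb L_bt algebra_simps
           intro!: eq_vecI simp del: index_mult_mat_vec index_kronv dim_kronv\<close>)
    then have "row (L k * act ?X g) 0 = row (par \<epsilon>' \<cdot>\<^sub>m L k) 0" by simp
    moreover have "transpose_mat (act ?X g) *\<^sub>v l k = row (L k * act ?X g) 0"
      unfolding l_def by (intro eq_vecI) (auto intro!: comm_scalar_prod[where n = N])
    ultimately show "transpose_mat (act ?X g) *\<^sub>v l k = par \<epsilon>' \<cdot>\<^sub>v l k" by (simp add: l_def)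
  next
    fix k k' assume k: "0 \<le> k" "k < int n" "0 \<le> k'" "k' < int n"
    note r = range[OF k(1,2)] range[OF k(3,4)]
    have eq: "k div int t = k' div int t \<and> k mod int t = k' mod int t \<longleftrightarrow> k = k'"
      by (metis div_mult_mod_eq)
    have d: "par \<tau> * (par \<tau> * (if 0 \<le> k' div int t \<and> k' div int t < int s
          then \<Lambda> (k div int t) (k mod int t) (k' div int t) (k' mod int t + 1) else 0)) -
        par \<tau> * (par \<tau> * (if 0 \<le> k' div int t - 1 \<and> k' div int t - 1 < int s
          then \<Lambda> (k div int t) (k mod int t) (k' div int t - 1) (k' mod int t) else 0)) = (if k = k' then 1 else 0)"
      using delta[OF r] unfolding eq by simp
    have "l k \<bullet> v k' = 0" "l k \<bullet> (act ?X Ga *\<^sub>v v k') = 0" "l k \<bullet> (act ?X Gd *\<^sub>v v k') = 0"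
      using r by (simp_all add: pair v_def act mat_vec_dim L_t L_tb L_bb del: index_mult_mat_vec)
    moreover have "l k \<bullet> (act ?X Ga *\<^sub>v (act ?X Gd *\<^sub>v v k')) = (if k = k' then 1 else 0)"
      using r d by (auto simp: pair v_def act mat_vec_dim L_bt simp del: index_mult_mat_vec split: if_splits)
    ultimately show "l k \<bullet> v k' = 0 \<and> l k \<bullet> (act ?X Ga *\<^sub>v v k') = 0 \<and> l k \<bullet> (act ?X Gd *\<^sub>v v k') = 0 \<and>
      l k \<bullet> (act ?X Ga *\<^sub>v (act ?X Gd *\<^sub>v v k')) = (if k = k' then 1 else 0)" by blast
  qed (use X dv in auto)
  \<comment> \<open>A linear section of \<open>p\<close> along h_0; its factor
    \<open>par \<tau>\<close> cancels the one in \<open>p\<close>.\<close>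
  define S :: "'k mat" where "S = K_map N u (\<lambda>m. kronv (Kt s m) (Kt t 0)) (\<lambda>m. par \<tau> \<cdot>\<^sub>v kronv (Kb s m) (Kt t 0))"
  have [simp]: "dim_row S = N" "dim_col S = 2 * u + 1" by (simp_all add: S_def)
  have "?X \<cong>\<^sub>D Km u \<epsilon> \<oplus>\<^sub>D PF n \<epsilon>'"
  proof (rule d4_split[OF X d4_module_Km d4_module_PF _ q(1), where i = "PF_hom n ?X v" and j = S])
    show "d4_hom ?X (Km u \<epsilon>) p" by (rule hp)
    show "p * S = 1\<^sub>m (mdim (Km u \<epsilon> :: 'k d4_mod))"
      by (rule mat_eqI_K[where s = u])
         (use u in \<open>auto simp: mat_vec_dim S_def K_map_Kt K_map_Kb p intro!: eq_vecI
           simp del: index_mult_mat_vec index_kronv dim_kronv\<close>)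
    have pg: "p *\<^sub>v (act ?X g *\<^sub>v x) = act (Km u \<epsilon>) g *\<^sub>v (p *\<^sub>v x)" if "dim_vec x = N" for g x
      using d4_hom_vec[OF hp X d4_module_Km] that by simp
    have pv: "p *\<^sub>v v k = 0\<^sub>v (2 * u + 1)" if "0 \<le> k" "k < int n" for k
      using range[OF that] by (simp add: v_def p)
    show "p * PF_hom n ?X v = 0\<^sub>m (mdim (Km u \<epsilon> :: 'k d4_mod)) (mdim (PF n \<epsilon>' :: 'k d4_mod))"
      by (rule mat_eqI_xb[where n = n])
         (use dv in \<open>simp_all add: mat_vec_dim PF_hom_xb[OF X dv] pg pv\<close>)
    have "N = 2 * u + 1 + n * 4"
    proof -
      \<comment> \<open>The substitution removes the truncated subtraction in s - t.\<close>
      obtain u' where "s = t + u'" using ts le_Suc_ex by blast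
      then show ?thesis by (simp add: N_def n_def u_def algebra_simps)
    qed
    then show "mdim ?X = mdim (Km u \<epsilon> :: 'k d4_mod) + mdim (PF n \<epsilon>' :: 'k d4_mod)" by simp
  qed (use q(2) in simp_all)
  then show ?thesis by (simp only: u_def \<epsilon>_def \<epsilon>'_def n_def)
qed

text \<open>The final dualization turns the syzygy into a cosyzygy but keeps the projective part,
  because \<open>P4\<close> is self-dual with the same parity.\<close>

lemma KC_decomposition_dual:
  fixes \<rho> \<tau> :: bit and s t :: nat
  assumes char: "CHAR('k::field) \<noteq> 2" and "s \<le> t"
  shows "(KC s \<rho> t \<tau> :: 'k d4_mod) \<cong>\<^sub>D d4_dual (Km (t - s) (\<tau> + \<rho>)) \<oplus>\<^sub>D PF ((t + 1) * s) (\<tau> + \<rho> + 1)"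
proof -
  let ?M = "Km s \<rho> :: 'k d4_mod" and ?N = "Km t \<tau> :: 'k d4_mod"
  define \<epsilon> \<epsilon>' where "\<epsilon> = \<tau> + \<rho>" and "\<epsilon>' = \<tau> + \<rho> + 1"
  let ?Y = "Km (t - s) \<epsilon> :: 'k d4_mod" and ?Q = "PF ((t + 1) * s) \<epsilon>' :: 'k d4_mod"
  note m = d4_module_Km d4_module_PF d4_module_dual d4_module_tensor d4_module_sum d4_module_P4 d4_module_copies
  have "d4_dual (KC s \<rho> t \<tau>) = d4_dual ?M \<otimes>\<^sub>D ?N"
    by (simp add: d4_dual_tensor m)
  moreover have "d4_dual ?M \<otimes>\<^sub>D ?N \<cong>\<^sub>D ?N \<otimes>\<^sub>D d4_dual ?M"
    by (rule d4_tensor_comm[OF char]) (simp_all add: m act_Km_bc)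
  moreover have "?N \<otimes>\<^sub>D d4_dual ?M \<cong>\<^sub>D ?Y \<oplus>\<^sub>D ?Q"
    unfolding \<epsilon>_def \<epsilon>'_def by (rule KC_decomposition[OF assms(2)])
  ultimately have "d4_dual (KC s \<rho> t \<tau>) \<cong>\<^sub>D ?Y \<oplus>\<^sub>D ?Q"
    using d4_iso_trans[of "d4_dual ?M \<otimes>\<^sub>D ?N"] by (simp add: m)
  then have "d4_dual (d4_dual (KC s \<rho> t \<tau>)) \<cong>\<^sub>D d4_dual (?Y \<oplus>\<^sub>D ?Q)"
    by (rule d4_iso_dual) (simp_all add: m)
  then have 1: "KC s \<rho> t \<tau> \<cong>\<^sub>D d4_dual ?Y \<oplus>\<^sub>D d4_dual ?Q"
    by (simp add: d4_dual_sum m)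
  have "d4_dual ?Q \<cong>\<^sub>D ?Q"
    unfolding d4_dual_copies[OF d4_module_P4] by (rule d4_iso_copies[OF P4_dual]) (simp_all add: m)
  then have "d4_dual ?Y \<oplus>\<^sub>D d4_dual ?Q \<cong>\<^sub>D d4_dual ?Y \<oplus>\<^sub>D ?Q"
    by (intro d4_iso_sum d4_iso_refl) (simp_all add: m)
  then show ?thesis
    unfolding \<epsilon>'_def[symmetric] unfolding \<epsilon>_def[symmetric] by (intro d4_iso_trans[OF 1]) (simp_all add: m)
qed

text \<open>The four cases are one statement: with \<rho> = r + s and \<tau> = r' + t the generators
  e_i \<otimes> g_j have parity \<rho> + \<tau> + 1 = r + r' + (s + t) + 1, so only the parity of s
  + t matters.\<close>

lemma Omega_tensor:
  fixes r r' :: bit and s t :: nat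
  assumes char: "CHAR('k::field) \<noteq> 2"
  shows "Omega (int s) (V r :: 'k d4_mod) \<otimes>\<^sub>D Omega (- int t) (V r') \<cong>\<^sub>D
    Omega (int s - int t) (V (r + r')) \<oplus>\<^sub>D
      (if t \<le> s then (s + 1) * t else (t + 1) * s) \<odot>\<^sub>D P (r + r' + of_nat (s + t) + 1)"
proof -
  note m = d4_module_Km d4_module_PF d4_module_dual d4_module_tensor d4_module_sum d4_module_P4 d4_module_copies
  define \<rho> \<tau> where "\<rho> = r + of_nat s" and "\<tau> = r' + of_nat t"
  define \<epsilon> where "\<epsilon> = r + r' + of_nat (s + t) + 1"
  define n where "n = (if t \<le> s then (s + 1) * t else (t + 1) * s)"
  have \<epsilon>: "\<rho> + \<tau> + 1 = \<epsilon>" "\<tau> + \<rho> + 1 = \<epsilon>"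
    unfolding \<rho>_def \<tau>_def \<epsilon>_def by (simp_all only: of_nat_add ac_simps)
  have double: "x + x = 0" for x :: bit by (cases x) auto
  define \<omega> where "\<omega> = (Omega (int s - int t) (V (r + r')) :: 'k d4_mod)"
  obtain Y :: "'k d4_mod" where Y: "d4_module \<omega>" "\<omega> \<cong>\<^sub>D Y" "KC s \<rho> t \<tau> \<cong>\<^sub>D Y \<oplus>\<^sub>D PF n \<epsilon>" "d4_module Y"
  proof (cases "t \<le> s")
    case True
    have "of_nat s = of_nat (s - t) + (of_nat t :: bit)"
      using True by (simp only: of_nat_add[symmetric] le_add_diff_inverse2)
    \<comment> \<open>The parity of the model of \<Omega>^(s-t) V(r + r') is the expected one
      because 2 t = 0 modulo 2.\<close>
    then have "\<rho> + \<tau> = (r + r') + of_nat (s - t) + (of_nat t + of_nat t)"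
      unfolding \<rho>_def \<tau>_def by (simp only: ac_simps)
    then have e: "\<rho> + \<tau> = (r + r') + of_nat (s - t)" by (simp only: double add_0_right)
    have i: "int s - int t = int (s - t)" using True by simp
    have a: "d4_module \<omega> \<and> \<omega> \<cong>\<^sub>D Km (s - t) (\<rho> + \<tau>)"
      unfolding \<omega>_def e i by (rule Omega_nonneg[OF char])
    have b: "KC s \<rho> t \<tau> \<cong>\<^sub>D (Km (s - t) (\<rho> + \<tau>) :: 'k d4_mod) \<oplus>\<^sub>D PF n \<epsilon>"
      using KC_decomposition[OF True, where 'k = 'k, of \<rho> \<tau>] unfolding \<epsilon> n_def if_P[OF True] .
    show ?thesis by (rule that[OF conjunct1[OF a] conjunct2[OF a] b d4_module_Km])
  next
    case False
    then have ts: "s \<le> t" by simp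
    have "of_nat t = of_nat (t - s) + (of_nat s :: bit)"
      using ts by (simp only: of_nat_add[symmetric] le_add_diff_inverse2)
    then have "\<tau> + \<rho> = (r + r') + of_nat (t - s) + (of_nat s + of_nat s)"
      unfolding \<rho>_def \<tau>_def by (simp only: ac_simps)
    then have e: "\<tau> + \<rho> = (r + r') + of_nat (t - s)" by (simp only: double add_0_right)
    have i: "int s - int t = - int (t - s)" using ts by simp
    have a: "d4_module \<omega> \<and> \<omega> \<cong>\<^sub>D d4_dual (Km (t - s) (\<tau> + \<rho>))"
      unfolding \<omega>_def e i by (rule Omega_nonpos[OF char])
    have b: "KC s \<rho> t \<tau> \<cong>\<^sub>D d4_dual (Km (t - s) (\<tau> + \<rho>) :: 'k d4_mod) \<oplus>\<^sub>D PF n \<epsilon>"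
      using KC_decomposition_dual[OF char ts, of \<rho> \<tau>] unfolding \<epsilon> n_def if_not_P[OF False] .
    show ?thesis
      by (rule that[OF conjunct1[OF a] conjunct2[OF a] b d4_module_dual[OF d4_module_Km]])
  qed
  let ?A = "Omega (int s) (V r) :: 'k d4_mod" and ?B = "Omega (- int t) (V r') :: 'k d4_mod"
  have A: "d4_module ?A" "?A \<cong>\<^sub>D Km s \<rho>" using Omega_nonneg[OF char] by (auto simp only: \<rho>_def)
  have B: "d4_module ?B" "?B \<cong>\<^sub>D d4_dual (Km t \<tau>)" using Omega_nonpos[OF char] by (auto simp only: \<tau>_def)
  have P: "d4_module (P \<epsilon> :: 'k d4_mod)" "(P \<epsilon> :: 'k d4_mod) \<cong>\<^sub>D P4 \<epsilon>" using P_iso[OF char] by auto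
  have "?A \<otimes>\<^sub>D ?B \<cong>\<^sub>D KC s \<rho> t \<tau>"
    by (rule d4_iso_tensor[OF A(2) B(2) A(1) _ B(1)]) (simp_all add: m)
  then have 1: "?A \<otimes>\<^sub>D ?B \<cong>\<^sub>D Y \<oplus>\<^sub>D PF n \<epsilon>"
    by (rule d4_iso_trans[OF _ Y(3)]) (simp_all add: m A B Y)
  have "n \<odot>\<^sub>D P \<epsilon> \<cong>\<^sub>D (PF n \<epsilon> :: 'k d4_mod)"
    by (rule d4_iso_copies[OF P(2,1)]) (simp add: m)
  then have "\<omega> \<oplus>\<^sub>D n \<odot>\<^sub>D P \<epsilon> \<cong>\<^sub>D Y \<oplus>\<^sub>D PF n \<epsilon>"
    by (intro d4_iso_sum) (simp_all add: m Y P)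
  then have "?A \<otimes>\<^sub>D ?B \<cong>\<^sub>D \<omega> \<oplus>\<^sub>D n \<odot>\<^sub>D P \<epsilon>"
    by (intro d4_iso_trans[OF 1 d4_iso_sym]) (simp_all add: m A B Y P)
  then show ?thesis unfolding \<omega>_def n_def \<epsilon>_def .
qed

theorem proposition2p20:
  fixes r r' :: bit and s t :: nat
  assumes char: "CHAR('k::alg_closed_field) \<noteq> 2"
    and "s \<ge> 1" and "t \<ge> 1"
  shows
    "(even (s + t) \<and> s \<ge> t \<longrightarrow>
        Omega (int s) (V r :: 'k d4_mod) \<otimes>\<^sub>D Omega (- int t) (V r')
          \<cong>\<^sub>D Omega (int s - int t) (V (r + r')) \<oplus>\<^sub>D ((s + 1) * t) \<odot>\<^sub>D P (r + r' + 1)) \<and>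
     (odd (s + t) \<and> s \<ge> t \<longrightarrow>
        Omega (int s) (V r :: 'k d4_mod) \<otimes>\<^sub>D Omega (- int t) (V r')
          \<cong>\<^sub>D Omega (int s - int t) (V (r + r')) \<oplus>\<^sub>D ((s + 1) * t) \<odot>\<^sub>D P (r + r')) \<and>
     (even (s + t) \<and> s < t \<longrightarrow>
        Omega (int s) (V r :: 'k d4_mod) \<otimes>\<^sub>D Omega (- int t) (V r')
          \<cong>\<^sub>D Omega (int s - int t) (V (r + r')) \<oplus>\<^sub>D ((t + 1) * s) \<odot>\<^sub>D P (r + r' + 1)) \<and>
     (odd (s + t) \<and> s < t \<longrightarrow>
        Omega (int s) (V r :: 'k d4_mod) \<otimes>\<^sub>D Omega (- int t) (V r')
          \<cong>\<^sub>D Omega (int s - int t) (V (r + r')) \<oplus>\<^sub>D ((t + 1) * s) \<odot>\<^sub>D P (r + r'))"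
proof -
  have double: "x + x = 0" for x :: bit by (cases x) auto
  have ev: "of_nat m = (0 :: bit)" if "even m" for m
  proof -
    from that obtain k where "m = k + k" by (metis evenE mult_2)
    then show ?thesis by (simp only: of_nat_add double)
  qed
  have e: "r + r' + of_nat (s + t) + 1 = r + r' + 1" if "even (s + t)"
    by (simp only: ev[OF that] add_0_right)
  have o: "r + r' + of_nat (s + t) + 1 = r + r'" if "odd (s + t)"
  proof -
    have "of_nat (s + t) + 1 = (of_nat (s + t + 1) :: bit)" by (simp only: of_nat_add of_nat_1)
    also have "\<dots> = 0" by (rule ev) (use that in simp)
    finally show ?thesis by (simp only: add.assoc add_0_right)
  qed
  note T = Omega_tensor[OF char, of s r t r']
  show ?thesis
  proof (intro conjI impI)
    assume "even (s + t) \<and> s \<ge> t"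
    then have h: "even (s + t)" "t \<le> s" by auto
    show "Omega (int s) (V r :: 'k d4_mod) \<otimes>\<^sub>D Omega (- int t) (V r')
        \<cong>\<^sub>D Omega (int s - int t) (V (r + r')) \<oplus>\<^sub>D ((s + 1) * t) \<odot>\<^sub>D P (r + r' + 1)"
      using T unfolding e[OF h(1)] if_P[OF h(2)] .
  next
    assume "odd (s + t) \<and> s \<ge> t"
    then have h: "odd (s + t)" "t \<le> s" by auto
    show "Omega (int s) (V r :: 'k d4_mod) \<otimes>\<^sub>D Omega (- int t) (V r')
        \<cong>\<^sub>D Omega (int s - int t) (V (r + r')) \<oplus>\<^sub>D ((s + 1) * t) \<odot>\<^sub>D P (r + r')"
      using T unfolding o[OF h(1)] if_P[OF h(2)] .
  next
    assume "even (s + t) \<and> s < t"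
    then have h: "even (s + t)" "\<not> t \<le> s" by auto
    show "Omega (int s) (V r :: 'k d4_mod) \<otimes>\<^sub>D Omega (- int t) (V r')
        \<cong>\<^sub>D Omega (int s - int t) (V (r + r')) \<oplus>\<^sub>D ((t + 1) * s) \<odot>\<^sub>D P (r + r' + 1)"
      using T unfolding e[OF h(1)] if_not_P[OF h(2)] .
  next
    assume "odd (s + t) \<and> s < t"
    then have h: "odd (s + t)" "\<not> t \<le> s" by auto
    show "Omega (int s) (V r :: 'k d4_mod) \<otimes>\<^sub>D Omega (- int t) (V r')
        \<cong>\<^sub>D Omega (int s - int t) (V (r + r')) \<oplus>\<^sub>D ((t + 1) * s) \<odot>\<^sub>D P (r + r')"
      using T unfolding o[OF h(1)] if_not_P[OF h(2)] .
  qed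
qed

end
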